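(* (1) Any real Banach space of dimension at least $4$ which admits a complex structure up to isomorphism has an equivalent norm for which it admits exactly two complex structures up to isometry. (2) Any real Banach space which is isomorphic to a cartesian square has an equivalent norm for which it admits a unique complex structure up to isometry.
   Context: A real Banach space $X$ admits a complex structure up to isomorphism if there is a bounded $\mathbb{R}$-linear operator $I$ on $X$ with $I^2=-\mathrm{Id}$. For a given norm on $X$, a complex structure on $X$ in the isometric sense is a complex Banach space whose underlying real Banach space with its norm is $X$; it is given by an $\mathbb{R}$-linear map $I$ with $I^2=-\mathrm{Id}$ such that $\cos\theta\,\mathrm{Id}+\sin\theta\,I$ is an isometry for all $\theta\in\mathbb{R}$ (multiplication by $i$ being $I$), the corresponding complex space being denoted $X^I$. Two complex structures $X^I$ and $X^J$ are identified up to isometry if there is a surjective $\mathbb{C}$-linear isometry from $X^I$ onto $X^J$, equivalently if $J=PIP^{-1}$ for some surjective $\mathbb{R}$-linear isometry $P$ of $X$. In (1) and (2) the count is of complex structures in the isometric sense for the new norm, up to isometry. $X$ is isomorphic to a cartesian square if $X\simeq Z\oplus Z$ (as real Banach spaces) for some real Banach space $Z$. *)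

theory Defs
  imports "HOL-Analysis.Analysis"
begin

definition toplinear_iso :: "('a::real_normed_vector \<Rightarrow> 'b::real_normed_vector) \<Rightarrow> bool" where
  "toplinear_iso T \<longleftrightarrow> bounded_linear T \<and> bij T \<and> bounded_linear (inv T)"

text \<open>The library's \<^term>\<open>dim\<close> is 0 for infinite-dimensional spaces, which here have
  to count as spaces of dimension at least \<^term>\<open>n\<close>; so we refer to a Hamel basis.\<close>

definition dim_ge :: "nat \<Rightarrow> 'a::real_vector set \<Rightarrow> bool" where
  "dim_ge n S \<longleftrightarrow>
     (\<exists>B. B \<subseteq> S \<and> independent B \<and> S \<subseteq> span B \<and> (finite B \<longrightarrow> n \<le> card B))"

definition equivalent_norm :: "('a::real_normed_vector \<Rightarrow> real) \<Rightarrow> bool" where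
  "equivalent_norm N \<longleftrightarrow>
     (\<forall>x. N x = 0 \<longleftrightarrow> x = 0) \<and>
     (\<forall>c x. N (c *\<^sub>R x) = \<bar>c\<bar> * N x) \<and>
     (\<forall>x y. N (x + y) \<le> N x + N y) \<and>
     (\<exists>a>0. \<exists>b>0. \<forall>x. a * norm x \<le> N x \<and> N x \<le> b * norm x)"

definition linear_isometry :: "('a::real_vector \<Rightarrow> real) \<Rightarrow> ('a \<Rightarrow> 'a) \<Rightarrow> bool" where
  "linear_isometry N P \<longleftrightarrow> linear P \<and> (\<forall>x. N (P x) = N x)"

definition admits_complex_structure :: "'a::real_normed_vector itself \<Rightarrow> bool" where
  "admits_complex_structure _ \<longleftrightarrow> (\<exists>I :: 'a \<Rightarrow> 'a. bounded_linear I \<and> (\<forall>x. I (I x) = - x))"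

text \<open>A complex structure in the isometric sense is represented by its multiplication by
  \<open>i\<close>; the rotation condition says that the complex scalar multiplication
  \<open>(s + it) x = s x + t I x\<close> is homogeneous for \<open>N\<close>.\<close>

definition isometric_complex_structures :: "('a::real_vector \<Rightarrow> real) \<Rightarrow> ('a \<Rightarrow> 'a) set" where
  "isometric_complex_structures N =
     {I. linear I \<and> (\<forall>x. I (I x) = - x) \<and>
         (\<forall>\<theta>. linear_isometry N (\<lambda>x. cos \<theta> *\<^sub>R x + sin \<theta> *\<^sub>R I x))}"

text \<open>A real-linear \<open>P\<close> is complex-linear from \<open>X\<^sup>I\<close> to \<open>X\<^sup>J\<close> iff it intertwines the two
  multiplications by \<open>i\<close>.\<close>

definition isometric_structs_rel :: "('a::real_vector \<Rightarrow> real) \<Rightarrow> (('a \<Rightarrow> 'a) \<times> ('a \<Rightarrow> 'a)) set" where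
  "isometric_structs_rel N =
     {(I, J). I \<in> isometric_complex_structures N \<and> J \<in> isometric_complex_structures N \<and>
        (\<exists>P. linear_isometry N P \<and> surj P \<and> (\<forall>x. P (I x) = J (P x)))}"

definition complex_structures_upto_isometry :: "('a::real_vector \<Rightarrow> real) \<Rightarrow> ('a \<Rightarrow> 'a) set set" where
  "complex_structures_upto_isometry N =
     isometric_complex_structures N // isometric_structs_rel N"

lemma equiv_isometric_structs_rel:
  assumes "equivalent_norm N"
  shows "equiv (isometric_complex_structures N) (isometric_structs_rel N)"
proof (rule equivI)
  show "isometric_structs_rel N \<subseteq> isometric_complex_structures N \<times> isometric_complex_structures N"
    by (auto simp: isometric_structs_rel_def)
  show "refl_on (isometric_complex_structures N) (isometric_structs_rel N)"
    by (auto simp: refl_on_def isometric_structs_rel_def linear_isometry_def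
        intro!: exI[of _ "\<lambda>x. x"] linear_id[unfolded id_def])
  show "trans (isometric_structs_rel N)"
  proof (rule transI)
    fix I J K
    assume "(I, J) \<in> isometric_structs_rel N" "(J, K) \<in> isometric_structs_rel N"
    then obtain P Q where "linear P" "linear Q" and "surj P" "surj Q"
      and N: "\<forall>x. N (P x) = N x" "\<forall>x. N (Q x) = N x"
      and PQ: "\<forall>x. P (I x) = J (P x)" "\<forall>x. Q (J x) = K (Q x)"
      and IK: "I \<in> isometric_complex_structures N" "K \<in> isometric_complex_structures N"
      unfolding isometric_structs_rel_def linear_isometry_def by blast
    have "linear (Q \<circ> P)"
      using \<open>linear P\<close> \<open>linear Q\<close> by (rule linear_compose)
    moreover have "surj (Q \<circ> P)"
      using \<open>surj P\<close> \<open>surj Q\<close> by (rule comp_surj)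
    moreover have "\<forall>x. N ((Q \<circ> P) x) = N x" "\<forall>x. (Q \<circ> P) (I x) = K ((Q \<circ> P) x)"
      using N PQ by simp_all
    ultimately show "(I, K) \<in> isometric_structs_rel N"
      unfolding isometric_structs_rel_def linear_isometry_def
      using IK by (auto intro!: exI[of _ "Q \<circ> P"])
  qed
  show "sym (isometric_structs_rel N)"
  proof (rule symI)
    fix I J
    assume "(I, J) \<in> isometric_structs_rel N"
    then obtain P where P: "linear P" "surj P" "\<forall>x. N (P x) = N x" "\<forall>x. P (I x) = J (P x)"
      and IJ: "I \<in> isometric_complex_structures N" "J \<in> isometric_complex_structures N"
      unfolding isometric_structs_rel_def linear_isometry_def by blast
    have "x = 0" if "P x = 0" for x
      using that P(3) assms unfolding equivalent_norm_def by metis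
    with P(1) have "inj P"
      by (simp add: linear_injective_0)
    define Q where "Q = inv P"
    have PQ: "P (Q y) = y" for y
      using P(2) by (simp add: Q_def surj_f_inv_f)
    have QP: "Q (P x) = x" for x
      using \<open>inj P\<close> by (simp add: Q_def)
    have "linear Q"
    proof (rule linearI)
      fix y z c
      have "P (Q y + Q z) = y + z" "P (c *\<^sub>R Q y) = c *\<^sub>R y"
        using P(1) by (simp_all add: linear_add linear_scale PQ)
      then show "Q (y + z) = Q y + Q z" "Q (c *\<^sub>R y) = c *\<^sub>R Q y"
        using QP[of "Q y + Q z"] QP[of "c *\<^sub>R Q y"] by simp_all
    qed
    moreover have "surj Q"
      using QP by (rule surjI)
    moreover have "N (Q x) = N x" "Q (J x) = I (Q x)" for x
      using P(3)[rule_format, of "Q x"] P(4)[rule_format, of "Q x"] QP[of "I (Q x)"]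
      by (simp_all add: PQ)
    ultimately show "(J, I) \<in> isometric_structs_rel N"
      unfolding isometric_structs_rel_def linear_isometry_def using IJ by auto
  qed
qed

end

theory Submission
  imports Defs "HOL-Library.Equipollence"
begin

text \<open>The isometries \<open>cos t + sin t J\<close> that come with a complex structure \<open>J\<close> tend to the identity as
\<open>t\<close> tends to 0, so they cannot move an isolated feature of the unit ball. The features used here
are of the following kind. Fix a complex structure \<open>I\<close> and suppose that the norm agrees near a point
\<open>z\<close> with \<open>|\<phi>| + k\<close>, where \<open>\<phi>\<close> is \<open>I\<close>-linear and \<open>k\<close> is invariant under the group. Then
\<open>|\<phi>|\<close> is invariant near \<open>z\<close> for small \<open>t\<close>, and this forces \<open>\<phi> (J y) = \<phi> (I y)\<close> for all
\<open>y\<close> or \<open>\<phi> (J y) = - \<phi> (I y)\<close> for all \<open>y\<close> (lemma \<open>exposed_sign_preserved\<close>). If such exposed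
functionals separate points, \<open>J\<close> is determined by a choice of signs, and if some of their
linear combinations are exposed too, all signs agree, so that \<open>J = I\<close> or \<open>J = - I\<close>
(theorem \<open>structures_eq\<close>).

Such a supply of functionals exists in every space, separable or not. Take a maximal biorthogonal
system \<open>(x p, f p)\<close>, uniformly bounded when the dimension is infinite. The functionals \<open>f p\<close> need not
separate points. But a vector killed by all \<open>f p\<close> and by a family that norms the span of
the \<open>x p\<close> would extend the system, so adding such a family makes them separate points; and since the
span is a union of spans of finite sets, each of which has a finite norming set, the family can be
indexed by the infinite index set of the system itself (\<open>total_biorthogonal_system\<close>). Call its
members \<open>g p\<close>, scaled to be tiny. With a fixed index \<open>e\<close>, the functionals \<open>f p\<close> and
\<open>l p = f e / 2 + 3/4 f p + g p\<close> are exposed at \<open>x p\<close> and at \<open>x e + x p\<close> in a supremum norm, and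
the second kind both captures \<open>g p\<close> and links the sign of \<open>f p\<close> to that of \<open>f e\<close>.

The norm is the maximum of two terms: the maximum of the moduli of finitely many functionals \<open>V\<close>
in the span of one or two of the \<open>f p\<close>, and the supremum over all the other functionals plus a
small multiple of the moduli of these one or two. If \<open>X\<close> is a square \<open>Z + Z\<close>,
the functionals can be taken from \<open>Z\<close>; then \<open>(z, w) \<mapsto> (z, - w)\<close> is an isometry and identifies
\<open>I\<close> with \<open>- I\<close>. In the other part of the theorem no isometry \<open>P\<close> may satisfy \<open>P I = - I P\<close>.
Here two of the \<open>f p\<close> are available. The added multiple of their moduli makes the second term of the
maximum strictly convex in some direction in the kernel of any given functional, so only a member of
\<open>V\<close> can be exposed without an additional term, and \<open>P\<close> has to permute \<open>V\<close> up to conjugation and phases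
(\<open>antilinear_isometry_permutes_V\<close>). The set \<open>V\<close> consists of four functionals whose pairs have
determinants of different absolute values, so \<open>P\<close> fixes each modulus; but the four moduli
determine the product \<open>f e y * cnj (f e' y)\<close>, which a conjugate-linear map with this property cannot
preserve (\<open>no_antilinear_isometry\<close>).\<close>

section \<open>Hahn-Banach, compactness and finite subsets\<close>

text \<open>Enlarge \<open>U\<close> to a maximal subspace \<open>W\<close> that keeps the distance \<open>d\<close> from \<open>x\<close>. It turns out to be
a hyperplane complementary to \<open>x\<close>, and \<open>f\<close> is the coordinate along \<open>x\<close>.\<close>

lemma hahn_banach_dist:
  fixes x :: "'a::real_normed_vector"
  assumes U: "subspace U" and d: "d > 0" and far: "\<And>u. u \<in> U \<Longrightarrow> d \<le> norm (x - u)"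
  obtains f :: "'a \<Rightarrow> real" where "bounded_linear f" "f x = 1" "\<And>u. u \<in> U \<Longrightarrow> f u = 0"
    "\<And>y. \<bar>f y\<bar> \<le> norm y / d"
proof -
  define \<A> where "\<A> = {W. subspace W \<and> U \<subseteq> W \<and> (\<forall>w\<in>W. d \<le> norm (x - w))}"
  have "\<exists>W\<in>\<A>. \<forall>X\<in>\<A>. W \<subseteq> X \<longrightarrow> X = W"
  proof (rule subset_Zorn_nonempty)
    show "\<A> \<noteq> {}" using U far by (auto simp: \<A>_def)
  next
    fix \<C> assume ne: "\<C> \<noteq> {}" and ch: "subset.chain \<A> \<C>"
    have sub: "\<And>W. W \<in> \<C> \<Longrightarrow> W \<in> \<A>" using ch by (auto simp: subset.chain_def)
    have "subspace (\<Union>\<C>)"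
    proof (rule subspaceI)
      show "0 \<in> \<Union>\<C>" using ne sub by (auto simp: \<A>_def subspace_0)
    next
      fix y z assume "y \<in> \<Union>\<C>" "z \<in> \<Union>\<C>"
      then obtain Y Z where "Y \<in> \<C>" "Z \<in> \<C>" "y \<in> Y" "z \<in> Z" by auto
      moreover have "Y \<subseteq> Z \<or> Z \<subseteq> Y" using ch \<open>Y \<in> \<C>\<close> \<open>Z \<in> \<C>\<close> by (auto simp: subset.chain_def)
      ultimately obtain V where "V \<in> \<C>" "y \<in> V" "z \<in> V" by auto
      moreover have "y + z \<in> V" using calculation sub[of V] by (auto simp: \<A>_def subspace_add)
      ultimately show "y + z \<in> \<Union>\<C>" by blast
    next
      fix c y assume "y \<in> \<Union>\<C>"
      then obtain Y where Y: "Y \<in> \<C>" "y \<in> Y" by blast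
      then have "c *\<^sub>R y \<in> Y" using sub[of Y] by (simp add: \<A>_def subspace_scale)
      with Y(1) show "c *\<^sub>R y \<in> \<Union>\<C>" by blast
    qed
    then show "\<Union>\<C> \<in> \<A>" using ne sub by (auto simp: \<A>_def)
  qed
  then obtain W where W: "W \<in> \<A>" and maxW: "\<And>X. X \<in> \<A> \<Longrightarrow> W \<subseteq> X \<Longrightarrow> X = W" by blast
  have sW: "subspace W" and UW: "U \<subseteq> W" and dW: "\<And>w. w \<in> W \<Longrightarrow> d \<le> norm (x - w)"
    using W by (auto simp: \<A>_def)
  have key: "\<bar>a\<bar> * d \<le> norm (a *\<^sub>R x + w)" if "w \<in> W" for a w
  proof (cases "a = 0")
    case False
    have "- (1/a) *\<^sub>R w \<in> W" using sW that by (simp add: subspace_neg subspace_scale)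
    from dW[OF this] have "d \<le> norm ((1/a) *\<^sub>R (a *\<^sub>R x + w))" using False by (simp add: scaleR_add_right)
    also have "\<dots> = norm (a *\<^sub>R x + w) / \<bar>a\<bar>" by simp
    finally show ?thesis using False by (simp add: field_simps)
  qed simp
  have xW: "x \<notin> W" using dW[of x] d by auto
  have ex: "\<exists>s. y - s *\<^sub>R x \<in> W" for y
  proof -
    \<comment> \<open>The admissible \<open>s\<close> are those between the lower bounds in \<open>L\<close> and the corresponding upper bounds, as in the one-step extension of a dominated functional.\<close>
    define L where "L = (\<lambda>(b, w). - norm (b *\<^sub>R x + w + y) / d - b) ` (UNIV \<times> W)"
    have 0: "0 \<in> W" by (rule subspace_0[OF sW])
    have lu: "- norm (b *\<^sub>R x + w + y) / d - b \<le> norm (b' *\<^sub>R x + w' + y) / d - b'"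
      if "w \<in> W" "w' \<in> W" for b b' w w'
    proof -
      have "(b' - b) * d \<le> \<bar>b' - b\<bar> * d" using d by (simp add: mult_right_mono)
      also have "\<dots> \<le> norm ((b' - b) *\<^sub>R x + (w' - w))" using key that subspace_diff[OF sW] by blast
      also have "\<dots> = norm ((b' *\<^sub>R x + w' + y) - (b *\<^sub>R x + w + y))"
        by (rule arg_cong[of _ _ norm]) (simp add: algebra_simps)
      also have "\<dots> \<le> norm (b' *\<^sub>R x + w' + y) + norm (b *\<^sub>R x + w + y)" by (rule norm_triangle_ineq4)
      finally have "b' - b \<le> (norm (b' *\<^sub>R x + w' + y) + norm (b *\<^sub>R x + w + y)) / d"
        using d by (simp only: pos_le_divide_eq)
      then show ?thesis by (simp add: add_divide_distrib)
    qed
    define s where "s = Sup L"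
    have lo: "- norm (b *\<^sub>R x + w + y) / d - b \<le> s" if "w \<in> W" for b w
      unfolding s_def
    proof (rule cSup_upper)
      show "- norm (b *\<^sub>R x + w + y) / d - b \<in> L" using that by (auto simp: L_def image_iff)
      show "bdd_above L" unfolding bdd_above_def L_def using lu[OF _ 0, of _ _ 0] by auto
    qed
    have up: "s \<le> norm (b *\<^sub>R x + w + y) / d - b" if "w \<in> W" for b w
      unfolding s_def
    proof (rule cSup_least)
      show "L \<noteq> {}" using 0 by (auto simp: L_def)
    qed (use lu that in \<open>auto simp: L_def\<close>)
    have bs: "\<bar>b + s\<bar> * d \<le> norm (b *\<^sub>R x + w + y)" if "w \<in> W" for b w
      using lo[OF that, of b] up[OF that, of b] d by (auto simp: field_simps abs_if)
    define X where "X = span (insert (y - s *\<^sub>R x) W)"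
    have "X \<in> \<A>"
      unfolding \<A>_def
    proof (intro CollectI conjI ballI)
      show "subspace X" by (simp add: X_def)
      show "U \<subseteq> X" using UW by (auto simp: X_def intro: span_base)
      fix v assume "v \<in> X"
      then obtain k where "v - k *\<^sub>R (y - s *\<^sub>R x) \<in> span W" by (auto simp: X_def span_breakdown_eq)
      then obtain w where w: "w \<in> W" "v = w + k *\<^sub>R (y - s *\<^sub>R x)"
        using sW by (metis diff_add_cancel span_eq_iff)
      show "d \<le> norm (x - v)"
      proof (cases "k = 0")
        case True
        then show ?thesis using w dW by simp
      next
        case False
        define b where "b = - 1 / k - s"
        have "(1/k) *\<^sub>R w \<in> W" using sW w by (simp add: subspace_scale)
        from bs[OF this, of b]
        have "d / \<bar>k\<bar> \<le> norm (b *\<^sub>R x + (1/k) *\<^sub>R w + y)" by (simp add: b_def)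
        then have "d \<le> \<bar>k\<bar> * norm (b *\<^sub>R x + (1/k) *\<^sub>R w + y)" using False by (simp add: field_simps)
        also have "\<dots> = norm ((-k) *\<^sub>R (b *\<^sub>R x + (1/k) *\<^sub>R w + y))" by simp
        also have "(-k) *\<^sub>R (b *\<^sub>R x + (1/k) *\<^sub>R w + y) = x - v"
          using False by (simp add: w b_def algebra_simps)
        finally show ?thesis .
      qed
    qed
    moreover have "W \<subseteq> X" by (auto simp: X_def intro: span_base)
    ultimately have "X = W" by (rule maxW)
    then have "y - s *\<^sub>R x \<in> W" by (auto simp: X_def intro: span_base)
    then show ?thesis by blast
  qed
  define f where "f y = (SOME s. y - s *\<^sub>R x \<in> W)" for y
  have f: "y - f y *\<^sub>R x \<in> W" for y unfolding f_def using ex[of y] by (rule someI_ex)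
  have uniq: "f y = s" if "y - s *\<^sub>R x \<in> W" for y s
  proof (rule ccontr)
    assume ne: "f y \<noteq> s"
    have "(y - s *\<^sub>R x) - (y - f y *\<^sub>R x) \<in> W" using f that sW by (blast intro: subspace_diff)
    then have "(f y - s) *\<^sub>R x \<in> W" by (simp add: algebra_simps)
    then have "(1 / (f y - s)) *\<^sub>R ((f y - s) *\<^sub>R x) \<in> W" by (rule subspace_scale[OF sW])
    then show False using ne xW by simp
  qed
  have bnd: "\<bar>f y\<bar> \<le> norm y / d" for y
    using key[OF f, of "f y" y] d by (simp add: field_simps)
  have "bounded_linear f"
  proof (rule bounded_linear_intro)
    fix y z r
    have "(y - f y *\<^sub>R x) + (z - f z *\<^sub>R x) \<in> W" using f sW by (blast intro: subspace_add)
    then show "f (y + z) = f y + f z" by (intro uniq) (simp add: algebra_simps)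
    have "r *\<^sub>R (y - f y *\<^sub>R x) \<in> W" using f sW by (blast intro: subspace_scale)
    then show "f (r *\<^sub>R y) = r *\<^sub>R f y" by (intro uniq) (simp add: algebra_simps)
    show "norm (f y) \<le> norm y * (1/d)" using bnd by simp
  qed
  moreover have "f x = 1" using subspace_0[OF sW] by (intro uniq) simp
  moreover have "f u = 0" if "u \<in> U" for u using UW that by (intro uniq) auto
  ultimately show ?thesis using bnd that by blast
qed

corollary norming_functional:
  fixes x :: "'a::real_normed_vector"
  obtains f :: "'a \<Rightarrow> real" where "bounded_linear f" "f x = norm x" "\<And>y. \<bar>f y\<bar> \<le> norm y"
proof (cases "x = 0")
  case True
  then show ?thesis using that[of "\<lambda>_. 0"] by (auto simp: bounded_linear_zero)
next
  case False
  obtain f :: "'a \<Rightarrow> real" where f: "bounded_linear f" "f x = 1" "\<And>y. \<bar>f y\<bar> \<le> norm y / norm x"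
  proof (rule hahn_banach_dist[of "{0}" "norm x" x])
    show "norm x \<le> norm (x - u)" if "u \<in> {0}" for u using that by simp
  qed (use False in simp_all)
  have "bounded_linear (\<lambda>y. norm x * f y)" using f(1) by (rule bounded_linear_const_mult)
  then show ?thesis using f False by (intro that[of "\<lambda>y. norm x * f y"]) (auto simp: abs_mult field_simps)
qed

text \<open>This replaces the compactness of the unit ball of a finite-dimensional subspace: bounded coordinates
are available whenever there is a biorthogonal system.\<close>

lemma finite_combinations_in_compact:
  fixes w :: "'i \<Rightarrow> 'a::real_normed_vector"
  assumes "finite A"
  shows "\<exists>K. compact K \<and> (\<forall>c. (\<forall>p\<in>A. \<bar>c p\<bar> \<le> M) \<longrightarrow> (\<Sum>p\<in>A. c p *\<^sub>R w p) \<in> K)"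
  using assms
proof (induction A)
  case empty
  then show ?case by (intro exI[of _ "{0}"]) auto
next
  case (insert q A)
  then obtain K where K: "compact K" "\<And>c. (\<forall>p\<in>A. \<bar>c p\<bar> \<le> M) \<Longrightarrow> (\<Sum>p\<in>A. c p *\<^sub>R w p) \<in> K" by blast
  define L where "L = (\<lambda>t. t *\<^sub>R w q) ` {-M..M}"
  have "compact L" unfolding L_def by (intro compact_continuous_image continuous_intros) simp
  with K(1) have "compact {x + y |x y. x \<in> L \<and> y \<in> K}" by (rule compact_sums[rotated])
  moreover have "(\<Sum>p\<in>insert q A. c p *\<^sub>R w p) \<in> {x + y |x y. x \<in> L \<and> y \<in> K}"
    if "\<forall>p\<in>insert q A. \<bar>c p\<bar> \<le> M" for c
  proof -
    have "c q *\<^sub>R w q \<in> L" using that by (auto simp: L_def abs_le_iff)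
    moreover have "(\<Sum>p\<in>A. c p *\<^sub>R w p) \<in> K" using that by (intro K(2)) simp
    ultimately show ?thesis unfolding sum.insert[OF insert.hyps] by blast
  qed
  ultimately show ?case by blast
qed

text \<open>The sets with \<open>n + 1\<close> elements are images of pairs of a point and a set with \<open>n\<close> elements.\<close>

lemma Fpow_lepoll:
  includes cardinal_syntax
  assumes "infinite S"
  shows "Fpow S \<lesssim> S"
proof -
  define F where "F n = {X. X \<subseteq> S \<and> finite X \<and> card X = n}" for n
  have F: "|F n| \<le>o |S|" for n
  proof (induction n)
    case 0
    have "F 0 = {{}}" by (auto simp: F_def)
    then have "finite (F 0)" by simp
    then have "F 0 \<lesssim> S" using assms by (rule finite_lepoll_infinite[rotated])
    then show ?case by (simp add: lepoll_def card_of_ordLeq)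
  next
    case (Suc n)
    have "F (Suc n) \<subseteq> (\<lambda>(a, X). insert a X) ` (S \<times> F n)"
    proof
      fix X assume "X \<in> F (Suc n)"
      then have X: "X \<subseteq> S" "finite X" "card X = Suc n" by (auto simp: F_def)
      then obtain a where "a \<in> X" by fastforce
      with X have "X = insert a (X - {a})" "a \<in> S" "X - {a} \<in> F n" by (auto simp: F_def)
      then show "X \<in> (\<lambda>(a, X). insert a X) ` (S \<times> F n)" by blast
    qed
    then have "|F (Suc n)| \<le>o |S \<times> F n|" by (meson card_of_image card_of_mono1 ordLeq_transitive)
    also have "|S \<times> F n| \<le>o |S|"
      using card_of_Sigma_ordLeq_infinite[OF assms card_of_mono1[OF order_refl], of "\<lambda>_. F n"] Suc by simp
    finally show ?case .
  qed
  have "|\<Union>n. F n| \<le>o |S|"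
    using F infinite_iff_card_of_nat[of S] assms by (intro card_of_UNION_ordLeq_infinite[OF assms]) simp_all
  moreover have "Fpow S = (\<Union>n. F n)" by (auto simp: F_def Fpow_def)
  ultimately show ?thesis by (simp add: lepoll_def card_of_ordLeq)
qed

section \<open>Total families from maximal biorthogonal systems\<close>

text \<open>The pairs are vectors with their coordinate functionals. The operator \<open>I\<close> is either a complex
structure, and then the system is biorthogonal over the complex numbers, or it is zero, and then
the system is a real one.\<close>

definition biorthogonal :: "('z::real_normed_vector \<Rightarrow> 'z) \<Rightarrow> ('z \<times> ('z \<Rightarrow> real)) set \<Rightarrow> bool" where
  "biorthogonal I S \<longleftrightarrow>
     (\<forall>p\<in>S. bounded_linear (snd p) \<and> norm (fst p) = 1) \<and>
     (\<forall>p\<in>S. \<forall>q\<in>S. snd p (fst q) = of_bool (p = q) \<and> snd p (I (fst q)) = 0)"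

lemma biorthogonalD:
  assumes "biorthogonal I S" "p \<in> S"
  shows "bounded_linear (snd p)" "linear (snd p)" "norm (fst p) = 1"
    "q \<in> S \<Longrightarrow> snd p (fst q) = of_bool (p = q)" "q \<in> S \<Longrightarrow> snd p (I (fst q)) = 0"
  using assms bounded_linear.linear unfolding biorthogonal_def by blast+

lemma biorthogonal_maximal:
  fixes P :: "'z::real_normed_vector \<times> ('z \<Rightarrow> real) \<Rightarrow> bool"
  obtains S where "biorthogonal I S" "\<And>p. p \<in> S \<Longrightarrow> P p"
    "\<And>p. biorthogonal I (insert p S) \<Longrightarrow> P p \<Longrightarrow> p \<in> S"
proof -
  define \<A> where "\<A> = {S. biorthogonal I S \<and> (\<forall>p\<in>S. P p)}"
  have "\<exists>S\<in>\<A>. \<forall>X\<in>\<A>. S \<subseteq> X \<longrightarrow> X = S"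
  proof (rule subset_Zorn_nonempty)
    have "{} \<in> \<A>" by (simp add: \<A>_def biorthogonal_def)
    then show "\<A> \<noteq> {}" by blast
  next
    fix \<C> assume "\<C> \<noteq> {}" and ch: "subset.chain \<A> \<C>"
    have sub: "biorthogonal I W" "\<forall>p\<in>W. P p" if "W \<in> \<C>" for W
      using ch that by (auto simp: subset.chain_def \<A>_def)
    have "snd p (fst q) = of_bool (p = q) \<and> snd p (I (fst q)) = 0"
      if pq: "p \<in> \<Union>\<C>" "q \<in> \<Union>\<C>" for p q
    proof -
      obtain Y Z where YZ: "Y \<in> \<C>" "Z \<in> \<C>" "p \<in> Y" "q \<in> Z" using pq by blast
      have "Y \<subseteq> Z \<or> Z \<subseteq> Y" using ch YZ by (auto simp: subset.chain_def)
      then obtain V where "V \<in> \<C>" "p \<in> V" "q \<in> V" using YZ by blast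
      then show ?thesis using sub(1)[of V] by (simp add: biorthogonal_def)
    qed
    moreover have "bounded_linear (snd p) \<and> norm (fst p) = 1 \<and> P p" if "p \<in> \<Union>\<C>" for p
      using that sub by (auto simp: biorthogonal_def)
    ultimately show "\<Union>\<C> \<in> \<A>" unfolding \<A>_def biorthogonal_def by blast
  qed
  then obtain S where S: "S \<in> \<A>" and max: "\<And>X. X \<in> \<A> \<Longrightarrow> S \<subseteq> X \<Longrightarrow> X = S" by blast
  show ?thesis
  proof (rule that[of S])
    show "p \<in> S" if "biorthogonal I (insert p S)" "P p" for p
      using max[of "insert p S"] that S by (auto simp: \<A>_def)
  qed (use S in \<open>auto simp: \<A>_def\<close>)
qed

text \<open>Used to keep finitely many indices of an infinite system free of correction functionals.\<close>

lemma infinite_lepoll_Diff_finite: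
  assumes "finite A" "infinite S"
  shows "S \<lesssim> S - A"
  using assms
proof (induction A arbitrary: S)
  case (insert a A)
  have "S \<lesssim> insert a (S - {a})" by (rule subset_imp_lepoll) blast
  also have "insert a (S - {a}) \<approx> S - {a}"
    by (rule infinite_insert_eqpoll) (use insert.prems in simp)
  also have "S - {a} \<lesssim> S - {a} - A" by (rule insert.IH) (use insert.prems in simp)
  also have "S - {a} - A = S - insert a A" by blast
  finally show ?case .
qed simp

lemma UN_finite_lepoll:
  includes cardinal_syntax
  assumes "infinite S" "J \<lesssim> S" and fin: "\<And>j. j \<in> J \<Longrightarrow> finite (F j)"
  shows "(\<Union>j\<in>J. F j) \<lesssim> S"
proof -
  have "|J| \<le>o |S|" using assms(2) by (simp add: lepoll_def card_of_ordLeq)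
  moreover have "|F j| \<le>o |S|" if "j \<in> J" for j
    using finite_lepoll_infinite[OF assms(1) fin[OF that]] by (simp add: lepoll_def card_of_ordLeq)
  ultimately have "|\<Union>j\<in>J. F j| \<le>o |S|" by (intro card_of_UNION_ordLeq_infinite[OF assms(1)]) auto
  then show ?thesis by (simp add: lepoll_def card_of_ordLeq)
qed

lemma finite_total_imp_finite_dim:
  fixes T :: "('a::real_vector \<Rightarrow> real) set"
  assumes "finite T" and lin: "\<And>f. f \<in> T \<Longrightarrow> linear f" and total: "\<And>y. (\<And>f. f \<in> T \<Longrightarrow> f y = 0) \<Longrightarrow> y = 0"
  shows "\<exists>B. finite B \<and> span B = (UNIV :: 'a set)"
proof -
  have "\<exists>B. finite B \<and> (\<forall>y. \<exists>b\<in>span B. \<forall>f\<in>T. f (y - b) = 0)"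
    using assms(1) lin
  proof (induction T)
    case empty
    then show ?case by (intro exI[of _ "{}"]) auto
  next
    case (insert f T)
    obtain B where B: "finite B" "\<And>y. \<exists>b\<in>span B. \<forall>f\<in>T. f (y - b) = 0"
      using insert.IH insert.prems by blast
    have lf: "linear f" using insert.prems by simp
    show ?case
    proof (cases "\<exists>u. (\<forall>h\<in>T. h u = 0) \<and> f u \<noteq> 0")
      case True
      then obtain u where u: "\<And>h. h \<in> T \<Longrightarrow> h u = 0" "f u \<noteq> 0" by blast
      have "\<exists>c\<in>span (insert u B). \<forall>h\<in>insert f T. h (y - c) = 0" for y
      proof -
        obtain b where b: "b \<in> span B" "\<And>h. h \<in> T \<Longrightarrow> h (y - b) = 0" using B by blast
        define c where "c = b + (f (y - b) / f u) *\<^sub>R u"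
        have "c \<in> span (insert u B)" unfolding c_def
          by (intro span_add span_scale) (use b span_mono[of B "insert u B"] in \<open>auto intro: span_base\<close>)
        moreover have "f (y - c) = 0" using lf u(2)
          by (simp add: c_def linear_diff linear_add linear_scale)
        moreover have "h (y - c) = 0" if "h \<in> T" for h
        proof -
          have "linear h" using insert.prems that by simp
          then show ?thesis using u(1)[OF that] b(2)[OF that]
            by (simp add: c_def linear_diff linear_add linear_scale)
        qed
        ultimately show ?thesis by blast
      qed
      then show ?thesis using B(1) by (intro exI[of _ "insert u B"]) auto
    next
      case False
      have "\<forall>y. \<exists>b\<in>span B. \<forall>h\<in>insert f T. h (y - b) = 0" using B(2) False by blast
      then show ?thesis using B(1) by blast
    qed
  qed
  then obtain B where B: "finite B" "\<And>y. \<exists>b\<in>span B. \<forall>f\<in>T. f (y - b) = 0" by blast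
  have "y \<in> span B" for y
    using B(2)[of y] total[of "y - _"] by (metis eq_iff_diff_eq_0)
  then show ?thesis using B(1) by blast
qed

text \<open>One argument serves real and complex spaces: for \<open>I = 0\<close> all statements about \<open>I\<close> become
trivial and the real theory remains.\<close>

locale complex_or_trivial =
  fixes I :: "'z::real_normed_vector \<Rightarrow> 'z"
  assumes bounded_I: "bounded_linear I"
    and I_I: "(\<forall>y. I (I y) = - y) \<or> (\<forall>y. I y = 0)"
begin

lemma linear_I: "linear I"
  using bounded_I by (rule bounded_linear.linear)

definition K :: real where "K = 1 + onorm I"

lemma K_ge_1: "1 \<le> K"
  using onorm_pos_le[OF bounded_I] by (simp add: K_def)

lemma norm_I_le: "norm (I y) \<le> K * norm y"
proof -
  have "norm (I y) \<le> onorm I * norm y" by (rule onorm[OF bounded_I])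
  also have "\<dots> \<le> K * norm y" by (intro mult_right_mono) (simp_all add: K_def)
  finally show ?thesis .
qed

text \<open>For a complex structure this follows from \<open>(1 + b i) (1 - b i) x = (1 + b\<^sup>2) x\<close>.\<close>

lemma norm_le_complex_combination: "norm x \<le> 2 * K * norm (x - b *\<^sub>R I x)"
proof (cases "\<forall>y. I y = 0")
  case True
  have "1 * norm x \<le> 2 * K * norm x" using K_ge_1 by (intro mult_right_mono) auto
  then show ?thesis using True by simp
next
  case False
  with I_I have II: "I (I y) = - y" for y by blast
  define z where "z = x - b *\<^sub>R I x"
  have "(1 + b\<^sup>2) *\<^sub>R x = z + b *\<^sub>R I z"
    using linear_I by (simp add: z_def linear_diff linear_scale II algebra_simps power2_eq_square)
  then have "(1 + b\<^sup>2) * norm x = norm (z + b *\<^sub>R I z)"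
    by (metis abs_of_nonneg norm_scaleR add_nonneg_nonneg zero_le_one zero_le_power2)
  also have "\<dots> \<le> norm z + \<bar>b\<bar> * (K * norm z)"
    by (intro order_trans[OF norm_triangle_ineq] add_mono) (simp_all add: norm_I_le mult_left_mono)
  also have "\<dots> \<le> K * norm z + \<bar>b\<bar> * (K * norm z)"
    using K_ge_1 mult_right_mono[of 1 K "norm z"] by simp
  also have "\<dots> = (1 + \<bar>b\<bar>) * (K * norm z)" by (simp add: algebra_simps)
  also have "\<dots> \<le> (2 * (1 + b\<^sup>2)) * (K * norm z)"
  proof (rule mult_right_mono)
    have "0 \<le> (\<bar>b\<bar> - 1)\<^sup>2" by simp
    then have "2 * \<bar>b\<bar> \<le> 1 + b\<^sup>2" by (simp add: power2_eq_square algebra_simps)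
    moreover have "0 \<le> b\<^sup>2" by simp
    ultimately show "1 + \<bar>b\<bar> \<le> 2 * (1 + b\<^sup>2)" by argo
    show "0 \<le> K * norm z" using K_ge_1 by simp
  qed
  also have "\<dots> = (1 + b\<^sup>2) * (2 * K * norm z)" by simp
  finally show ?thesis unfolding z_def
    by (simp add: mult_le_cancel_left add_pos_nonneg not_less[symmetric])
qed

text \<open>The projection onto the span of the vectors and of their images under \<open>I\<close>. The coefficient of
\<open>I (fst p)\<close> is the imaginary part of \<open>snd p z - i snd p (I z)\<close>, hence the minus sign.\<close>

definition coord_proj :: "('z \<times> ('z \<Rightarrow> real)) set \<Rightarrow> 'z \<Rightarrow> 'z" where
  "coord_proj A z = (\<Sum>p\<in>A. snd p z *\<^sub>R fst p) - (\<Sum>p\<in>A. snd p (I z) *\<^sub>R I (fst p))"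

lemma coord_proj_generator:
  assumes "biorthogonal I S" "finite A" "A \<subseteq> S" "q \<in> A"
  shows "coord_proj A (fst q) = fst q" "coord_proj A (I (fst q)) = I (fst q)"
proof -
  have e: "snd p (fst q) = of_bool (p = q)" "snd p (I (fst q)) = 0" if "p \<in> A" for p
    using biorthogonalD(4,5)[OF assms(1)] assms(3,4) that by (meson subsetD)+
  have d: "(\<Sum>p\<in>A. of_bool (p = q) *\<^sub>R h p) = h q" for h :: "_ \<Rightarrow> 'z"
  proof -
    have "(\<Sum>p\<in>A. of_bool (p = q) *\<^sub>R h p) = (\<Sum>p\<in>A. if p = q then h p else 0)"
      by (intro sum.cong) auto
    then show ?thesis using assms by simp
  qed
  have "(\<Sum>p\<in>A. snd p (fst q) *\<^sub>R fst p) = fst q" using d[of fst] e by (simp cong: sum.cong)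
  then show "coord_proj A (fst q) = fst q" by (simp add: coord_proj_def e)
  have "(\<Sum>p\<in>A. snd p (I (I (fst q))) *\<^sub>R I (fst p)) = - I (fst q)"
  proof (cases "\<forall>y. I y = 0")
    case False
    with I_I have II: "I (I y) = - y" for y by blast
    have "snd p (- fst q) = - of_bool (p = q)" if "p \<in> A" for p
      using e(1)[OF that] assms that
      by (auto simp: biorthogonal_def linear_neg bounded_linear.linear)
    then show ?thesis using d[of "\<lambda>p. I (fst p)"] by (simp add: II sum_negf cong: sum.cong)
  qed simp
  then show "coord_proj A (I (fst q)) = I (fst q)" by (simp add: coord_proj_def e)
qed

lemma bounded_linear_coord_proj:
  assumes "biorthogonal I S" "finite A" "A \<subseteq> S"
  shows "bounded_linear (coord_proj A)"
proof -
  have "bounded_linear (snd p)" if "p \<in> A" for p using assms that by (auto simp: biorthogonal_def)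
  then show ?thesis unfolding coord_proj_def
    by (intro bounded_linear_sub bounded_linear_sum bounded_linear_compose[OF bounded_linear_scaleR_left]
        bounded_linear_compose[OF _ bounded_I]) auto
qed

lemma coord_proj_span:
  assumes "biorthogonal I S" "finite A" "A \<subseteq> S" and v: "v \<in> span (fst ` A \<union> (I \<circ> fst) ` A)"
  shows "coord_proj A v = v"
proof -
  have "linear (\<lambda>z. coord_proj A z - z)"
    using bounded_linear_coord_proj[OF assms(1-3)]
    by (intro linear_compose_sub linear_ident) (rule bounded_linear.linear)
  then have "coord_proj A v - v = 0"
    by (rule linear_eq_0_on_span[OF _ _ v]) (use coord_proj_generator[OF assms(1-3)] in auto)
  then show ?thesis by simp
qed

lemma insert_biorthogonal:
  assumes S: "biorthogonal I S" and h: "bounded_linear h" and x: "norm x = 1" "h x = 1" "h (I x) = 0"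
    and hS: "\<And>p. p \<in> S \<Longrightarrow> h (fst p) = 0" "\<And>p. p \<in> S \<Longrightarrow> h (I (fst p)) = 0"
    and Sx: "\<And>p. p \<in> S \<Longrightarrow> snd p x = 0" "\<And>p. p \<in> S \<Longrightarrow> snd p (I x) = 0"
  shows "biorthogonal I (insert (x, h) S)" "(x, h) \<notin> S"
proof -
  show *: "(x, h) \<notin> S" using Sx(1)[of "(x, h)"] x by auto
  then show "biorthogonal I (insert (x, h) S)"
    using assms unfolding biorthogonal_def by (auto simp: of_bool_def)
qed

text \<open>A maximal system is total here: if all its functionals kill \<open>x\<close> and \<open>I x\<close>, composing a functional
with the complementary projection of the finite system yields one more biorthogonal pair. The
norms of the functionals are not controlled by \<open>I\<close>, but a finite system is bounded in any case.\<close>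

lemma finite_dim_total_biorthogonal:
  assumes B: "finite B" "span B = (UNIV :: 'z set)"
  obtains S where "biorthogonal I S" "finite S"
    "\<And>y. (\<And>p. p \<in> S \<Longrightarrow> snd p y = 0 \<and> snd p (I y) = 0) \<Longrightarrow> y = 0"
proof -
  obtain S where S: "biorthogonal I S" and max: "\<And>p. biorthogonal I (insert p S) \<Longrightarrow> p \<in> S"
    by (rule biorthogonal_maximal[of I "\<lambda>_. True"]) blast
  have inj: "inj_on fst S"
  proof (rule inj_onI)
    fix p q assume pq: "p \<in> S" "q \<in> S" "fst p = fst q"
    then have "snd p (fst q) = 1" using biorthogonalD(4)[OF S, of p p] by simp
    then show "p = q" using biorthogonalD(4)[OF S pq(1,2)] by (simp add: of_bool_def split: if_splits)
  qed
  have "independent (fst ` S)"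
    unfolding independent_explicit_module
  proof (intro allI impI)
    fix t u v assume t: "finite t" "t \<subseteq> fst ` S" "(\<Sum>v\<in>t. u v *\<^sub>R v) = 0" "v \<in> t"
    then obtain p where p: "p \<in> S" "v = fst p" by auto
    have lp: "linear (snd p)" using S p by (auto simp: biorthogonal_def bounded_linear.linear)
    have "snd p w = of_bool (w = v)" if w: "w \<in> t" for w
    proof -
      obtain q where q: "q \<in> S" "w = fst q" using w t by auto
      then show ?thesis using S p inj by (auto simp: biorthogonal_def inj_on_eq_iff)
    qed
    then have "0 = (\<Sum>w\<in>t. u w * of_bool (w = v))"
      using arg_cong[OF t(3), of "snd p"] lp by (simp add: linear_sum linear_scale linear_0 cong: sum.cong)
    also have "\<dots> = u v" using t by (simp add: of_bool_def if_distrib cong: if_cong)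
    finally show "u v = 0" by simp
  qed
  then have "finite (fst ` S)" using independent_span_bound[OF B(1)] B(2) by auto
  then have finS: "finite S" using inj by (rule finite_imageD)
  have "y = 0" if y: "\<And>p. p \<in> S \<Longrightarrow> snd p y = 0 \<and> snd p (I y) = 0" for y
  proof (rule ccontr)
    assume "y \<noteq> 0"
    define x where "x = (1 / norm y) *\<^sub>R y"
    have x1: "norm x = 1" using \<open>y \<noteq> 0\<close> by (simp add: x_def)
    have Sx: "snd p x = 0" "snd p (I x) = 0" if "p \<in> S" for p
      using y[OF that] S that linear_I
      by (auto simp: x_def biorthogonal_def linear_scale bounded_linear.linear)
    have lin: "linear (snd p)" if "p \<in> S" for p using S that by (auto simp: biorthogonal_def bounded_linear.linear)
    have SII: "snd p (I (I x)) = 0" if "p \<in> S" for p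
      using I_I
    proof
      assume "\<forall>y. I (I y) = - y"
      then show ?thesis using Sx(1)[OF that] linear_neg[OF lin[OF that], of x] by simp
    next
      assume "\<forall>y. I y = 0"
      then show ?thesis using linear_0[OF lin[OF that]] by simp
    qed
    obtain h where h: "bounded_linear h" "h x = 1" "\<And>u. u \<in> span {I x} \<Longrightarrow> h u = 0"
      "\<And>y. \<bar>h y\<bar> \<le> norm y / (1 / (2 * K))"
    proof (rule hahn_banach_dist[of "span {I x}" "1 / (2 * K)" x])
      fix u assume "u \<in> span {I x}"
      then obtain b where "u = b *\<^sub>R I x" by (auto simp: span_singleton)
      then show "1 / (2 * K) \<le> norm (x - u)"
        using norm_le_complex_combination[of x b] K_ge_1 x1 by (simp add: field_simps)
    qed (use K_ge_1 in simp_all)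
    define k where "k z = h (z - coord_proj S z)" for z
    have Q0: "coord_proj S x = 0" "coord_proj S (I x) = 0" using Sx SII by (simp_all add: coord_proj_def)
    have "bounded_linear k" unfolding k_def
      by (intro bounded_linear_compose[OF h(1)] bounded_linear_sub bounded_linear_ident
          bounded_linear_coord_proj[OF S finS order_refl])
    moreover have "k x = 1" "k (I x) = 0" using h by (simp_all add: k_def Q0 span_base)
    moreover have "k (fst p) = 0" "k (I (fst p)) = 0" if "p \<in> S" for p
      using coord_proj_generator[OF S finS order_refl that] h(1)
      by (simp_all add: k_def linear_0 bounded_linear.linear)
    ultimately have "biorthogonal I (insert (x, k) S)" "(x, k) \<notin> S"
      using insert_biorthogonal[OF S _ x1] Sx by blast+
    then show False using max by blast
  qed
  then show ?thesis using that S finS by blast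
qed

text \<open>The unit ball of the span lies in a compact set because the coordinates are bounded, and the
norming functionals of a \<open>1/4\<close>-net norm all its unit vectors up to the factor \<open>1/2\<close>.\<close>

lemma finite_norming_set:
  assumes S: "biorthogonal I S" and C: "0 \<le> C" "\<And>p y. p \<in> S \<Longrightarrow> \<bar>snd p y\<bar> \<le> C * norm y"
    and A: "finite A" "A \<subseteq> S"
  shows "\<exists>G. finite G \<and> (\<forall>g\<in>G. bounded_linear g \<and> (\<forall>y. \<bar>g y\<bar> \<le> norm y)) \<and>
    (\<forall>v\<in>span (fst ` A \<union> (I \<circ> fst) ` A). \<exists>g\<in>G. norm v \<le> 2 * \<bar>g v\<bar>)"
proof -
  define M where "M = C * K"
  obtain K1 K2 where K12: "compact K1" "compact K2"
      "\<And>c. (\<forall>p\<in>A. \<bar>c p\<bar> \<le> M) \<Longrightarrow> (\<Sum>p\<in>A. c p *\<^sub>R fst p) \<in> K1"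
      "\<And>c. (\<forall>p\<in>A. \<bar>c p\<bar> \<le> M) \<Longrightarrow> (\<Sum>p\<in>A. c p *\<^sub>R I (fst p)) \<in> K2"
    using finite_combinations_in_compact[OF A(1), of M fst]
      finite_combinations_in_compact[OF A(1), of M "\<lambda>p. I (fst p)"] by blast
  define L where "L = {x - y |x y. x \<in> K1 \<and> y \<in> K2}"
  have "compact L" using K12 unfolding L_def by (intro compact_differences)
  then obtain D where D: "finite D" "L \<subseteq> (\<Union>d\<in>D. ball d (1/4))"
    unfolding compact_eq_totally_bounded by (metis zero_less_divide_1_iff zero_less_numeral)
  have "\<exists>g :: 'z \<Rightarrow> real. bounded_linear g \<and> g d = norm d \<and> (\<forall>y. \<bar>g y\<bar> \<le> norm y)" for d
    using norming_functional[of d] by blast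
  then obtain g :: "'z \<Rightarrow> 'z \<Rightarrow> real" where g: "bounded_linear (g d)" "g d d = norm d" "\<bar>g d y\<bar> \<le> norm y" for d y
    by metis
  have unit: "\<exists>d\<in>D. 1 \<le> 2 * \<bar>g d v\<bar>" if v: "v \<in> span (fst ` A \<union> (I \<circ> fst) ` A)" "norm v = 1" for v
  proof -
    have "C * 1 \<le> C * K" using K_ge_1 C(1) by (intro mult_left_mono)
    then have b1: "\<bar>snd p v\<bar> \<le> M" if "p \<in> A" for p
      using C(2)[of p v] A v that by (auto simp: M_def)
    have b2: "\<bar>snd p (I v)\<bar> \<le> M" if "p \<in> A" for p
    proof -
      have "C * norm (I v) \<le> C * K" using norm_I_le[of v] v C(1) by (intro mult_left_mono) auto
      then show ?thesis using C(2)[of p "I v"] A that by (auto simp: M_def)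
    qed
    have "coord_proj A v \<in> L" unfolding coord_proj_def L_def
      using K12(3)[of "\<lambda>p. snd p v"] K12(4)[of "\<lambda>p. snd p (I v)"] b1 b2 by blast
    then have "v \<in> L" using coord_proj_span[OF S A v(1)] by simp
    then obtain d where d: "d \<in> D" "norm (d - v) < 1/4" using D by (auto simp: dist_norm)
    have "g d (d - v) = norm d - g d v" using g by (simp add: linear_diff bounded_linear.linear)
    then have "norm d - g d v \<le> 1/4" using g(3)[of d "d - v"] d by linarith
    moreover have "norm v - norm d \<le> 1/4" using norm_triangle_ineq2[of v d] d by (simp add: norm_minus_commute)
    ultimately have "1 \<le> 2 * \<bar>g d v\<bar>" using v by linarith
    then show ?thesis using d by blast
  qed
  have "\<exists>h\<in>insert (\<lambda>_. 0) (g ` D). norm v \<le> 2 * \<bar>h v\<bar>" if v: "v \<in> span (fst ` A \<union> (I \<circ> fst) ` A)" for v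
  proof (cases "v = 0")
    case False
    obtain d where d: "d \<in> D" "1 \<le> 2 * \<bar>g d ((1 / norm v) *\<^sub>R v)\<bar>"
      using unit[of "(1 / norm v) *\<^sub>R v"] v False by (auto intro: span_scale)
    have "g d ((1 / norm v) *\<^sub>R v) = g d v / norm v"
      using g(1)[of d] by (simp add: linear_scale bounded_linear.linear)
    then have "norm v \<le> 2 * \<bar>g d v\<bar>" using d(2) False by (simp add: abs_div_pos[symmetric] pos_le_divide_eq)
    then show ?thesis using d by blast
  qed auto
  then show ?thesis using D(1) g
    by (intro exI[of _ "insert (\<lambda>_. 0) (g ` D)"]) (auto simp: bounded_linear_zero)
qed

text \<open>A unit vector \<open>x\<close> killed by the system and by the norming family \<open>G\<close> is far from the span of the
system, since some member of \<open>G\<close> sees a given vector of the span but not \<open>x\<close>. So Hahn-Banach gives a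
coordinate functional for \<open>x\<close> that vanishes on the span, with a bound that depends on \<open>I\<close> only. The
constant \<open>6 K\<close> is \<open>2 K\<close> from the distance between \<open>x\<close> and the multiples of \<open>I x\<close>, times 3 from the
factor \<open>2\<close> in the norming condition.\<close>

lemma maximal_with_norming_total:
  assumes S: "biorthogonal I S" "\<And>p y. p \<in> S \<Longrightarrow> \<bar>snd p y\<bar> \<le> 6 * K * norm y"
    and max: "\<And>p. biorthogonal I (insert p S) \<Longrightarrow> (\<And>y. \<bar>snd p y\<bar> \<le> 6 * K * norm y) \<Longrightarrow> p \<in> S"
    and G: "\<And>g. g \<in> G \<Longrightarrow> bounded_linear g" "\<And>g y. g \<in> G \<Longrightarrow> \<bar>g y\<bar> \<le> norm y"
    and norming: "\<And>v. v \<in> span (fst ` S \<union> (I \<circ> fst) ` S) \<Longrightarrow> \<exists>g\<in>G. norm v \<le> 2 * \<bar>g v\<bar>"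
    and yS: "\<And>p. p \<in> S \<Longrightarrow> snd p y = 0 \<and> snd p (I y) = 0"
    and yG: "\<And>g. g \<in> G \<Longrightarrow> g y = 0 \<and> g (I y) = 0"
  shows "y = 0"
proof (rule ccontr)
  assume "y \<noteq> 0"
  define x where "x = (1 / norm y) *\<^sub>R y"
  have x1: "norm x = 1" using \<open>y \<noteq> 0\<close> by (simp add: x_def)
  have Sx: "snd p x = 0" "snd p (I x) = 0" if "p \<in> S" for p
    using yS[OF that] S that linear_I
    by (auto simp: x_def biorthogonal_def linear_scale bounded_linear.linear)
  have Gx: "g x = 0" "g (I x) = 0" if "g \<in> G" for g
    using yG[OF that] G(1)[OF that] linear_I
    by (auto simp: x_def linear_scale bounded_linear.linear)
  define W where "W = fst ` S \<union> (I \<circ> fst) ` S"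
  have far: "1 / (6 * K) \<le> norm (x - u)" if u: "u \<in> span (insert (I x) W)" for u
  proof -
    obtain b where "u - b *\<^sub>R I x \<in> span W" using u unfolding span_breakdown_eq by blast
    then obtain v where v: "v \<in> span W" "u = v + b *\<^sub>R I x" by (metis diff_add_cancel)
    define z where "z = x - b *\<^sub>R I x"
    obtain g where g: "g \<in> G" "norm v \<le> 2 * \<bar>g v\<bar>" using norming v(1) W_def by blast
    have "g z = 0" using G(1)[OF g(1)] Gx[OF g(1)]
      by (simp add: z_def linear_diff linear_scale bounded_linear.linear)
    then have "\<bar>g v\<bar> = \<bar>g (z - v)\<bar>" using G(1)[OF g(1)] by (simp add: linear_diff bounded_linear.linear)
    also have "\<dots> \<le> norm (z - v)" using G(2)[OF g(1)] .
    finally have "norm v \<le> 2 * norm (z - v)" using g(2) by simp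
    moreover have "norm z \<le> norm v + norm (z - v)" using norm_triangle_sub by blast
    ultimately have "norm z \<le> 3 * norm (z - v)" by simp
    then have "2 * K * norm z \<le> 2 * K * (3 * norm (z - v))" using K_ge_1 by (intro mult_left_mono) auto
    then have "1 \<le> 6 * K * norm (z - v)"
      using norm_le_complex_combination[of x b] x1 by (simp add: z_def)
    moreover have "z - v = x - u" by (simp add: z_def v)
    ultimately show ?thesis using K_ge_1 by (simp add: field_simps)
  qed
  obtain h where h: "bounded_linear h" "h x = 1" "\<And>u. u \<in> span (insert (I x) W) \<Longrightarrow> h u = 0"
      "\<And>y. \<bar>h y\<bar> \<le> norm y / (1 / (6 * K))"
  proof (rule hahn_banach_dist[of "span (insert (I x) W)" "1 / (6 * K)" x])
    show "1 / (6 * K) \<le> norm (x - u)" if "u \<in> span (insert (I x) W)" for u using far[OF that] .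
  qed (use K_ge_1 in simp_all)
  have "h (I x) = 0" "h (fst p) = 0" "h (I (fst p)) = 0" if "p \<in> S" for p
    using that by (auto intro!: h(3) span_base simp: W_def)
  moreover have "h (I x) = 0" by (auto intro!: h(3) span_base)
  ultimately have "biorthogonal I (insert (x, h) S)" "(x, h) \<notin> S"
    using insert_biorthogonal[OF S(1) h(1) x1 h(2)] Sx by blast+
  moreover have "\<bar>h y\<bar> \<le> 6 * K * norm y" for y using h(4)[of y] by (simp add: mult.commute)
  ultimately show False using max[of "(x, h)"] by simp
qed

text \<open>The functionals \<open>g p\<close> make up for the possible failure of totality of the system. That they can be
indexed by the system, even after any finite set of indices is removed, is what allows them to be
absorbed into the functionals of the system below.\<close>

theorem total_biorthogonal_system:
  obtains S C where "biorthogonal I S" "1 \<le> C" "\<And>p y. p \<in> S \<Longrightarrow> \<bar>snd p y\<bar> \<le> C * norm y"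
    "\<And>A. finite A \<Longrightarrow> \<exists>g. (\<forall>p\<in>S - A. bounded_linear (g p) \<and> (\<forall>y. \<bar>g p y\<bar> \<le> norm y)) \<and>
       (\<forall>y. (\<forall>p\<in>S. snd p y = 0 \<and> snd p (I y) = 0) \<longrightarrow> (\<forall>p\<in>S - A. g p y = 0 \<and> g p (I y) = 0) \<longrightarrow> y = 0)"
proof (cases "\<exists>B. finite B \<and> span B = (UNIV :: 'z set)")
  case True
  then obtain S where S: "biorthogonal I S" "finite S"
    "\<And>y. (\<And>p. p \<in> S \<Longrightarrow> snd p y = 0 \<and> snd p (I y) = 0) \<Longrightarrow> y = 0"
    using finite_dim_total_biorthogonal by blast
  have bl: "bounded_linear (snd p)" if "p \<in> S" for p using S(1) that by (simp add: biorthogonal_def)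
  define C where "C = 1 + (\<Sum>p\<in>S. onorm (snd p))"
  have "onorm (snd p) \<le> C" if "p \<in> S" for p
    using member_le_sum[OF that, of "\<lambda>p. onorm (snd p)"] onorm_pos_le[OF bl] S(2) by (auto simp: C_def)
  then have "\<bar>snd p y\<bar> \<le> C * norm y" if "p \<in> S" for p y
    using onorm[OF bl[OF that], of y] mult_right_mono[of "onorm (snd p)" C "norm y"] that by fastforce
  moreover have "1 \<le> C" unfolding C_def using onorm_pos_le[OF bl] by (simp add: sum_nonneg)
  ultimately show ?thesis
    using S by (intro that[of S C]) (auto intro!: exI[of _ "\<lambda>_ _. 0"] bounded_linear_zero)
next
  case infinite_dim: False
  obtain S where S: "biorthogonal I S" and bdd: "\<And>p. p \<in> S \<Longrightarrow> \<forall>y. \<bar>snd p y\<bar> \<le> 6 * K * norm y"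
    and max: "\<And>p. biorthogonal I (insert p S) \<Longrightarrow> \<forall>y. \<bar>snd p y\<bar> \<le> 6 * K * norm y \<Longrightarrow> p \<in> S"
    by (rule biorthogonal_maximal[of I "\<lambda>p. \<forall>y. \<bar>snd p y\<bar> \<le> 6 * K * norm y"]) blast
  have "\<forall>A\<in>Fpow S. \<exists>G. finite G \<and> (\<forall>g\<in>G. bounded_linear g \<and> (\<forall>y. \<bar>g y\<bar> \<le> norm y)) \<and>
    (\<forall>v\<in>span (fst ` A \<union> (I \<circ> fst) ` A). \<exists>g\<in>G. norm v \<le> 2 * \<bar>g v\<bar>)"
    using finite_norming_set[OF S, of "6 * K"] bdd K_ge_1 by (auto simp: Fpow_def)
  then obtain \<G> where fin\<G>: "\<And>A. A \<in> Fpow S \<Longrightarrow> finite (\<G> A)"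
    and \<G>: "\<And>A. A \<in> Fpow S \<Longrightarrow> \<forall>g\<in>\<G> A. bounded_linear g \<and> (\<forall>y. \<bar>g y\<bar> \<le> norm y)"
    and \<G>n: "\<And>A v. A \<in> Fpow S \<Longrightarrow> v \<in> span (fst ` A \<union> (I \<circ> fst) ` A) \<Longrightarrow> \<exists>g\<in>\<G> A. norm v \<le> 2 * \<bar>g v\<bar>"
    by metis
  define G where "G = (\<Union>A\<in>Fpow S. \<G> A)"
  have Gb: "bounded_linear g" "\<bar>g y\<bar> \<le> norm y" if "g \<in> G" for g y using that \<G> by (auto simp: G_def)
  have norming: "\<exists>g\<in>G. norm v \<le> 2 * \<bar>g v\<bar>" if "v \<in> span (fst ` S \<union> (I \<circ> fst) ` S)" for v
  proof -
    have "\<exists>A\<in>Fpow S. v \<in> span (fst ` A \<union> (I \<circ> fst) ` A)"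
      using that
    proof (induction rule: span_induct_alt)
      case base
      show ?case by (rule bexI[of _ "{}"]) (auto simp: Fpow_def)
    next
      case (step c x y)
      then obtain A p where A: "A \<in> Fpow S" "y \<in> span (fst ` A \<union> (I \<circ> fst) ` A)"
        and p: "p \<in> S" "x = fst p \<or> x = I (fst p)" by auto
      have "y \<in> span (fst ` insert p A \<union> (I \<circ> fst) ` insert p A)"
        using A(2) span_mono[of "fst ` A \<union> (I \<circ> fst) ` A" "fst ` insert p A \<union> (I \<circ> fst) ` insert p A"] by blast
      moreover have "x \<in> span (fst ` insert p A \<union> (I \<circ> fst) ` insert p A)" using p(2) by (auto intro: span_base)
      ultimately have "c *\<^sub>R x + y \<in> span (fst ` insert p A \<union> (I \<circ> fst) ` insert p A)"
        by (intro span_add span_scale)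
      moreover have "insert p A \<in> Fpow S" using A p by (auto simp: Fpow_def)
      ultimately show ?case by blast
    qed
    then show ?thesis using \<G>n unfolding G_def by blast
  qed
  have total: "y = 0" if "\<And>p. p \<in> S \<Longrightarrow> snd p y = 0 \<and> snd p (I y) = 0"
    "\<And>g. g \<in> G \<Longrightarrow> g y = 0 \<and> g (I y) = 0" for y
  proof (rule maximal_with_norming_total[of S G y, OF S])
    show "p \<in> S" if "biorthogonal I (insert p S)" "\<And>y. \<bar>snd p y\<bar> \<le> 6 * K * norm y" for p
      using max that by blast
    show "\<bar>snd p y\<bar> \<le> 6 * K * norm y" if "p \<in> S" for p y using bdd that by blast
  qed (fact Gb norming that)+
  \<comment> \<open>A finite system would make finitely many functionals total, and the space finite-dimensional.\<close>
  have infS: "infinite S"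
  proof
    assume finS: "finite S"
    then have "finite (Fpow S)" by (simp add: Fpow_Pow_finite)
    then have "finite G" using fin\<G> by (simp add: G_def)
    define T where "T = snd ` S \<union> (\<lambda>p. snd p \<circ> I) ` S \<union> G \<union> (\<lambda>g. g \<circ> I) ` G"
    have "finite T" using finS \<open>finite G\<close> by (simp add: T_def)
    moreover have "linear f" if "f \<in> T" for f
    proof -
      have "linear h" if "h \<in> snd ` S \<union> G" for h
        using that biorthogonalD(2)[OF S] Gb(1) bounded_linear.linear by blast
      moreover have "\<exists>h\<in>snd ` S \<union> G. f = h \<or> f = h \<circ> I" using that by (auto simp: T_def)
      ultimately show ?thesis using linear_compose[OF linear_I] by blast
    qed
    moreover have "y = 0" if y: "\<And>f. f \<in> T \<Longrightarrow> f y = 0" for y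
    proof (rule total)
      show "snd p y = 0 \<and> snd p (I y) = 0" if "p \<in> S" for p
        using y[of "snd p"] y[of "snd p \<circ> I"] that unfolding T_def comp_def by blast
      show "g y = 0 \<and> g (I y) = 0" if "g \<in> G" for g
        using y[of g] y[of "g \<circ> I"] that unfolding T_def comp_def by blast
    qed
    ultimately have "\<exists>B. finite B \<and> span B = (UNIV :: 'z set)" by (rule finite_total_imp_finite_dim)
    with infinite_dim show False ..
  qed
  have GS: "G \<lesssim> S"
    unfolding G_def using infS Fpow_lepoll[OF infS] fin\<G> by (rule UN_finite_lepoll)
  have "\<exists>g. (\<forall>p\<in>S - A. bounded_linear (g p) \<and> (\<forall>y. \<bar>g p y\<bar> \<le> norm y)) \<and>
       (\<forall>y. (\<forall>p\<in>S. snd p y = 0 \<and> snd p (I y) = 0) \<longrightarrow> (\<forall>p\<in>S - A. g p y = 0 \<and> g p (I y) = 0) \<longrightarrow> y = 0)"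
    if A: "finite A" for A
  proof -
    have "S \<lesssim> S - A" by (rule infinite_lepoll_Diff_finite[OF A infS])
    with GS have "G \<lesssim> S - A" by (rule lepoll_trans)
    then obtain g where g: "G \<subseteq> g ` (S - A)" unfolding lepoll_iff by blast
    define g' where "g' p = (if g p \<in> G then g p else (\<lambda>_. 0))" for p
    have "G \<subseteq> g' ` (S - A)"
    proof
      fix h assume "h \<in> G"
      then obtain p where "p \<in> S - A" "h = g p" using g by auto
      with \<open>h \<in> G\<close> show "h \<in> g' ` (S - A)" by (intro image_eqI[of _ _ p]) (auto simp: g'_def)
    qed
    moreover have "bounded_linear (g' p)" "\<bar>g' p y\<bar> \<le> norm y" for p y
      using Gb by (auto simp: g'_def bounded_linear_zero)
    moreover have "y = 0" if "\<forall>p\<in>S. snd p y = 0 \<and> snd p (I y) = 0"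
      "\<forall>p\<in>S - A. g' p y = 0 \<and> g' p (I y) = 0" for y
    proof (rule total)
      show "snd p y = 0 \<and> snd p (I y) = 0" if "p \<in> S" for p using \<open>\<forall>p\<in>S. _ p\<close> that by blast
      fix h assume "h \<in> G"
      with \<open>G \<subseteq> g' ` (S - A)\<close> obtain p where "p \<in> S - A" "h = g' p" by blast
      then show "h y = 0 \<and> h (I y) = 0" using that(2) by simp
    qed
    ultimately show ?thesis by (intro exI[of _ g'] conjI allI impI ballI) blast+
  qed
  then show ?thesis using bdd K_ge_1 by (intro that[OF S, of "6 * K"]) simp_all
qed

end

section \<open>Complex functionals and points where they give the norm\<close>

definition complex_functional :: "('a::real_normed_vector \<Rightarrow> 'a) \<Rightarrow> ('a \<Rightarrow> complex) \<Rightarrow> bool" where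
  "complex_functional I \<phi> \<longleftrightarrow> bounded_linear \<phi> \<and> (\<forall>y. \<phi> (I y) = \<i> * \<phi> y)"

definition cscale :: "('a::real_normed_vector \<Rightarrow> 'a) \<Rightarrow> complex \<Rightarrow> 'a \<Rightarrow> 'a" where
  "cscale I c y = Re c *\<^sub>R y + Im c *\<^sub>R I y"

lemma complex_functionalD:
  assumes "complex_functional I \<phi>"
  shows "bounded_linear \<phi>" "linear \<phi>" "\<phi> (I y) = \<i> * \<phi> y" "\<phi> (a + b) = \<phi> a + \<phi> b"
    "\<phi> (a - b) = \<phi> a - \<phi> b" "\<phi> (- a) = - \<phi> a" "\<phi> (r *\<^sub>R a) = r *\<^sub>R \<phi> a" "\<phi> 0 = 0"
    "\<phi> (cscale I c y) = c * \<phi> y"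
proof -
  show bl: "bounded_linear \<phi>" and i: "\<phi> (I y) = \<i> * \<phi> y" for y
    using assms by (auto simp: complex_functional_def)
  then interpret bounded_linear \<phi> by simp
  show "linear \<phi>" "\<phi> (a + b) = \<phi> a + \<phi> b" "\<phi> (a - b) = \<phi> a - \<phi> b" "\<phi> (- a) = - \<phi> a"
    "\<phi> (r *\<^sub>R a) = r *\<^sub>R \<phi> a" "\<phi> 0 = 0"
    by (simp_all add: linear_axioms add diff neg scale)
  show "\<phi> (cscale I c y) = c * \<phi> y"
    by (rule complex_eqI) (simp_all add: cscale_def add scale i)
qed

lemma complex_functional_sum:
  assumes "\<And>a. a \<in> A \<Longrightarrow> complex_functional I (\<phi> a)"
  shows "complex_functional I (\<lambda>y. \<Sum>a\<in>A. c a * \<phi> a y)"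
  unfolding complex_functional_def
proof
  show "bounded_linear (\<lambda>y. \<Sum>a\<in>A. c a * \<phi> a y)"
    by (intro bounded_linear_sum bounded_linear_const_mult complex_functionalD(1)[OF assms])
  have "(\<Sum>a\<in>A. c a * \<phi> a (I y)) = (\<Sum>a\<in>A. \<i> * (c a * \<phi> a y))" for y
    by (intro sum.cong refl) (simp add: complex_functionalD(3)[OF assms])
  then show "\<forall>y. (\<Sum>a\<in>A. c a * \<phi> a (I y)) = \<i> * (\<Sum>a\<in>A. c a * \<phi> a y)"
    by (simp add: sum_distrib_left)
qed

lemma cmod_parallelogram:
  "(cmod (w + d))\<^sup>2 + (cmod (w - d))\<^sup>2 = 2 * (cmod w)\<^sup>2 + 2 * (cmod d)\<^sup>2"
  unfolding cmod_power2 by (simp add: power2_eq_square algebra_simps)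

text \<open>Strict convexity of the disc: its boundary contains no segment.\<close>

lemma zero_if_cmod_le_both:
  assumes "cmod (w + d) \<le> r" "cmod (w - d) \<le> r" "cmod w = r"
  shows "d = 0"
proof -
  have "(cmod (w + d))\<^sup>2 \<le> r\<^sup>2" "(cmod (w - d))\<^sup>2 \<le> r\<^sup>2"
    using assms by (simp_all add: power_mono)
  then have "(cmod d)\<^sup>2 \<le> 0" using cmod_parallelogram[of w d, unfolded assms(3)] by linarith
  then show ?thesis by simp
qed

text \<open>The modulus can be affine near \<open>w\<close> in one real direction, but not in two orthogonal ones.\<close>

lemma zero_if_cmod_affine:
  assumes "cmod (w + d) + cmod (w - d) = 2 * cmod w" "cmod (w + \<i> * d) + cmod (w - \<i> * d) = 2 * cmod w"
  shows "d = 0"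
proof -
  have 1: "cmod (w + d) * cmod (w - d) = (cmod w)\<^sup>2 - (cmod d)\<^sup>2"
    if "cmod (w + d) + cmod (w - d) = 2 * cmod w" for d
  proof -
    have "(cmod (w + d) + cmod (w - d))\<^sup>2 = 4 * (cmod w)\<^sup>2" by (simp add: that power_mult_distrib)
    then show ?thesis using cmod_parallelogram[of w d] by (simp add: power2_sum)
  qed
  \<comment> \<open>The hypotheses give \<open>|w\<^sup>2 - d\<^sup>2| = |w\<^sup>2 + d\<^sup>2| = |w|\<^sup>2 - |d|\<^sup>2\<close>, while the two squares add up to \<open>2 w\<^sup>2\<close>.\<close>
  have "2 * (cmod w)\<^sup>2 = cmod (((w + d) * (w - d)) + ((w + \<i> * d) * (w - \<i> * d)))"
    by (simp add: algebra_simps norm_mult power2_eq_square flip: mult_2)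
  also have "\<dots> \<le> cmod ((w + d) * (w - d)) + cmod ((w + \<i> * d) * (w - \<i> * d))"
    by (rule norm_triangle_ineq)
  also have "\<dots> = 2 * (cmod w)\<^sup>2 - 2 * (cmod d)\<^sup>2"
    using 1[OF assms(1)] 1[OF assms(2)] by (simp add: norm_mult)
  finally show ?thesis by simp
qed

text \<open>Used with \<open>w\<close> the quotient of \<open>\<phi> (J z)\<close> by \<open>\<phi> z\<close>, and with the rotations by a small angle in
both directions.\<close>

lemma rotation_unimodular:
  fixes w :: complex
  assumes c: "c > 0" "s > 0" "c\<^sup>2 + s\<^sup>2 = (1::real)"
    and w: "cmod (of_real c + of_real s * w) = 1" "cmod (of_real c - of_real s * w) = 1"
  shows "w = \<i> \<or> w = - \<i>"
proof -
  have "(c + s * Re w)\<^sup>2 + (s * Im w)\<^sup>2 = 1" "(c - s * Re w)\<^sup>2 + (s * Im w)\<^sup>2 = 1"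
    using w[THEN arg_cong, of "\<lambda>r. r\<^sup>2"] by (simp_all add: cmod_power2)
  moreover have "(c + s * Re w)\<^sup>2 - (c - s * Re w)\<^sup>2 = 4 * (c * s) * Re w"
    by (simp add: power2_eq_square algebra_simps)
  ultimately have "4 * (c * s) * Re w = 0" and 2: "(c + s * Re w)\<^sup>2 + (s * Im w)\<^sup>2 = 1"
    by linarith+
  then have re: "Re w = 0" using c by simp
  have "c\<^sup>2 + s\<^sup>2 * (Im w)\<^sup>2 = 1" using 2 by (simp add: re power_mult_distrib)
  then have "s\<^sup>2 * (Im w)\<^sup>2 = s\<^sup>2 * 1" using c(3) by linarith
  moreover have "s\<^sup>2 \<noteq> 0" using c(2) by simp
  ultimately have "(Im w)\<^sup>2 = 1" by (metis mult_left_cancel)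
  then have "Im w = 1 \<or> Im w = -1" by (simp add: power2_eq_1_iff)
  then show ?thesis using re by (auto simp: complex_eq_iff)
qed

definition sign_preserved :: "('a::real_normed_vector \<Rightarrow> 'a) \<Rightarrow> ('a \<Rightarrow> 'a) \<Rightarrow> ('a \<Rightarrow> complex) \<Rightarrow> bool" where
  "sign_preserved I J \<phi> \<longleftrightarrow> (\<forall>y. \<phi> (J y) = \<phi> (I y)) \<or> (\<forall>y. \<phi> (J y) = - \<phi> (I y))"

text \<open>For small angles the rotations by \<open>J\<close> keep a neighbourhood of \<open>z\<close> inside the region where the norm
is \<open>|\<phi>| + k\<close>, so they preserve \<open>|\<phi>|\<close> there. Applied to \<open>z + s u\<close> with \<open>\<phi> u = 0\<close> this shows that \<open>J\<close>
preserves the kernel of \<open>\<phi>\<close>, hence induces a complex structure on the complex line \<open>X / ker \<phi>\<close>;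
applied to \<open>z\<close> it shows that this structure is isometric, so it is multiplication by \<open>i\<close> or \<open>- i\<close>.\<close>

lemma exposed_sign_preserved:
  fixes I J :: "'a::real_normed_vector \<Rightarrow> 'a"
  assumes \<phi>: "complex_functional I \<phi>" and II: "\<And>y. I (I y) = - y"
    and J: "linear J" "\<And>y. J (J y) = - y" "\<And>y. norm (J y) \<le> B * norm y"
    and N: "\<And>\<theta> y. N (cos \<theta> *\<^sub>R y + sin \<theta> *\<^sub>R J y) = N y"
    and k: "\<And>\<theta> y. k (cos \<theta> *\<^sub>R y + sin \<theta> *\<^sub>R J y) = k y"
    and loc: "\<forall>\<^sub>F y in nhds z. N y = cmod (\<phi> y) + k y" and z: "\<phi> z \<noteq> 0"
  shows "sign_preserved I J \<phi>"
proof -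
  note P = complex_functionalD[OF \<phi>]
  define T where "T \<theta> y = cos \<theta> *\<^sub>R y + sin \<theta> *\<^sub>R J y" for \<theta> y
  obtain \<rho> where \<rho>: "\<rho> > 0" "\<And>y. dist y z < \<rho> \<Longrightarrow> N y = cmod (\<phi> y) + k y"
    using loc unfolding eventually_nhds_metric by blast
  have "z \<noteq> 0" using z P(8) by blast
  moreover have "0 \<le> B * norm z" by (rule order_trans[OF norm_ge_zero J(3)])
  ultimately have B: "B \<ge> 0" by (simp add: zero_le_mult_iff)
  have Tadd: "T \<theta> (y + u) = T \<theta> y + T \<theta> u" for \<theta> y u
    using J(1) by (simp add: T_def linear_add algebra_simps)
  have Tbound: "norm (T \<theta> u) \<le> (1 + B) * norm u" for \<theta> u
  proof -
    have "norm (T \<theta> u) \<le> \<bar>cos \<theta>\<bar> * norm u + \<bar>sin \<theta>\<bar> * norm (J u)"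
      unfolding T_def by (rule order_trans[OF norm_triangle_ineq]) simp
    also have "\<dots> \<le> 1 * norm u + 1 * (B * norm u)"
      by (intro add_mono mult_mono) (use J(3) in auto)
    finally show ?thesis by (simp add: algebra_simps)
  qed
  have "((\<lambda>\<theta>. T \<theta> z) \<longlongrightarrow> cos 0 *\<^sub>R z + sin 0 *\<^sub>R J z) (at 0)" unfolding T_def
    by (intro tendsto_intros)
  then have "\<forall>\<^sub>F \<theta> in at 0. dist (T \<theta> z) (cos 0 *\<^sub>R z + sin 0 *\<^sub>R J z) < \<rho> / 2"
    by (rule tendstoD) (use \<rho>(1) in simp)
  then obtain \<tau> where \<tau>: "\<tau> > 0" "\<And>\<theta>. \<theta> \<noteq> 0 \<Longrightarrow> \<bar>\<theta>\<bar> < \<tau> \<Longrightarrow> dist (T \<theta> z) z < \<rho> / 2"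
    unfolding eventually_at by auto
  \<comment> \<open>One angle suffices. It is less than 1 so that its sine and cosine are positive.\<close>
  define \<theta> where "\<theta> = min \<tau> 1 / 2"
  have \<theta>: "\<theta> > 0" "\<theta> < \<tau>" "\<theta> < 1" using \<tau>(1) by (auto simp: \<theta>_def min_def)
  have c: "cos \<theta> > 0" "sin \<theta> > 0" using \<theta> pi_gt3 by (auto intro!: cos_gt_zero sin_gt_zero)
  define \<sigma> where "\<sigma> = \<rho> / (2 * (1 + B))"
  have \<sigma>: "\<sigma> > 0" using \<rho> B by (simp add: \<sigma>_def)
  have H: "cmod (\<phi> (T t (z + u))) = cmod (\<phi> (z + u))" if "t = \<theta> \<or> t = - \<theta>" "norm u < \<sigma>" for t u
  proof -
    have "norm (T t u) \<le> (1 + B) * norm u" by (rule Tbound)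
    also have "\<dots> < (1 + B) * \<sigma>" using that(2) B by (intro mult_strict_left_mono) auto
    also have "\<dots> = \<rho> / 2" using B by (simp add: \<sigma>_def field_simps)
    finally have "norm (T t u) < \<rho> / 2" .
    moreover have "norm (T t z - z) < \<rho> / 2" using \<tau>(2)[of t] \<theta> that(1) by (auto simp: dist_norm)
    moreover have "norm (T t (z + u) - z) \<le> norm (T t z - z) + norm (T t u)"
      using norm_triangle_ineq[of "T t z - z" "T t u"] by (simp add: Tadd algebra_simps)
    ultimately have "dist (T t (z + u)) z < \<rho>" unfolding dist_norm by linarith
    moreover have "\<sigma> \<le> \<rho>" using \<rho> B by (simp add: \<sigma>_def field_simps)
    then have "dist (z + u) z < \<rho>" using that(2) by (simp add: dist_norm)
    moreover have "N (T t (z + u)) = N (z + u)" "k (T t (z + u)) = k (z + u)"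
      using N k by (auto simp: T_def)
    ultimately show ?thesis using \<rho>(2)[of "z + u"] \<rho>(2)[of "T t (z + u)"] by simp
  qed
  have \<phi>T: "\<phi> (T t y) = of_real (cos t) * \<phi> y + of_real (sin t) * \<phi> (J y)" for t y
    by (simp add: T_def P scaleR_conv_of_real)
  have ker: "\<phi> (J u) = 0" if "\<phi> u = 0" for u
  proof -
    define s where "s = \<sigma> / (2 * (norm u + 1))"
    have s: "s > 0" using \<sigma> by (simp add: s_def add_nonneg_pos)
    have "norm (s *\<^sub>R u) = \<sigma> / 2 * (norm u / (norm u + 1))" using s \<sigma> by (simp add: s_def)
    also have "\<dots> \<le> \<sigma> / 2 * 1" using \<sigma> by (intro mult_left_mono) (auto simp: divide_le_eq_1 add_nonneg_pos)
    finally have su: "norm (s *\<^sub>R u) < \<sigma>" using \<sigma> by simp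
    define d where "d = \<phi> (T \<theta> (s *\<^sub>R u))"
    have d: "d = of_real (sin \<theta>) * (s *\<^sub>R \<phi> (J u))"
      using J(1) that by (simp add: d_def \<phi>T P linear_scale)
    have neg: "T \<theta> (- (s *\<^sub>R u)) = - T \<theta> (s *\<^sub>R u)" using J(1) by (simp add: T_def linear_neg)
    have e: "\<phi> (T \<theta> (z + s *\<^sub>R u)) = \<phi> (T \<theta> z) + d" "\<phi> (T \<theta> (z + - (s *\<^sub>R u))) = \<phi> (T \<theta> z) - d"
      unfolding Tadd neg d_def P(4) P(6) by simp_all
    have u0: "\<phi> (z + s *\<^sub>R u) = \<phi> z" "\<phi> (z + - (s *\<^sub>R u)) = \<phi> z"
      unfolding P(4) P(6) P(7) that by simp_all
    have "cmod (\<phi> (T \<theta> z) + d) = cmod (\<phi> z)" "cmod (\<phi> (T \<theta> z) - d) = cmod (\<phi> z)"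
      using H[of \<theta> "s *\<^sub>R u"] H[of \<theta> "- (s *\<^sub>R u)"] su unfolding e u0 by simp_all
    moreover have "cmod (\<phi> (T \<theta> z)) = cmod (\<phi> z)" using H[of \<theta> 0] \<sigma> by simp
    ultimately have "d = 0" by (intro zero_if_cmod_le_both[of "\<phi> (T \<theta> z)"]) auto
    then show ?thesis using d s c by simp
  qed
  define w where "w = \<phi> (J z) / \<phi> z"
  have "cmod (of_real (cos t) + of_real (sin t) * w) = 1" if "t = \<theta> \<or> t = - \<theta>" for t
  proof -
    have "\<phi> (T t z) = (of_real (cos t) + of_real (sin t) * w) * \<phi> z"
      using z by (simp add: \<phi>T w_def algebra_simps)
    moreover have "cmod (\<phi> (T t z)) = cmod (\<phi> z)" using H[OF that, of 0] \<sigma> by simp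
    ultimately show ?thesis using z by (simp add: norm_mult)
  qed
  from this[of \<theta>] this[of "- \<theta>"] have w: "w = \<i> \<or> w = - \<i>"
    using c by (intro rotation_unimodular[of "cos \<theta>" "sin \<theta>"]) auto
  have concl: "\<phi> (J y) = of_real s * \<phi> (I y)" if s: "w = of_real s * \<i>" "s = 1 \<or> s = -1" for s y
  proof -
    have Jz: "\<phi> (J z) = of_real s * (\<i> * \<phi> z)" using s z by (simp add: w_def field_simps)
    then have "\<phi> (J z - s *\<^sub>R I z) = 0" by (simp add: P scaleR_conv_of_real)
    then have "\<phi> (J (J z - s *\<^sub>R I z)) = 0" by (rule ker)
    then have "s *\<^sub>R \<phi> (J (I z)) = - \<phi> z"
      using J by (simp add: linear_diff linear_scale P eq_neg_iff_add_eq_0 add.commute)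
    then have JIz: "\<phi> (J (I z)) = - of_real s * \<phi> z" using s(2) by (auto simp: minus_equation_iff)
    \<comment> \<open>Modulo the kernel every vector is a complex multiple of \<open>z\<close>.\<close>
    define a where "a = \<phi> y / \<phi> z"
    have "\<phi> (y - cscale I a z) = 0" using z by (simp add: P a_def)
    then have "\<phi> (J (y - cscale I a z)) = 0" by (rule ker)
    then have "\<phi> (J y) = of_real (Re a) * \<phi> (J z) + of_real (Im a) * \<phi> (J (I z))"
      using J(1) by (simp add: cscale_def linear_diff linear_add linear_scale P scaleR_conv_of_real)
    also have "\<dots> = of_real s * \<i> * ((of_real (Re a) + \<i> * of_real (Im a)) * \<phi> z)"
      by (simp add: Jz JIz algebra_simps)
    also have "\<dots> = of_real s * \<i> * \<phi> y" using z by (simp add: complex_eq[symmetric] a_def)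
    finally show ?thesis by (simp add: P)
  qed
  show ?thesis using w concl[of 1] concl[of "-1"] unfolding sign_preserved_def by auto
qed

definition sup_abs :: "('a \<Rightarrow> complex) set \<Rightarrow> 'a \<Rightarrow> real" where
  "sup_abs \<Phi> y = (SUP \<phi>\<in>\<Phi>. cmod (\<phi> y))"

locale bounded_functionals =
  fixes \<Phi> :: "('a::real_normed_vector \<Rightarrow> complex) set" and B :: real
  assumes nonempty: "\<Phi> \<noteq> {}" and lin: "\<phi> \<in> \<Phi> \<Longrightarrow> linear \<phi>"
    and bound: "\<phi> \<in> \<Phi> \<Longrightarrow> cmod (\<phi> y) \<le> B * norm y"
begin

lemma upper: "\<phi> \<in> \<Phi> \<Longrightarrow> cmod (\<phi> y) \<le> sup_abs \<Phi> y"
  unfolding sup_abs_def by (rule cSUP_upper) (assumption, rule bdd_aboveI2, rule bound)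

lemma least: "(\<And>\<phi>. \<phi> \<in> \<Phi> \<Longrightarrow> cmod (\<phi> y) \<le> b) \<Longrightarrow> sup_abs \<Phi> y \<le> b"
  unfolding sup_abs_def by (rule cSUP_least) (use nonempty in auto)

lemma nonneg: "0 \<le> sup_abs \<Phi> y"
proof -
  obtain \<phi> where "\<phi> \<in> \<Phi>" using nonempty by blast
  then show ?thesis using upper[of \<phi> y] norm_ge_zero order_trans by blast
qed

lemma le_norm: "sup_abs \<Phi> y \<le> B * norm y"
  by (rule least) (rule bound)

lemma triangle: "sup_abs \<Phi> (y + u) \<le> sup_abs \<Phi> y + sup_abs \<Phi> u"
proof (rule least)
  fix \<phi> assume \<phi>: "\<phi> \<in> \<Phi>"
  have "cmod (\<phi> (y + u)) \<le> cmod (\<phi> y) + cmod (\<phi> u)"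
    using lin[OF \<phi>] by (simp add: linear_add norm_triangle_ineq)
  then show "cmod (\<phi> (y + u)) \<le> sup_abs \<Phi> y + sup_abs \<Phi> u"
    using upper[OF \<phi>, of y] upper[OF \<phi>, of u] by linarith
qed

lemma scale: "sup_abs \<Phi> (c *\<^sub>R y) = \<bar>c\<bar> * sup_abs \<Phi> y"
proof -
  have le: "sup_abs \<Phi> (c *\<^sub>R y) \<le> \<bar>c\<bar> * sup_abs \<Phi> y" for c y
  proof (rule least)
    fix \<phi> assume \<phi>: "\<phi> \<in> \<Phi>"
    show "cmod (\<phi> (c *\<^sub>R y)) \<le> \<bar>c\<bar> * sup_abs \<Phi> y"
      using lin[OF \<phi>] upper[OF \<phi>, of y] by (simp add: linear_scale mult_left_mono)
  qed
  show ?thesis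
  proof (cases "c = 0")
    case True
    then show ?thesis using le[of 0 y] nonneg[of 0] by simp
  next
    case False
    have "sup_abs \<Phi> ((1/c) *\<^sub>R (c *\<^sub>R y)) \<le> \<bar>1/c\<bar> * sup_abs \<Phi> (c *\<^sub>R y)" by (rule le)
    then have "\<bar>c\<bar> * sup_abs \<Phi> y \<le> sup_abs \<Phi> (c *\<^sub>R y)" using False by (simp add: field_simps)
    then show ?thesis using le[of c y] by simp
  qed
qed

lemma diff_le: "\<bar>sup_abs \<Phi> y - sup_abs \<Phi> u\<bar> \<le> B * norm (y - u)"
proof -
  have "sup_abs \<Phi> y \<le> sup_abs \<Phi> u + B * norm (y - u)" for y u
    using triangle[of u "y - u"] le_norm[of "y - u"] by simp
  from this[of y u] this[of u y] show ?thesis by (simp add: norm_minus_commute abs_le_iff)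
qed

lemma continuous: "isCont (sup_abs \<Phi>) y"
proof -
  have "((\<lambda>u. sup_abs \<Phi> u - sup_abs \<Phi> y) \<longlongrightarrow> 0) (at y)"
  proof (rule Lim_null_comparison)
    show "\<forall>\<^sub>F u in at y. norm (sup_abs \<Phi> u - sup_abs \<Phi> y) \<le> B * norm (u - y)"
      using diff_le by (intro always_eventually allI) simp
    have "((\<lambda>u. B * norm (u - y)) \<longlongrightarrow> B * norm (y - y)) (at y)" by (intro tendsto_intros)
    then show "((\<lambda>u. B * norm (u - y)) \<longlongrightarrow> 0) (at y)" by simp
  qed
  then show ?thesis unfolding isCont_def by (rule LIM_zero_cancel)
qed

text \<open>All members of \<open>\<Phi>\<close> have the same Lipschitz constant, so a positive gap at \<open>z\<close> persists nearby, even
for infinite \<open>\<Phi>\<close>.\<close>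

lemma locally_attained:
  assumes \<phi>: "\<phi> \<in> \<Phi>" and d: "d > 0"
    and gap: "\<And>\<psi>. \<psi> \<in> \<Phi> \<Longrightarrow> \<psi> \<noteq> \<phi> \<Longrightarrow> cmod (\<psi> z) \<le> cmod (\<phi> z) - d"
  shows "\<forall>\<^sub>F y in nhds z. sup_abs \<Phi> y = cmod (\<phi> y)"
proof -
  have "((\<lambda>y. 2 * B * norm (y - z)) \<longlongrightarrow> 2 * B * norm (z - z)) (nhds z)"
    by (intro tendsto_intros tendsto_ident_at filterlim_ident)
  then have "\<forall>\<^sub>F y in nhds z. 2 * B * norm (y - z) < d"
    by (rule order_tendstoD) (use d in simp)
  then show ?thesis
  proof eventually_elim
    case (elim y)
    have near: "\<bar>cmod (\<psi> y) - cmod (\<psi> z)\<bar> \<le> B * norm (y - z)" if "\<psi> \<in> \<Phi>" for \<psi>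
      using norm_triangle_ineq3[of "\<psi> y" "\<psi> z"] bound[OF that, of "y - z"] lin[OF that]
      by (simp add: linear_diff)
    have "sup_abs \<Phi> y \<le> cmod (\<phi> y)"
    proof (rule least)
      fix \<psi> assume \<psi>: "\<psi> \<in> \<Phi>"
      show "cmod (\<psi> y) \<le> cmod (\<phi> y)"
        using near[OF \<psi>] near[OF \<phi>] gap[OF \<psi>] elim by (cases "\<psi> = \<phi>") (auto simp: abs_le_iff)
    qed
    then show ?case using upper[OF \<phi>] by (rule antisym)
  qed
qed

end

section \<open>The norm and its complex structures\<close>

lemma eventually_less_nhds:
  fixes F G :: "'a::t2_space \<Rightarrow> real"
  assumes "isCont F z" "isCont G z" "F z < G z"
  shows "\<forall>\<^sub>F y in nhds z. F y < G y"
proof -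
  have "((\<lambda>y. G y - F y) \<longlongrightarrow> G z - F z) (nhds z)"
    using isCont_diff[OF assms(2,1)] tendsto_at_iff_tendsto_nhds[of "\<lambda>y. G y - F y" z]
    unfolding isCont_def by simp
  then have "\<forall>\<^sub>F y in nhds z. 0 < G y - F y" by (rule order_tendstoD) (use assms in simp)
  then show ?thesis by eventually_elim simp
qed

lemma complex_functional_rotate:
  assumes "complex_functional I \<phi>"
  shows "cmod (\<phi> (cos \<theta> *\<^sub>R y + sin \<theta> *\<^sub>R I y)) = cmod (\<phi> y)"
proof -
  have "\<phi> (cos \<theta> *\<^sub>R y + sin \<theta> *\<^sub>R I y) = cis \<theta> * \<phi> y"
    by (rule complex_eqI) (simp_all add: complex_functionalD[OF assms])
  then show ?thesis by (simp add: norm_mult)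
qed

lemma sup_abs_cong:
  assumes "\<And>\<phi>. \<phi> \<in> \<Phi> \<Longrightarrow> cmod (\<phi> y) = cmod (\<phi> z)"
  shows "sup_abs \<Phi> y = sup_abs \<Phi> z"
  unfolding sup_abs_def by (intro SUP_cong refl assms)

lemma sign_preserved_rotate:
  assumes \<phi>: "complex_functional I \<phi>" and "sign_preserved I J \<phi>"
  shows "cmod (\<phi> (cos \<theta> *\<^sub>R y + sin \<theta> *\<^sub>R J y)) = cmod (\<phi> y)"
  using assms(2) unfolding sign_preserved_def
proof
  assume "\<forall>y. \<phi> (J y) = \<phi> (I y)"
  then have "\<phi> (cos \<theta> *\<^sub>R y + sin \<theta> *\<^sub>R J y) = \<phi> (cos \<theta> *\<^sub>R y + sin \<theta> *\<^sub>R I y)"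
    by (simp add: complex_functionalD[OF \<phi>])
  then show ?thesis by (simp add: complex_functional_rotate[OF \<phi>])
next
  assume "\<forall>y. \<phi> (J y) = - \<phi> (I y)"
  then have "\<phi> (cos \<theta> *\<^sub>R y + sin \<theta> *\<^sub>R J y) = \<phi> (cos (- \<theta>) *\<^sub>R y + sin (- \<theta>) *\<^sub>R I y)"
    by (simp add: complex_functionalD[OF \<phi>])
  then show ?thesis by (simp only: complex_functional_rotate[OF \<phi>])
qed

text \<open>The data of the construction: a biorthogonal system indexed by \<open>\<Gamma>\<close>, a set \<open>A\<close> of one or two
distinguished indices, one of which is \<open>e\<close>, small functionals \<open>g p\<close> that complete the system to a
total one, a small norming set \<open>Q\<close> which makes the norm an equivalent one, and a finite set \<open>V\<close> of
functionals in the span of the \<open>f a\<close> with \<open>a \<in> A\<close>, each exposed among \<open>V\<close> by a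
vector with small coordinates. The bound on \<open>\<epsilon>\<close> in terms of \<open>\<eta>\<close> is used to compare the \<open>g p\<close> with
the signs of the other functionals.\<close>

locale rigid_frame =
  fixes I :: "'a::real_normed_vector \<Rightarrow> 'a" and \<Gamma> A :: "'i set" and e :: 'i
    and x :: "'i \<Rightarrow> 'a" and f g :: "'i \<Rightarrow> 'a \<Rightarrow> complex" and V Q :: "('a \<Rightarrow> complex) set"
    and C \<epsilon> \<eta> :: real
  assumes bounded_I: "bounded_linear I" and I_I: "\<And>y. I (I y) = - y"
    and norm_I: "\<And>y. norm (I y) \<le> C * norm y" and C: "1 \<le> C"
    and A: "finite A" "A \<subseteq> \<Gamma>" "e \<in> A" "card A \<le> 2"
    and f: "\<And>p. p \<in> \<Gamma> \<Longrightarrow> complex_functional I (f p)"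
    and f_bound: "\<And>p y. p \<in> \<Gamma> \<Longrightarrow> cmod (f p y) \<le> C * norm y"
    and biorth: "\<And>p q. p \<in> \<Gamma> \<Longrightarrow> q \<in> \<Gamma> \<Longrightarrow> f p (x q) = of_bool (p = q)"
    and norm_x: "\<And>p. p \<in> \<Gamma> \<Longrightarrow> norm (x p) \<le> 1"
    and g: "\<And>p. p \<in> \<Gamma> - A \<Longrightarrow> complex_functional I (g p)"
    and g_bound: "\<And>p y. p \<in> \<Gamma> - A \<Longrightarrow> cmod (g p y) \<le> \<epsilon> * norm y"
    and total: "\<And>y. (\<And>p. p \<in> \<Gamma> \<Longrightarrow> f p y = 0) \<Longrightarrow> (\<And>p. p \<in> \<Gamma> - A \<Longrightarrow> g p y = 0) \<Longrightarrow> y = 0"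
    and Q: "\<And>\<phi>. \<phi> \<in> Q \<Longrightarrow> complex_functional I \<phi>"
    and Q_bound: "\<And>\<phi> y. \<phi> \<in> Q \<Longrightarrow> cmod (\<phi> y) \<le> \<eta> * norm y"
    and Q_norming: "\<And>y. \<exists>\<phi>\<in>Q. \<eta> * norm y \<le> C * cmod (\<phi> y)"
    and \<eta>\<epsilon>: "0 < \<eta>" "64 * (C * \<eta>) \<le> 1" "0 < \<epsilon>" "64 * (C * \<epsilon>) \<le> 1"
    and link_small: "2 * (\<epsilon> * (C * (3 * C\<^sup>2 / \<eta> + C))) < 1"
    and V_finite: "finite V" and f_V: "\<And>a. a \<in> A \<Longrightarrow> f a \<in> V"
    and V_comb: "\<And>v. v \<in> V \<Longrightarrow> \<exists>\<alpha>. (\<forall>a\<in>A. cmod (\<alpha> a) \<le> 1) \<and> v = (\<lambda>y. \<Sum>a\<in>A. \<alpha> a * f a y)"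
    and V_link: "\<And>a. a \<in> A \<Longrightarrow> a \<noteq> e \<Longrightarrow>
      \<exists>\<alpha> \<beta>. \<alpha> \<noteq> 0 \<and> \<beta> \<noteq> 0 \<and> (\<lambda>y. \<alpha> * f e y + \<beta> * f a y) \<in> V"
    and V_exposed: "\<And>v. v \<in> V \<Longrightarrow> \<exists>z. norm z \<le> 2 * C \<and> (\<forall>p\<in>\<Gamma> - A. f p z = 0) \<and> (\<forall>a\<in>A. cmod (f a z) \<le> 1) \<and>
      1 \<le> cmod (v z) \<and> (\<forall>w\<in>V - {v}. cmod (w z) < cmod (v z))"
begin

text \<open>The weights are such that \<open>l p\<close> stays below \<open>f p\<close> at \<open>x p\<close> and below the maximum over \<open>V\<close> at
\<open>x e\<close>, but exceeds all other functionals at \<open>x e + x p\<close>, where it is about \<open>5/4\<close>.\<close>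

definition l :: "'i \<Rightarrow> 'a \<Rightarrow> complex" where
  "l p y = f e y / 2 + 3/4 * f p y + g p y"

definition \<Phi> :: "('a \<Rightarrow> complex) set" where
  "\<Phi> = Q \<union> f ` (\<Gamma> - A) \<union> l ` (\<Gamma> - A)"

text \<open>Invariant under every isometric complex structure, once the signs of the \<open>f a\<close> are known to be preserved. Its
role is to make the second term of the maximum below strictly convex in enough directions; the factor
keeps it small.\<close>

definition k :: "'a \<Rightarrow> real" where
  "k y = (\<Sum>a\<in>A. cmod (f a y)) / 8"

definition R :: "'a \<Rightarrow> real" where
  "R y = sup_abs \<Phi> y + k y"

definition N :: "'a \<Rightarrow> real" where
  "N y = max (sup_abs V y) (R y)"

lemma eG: "e \<in> \<Gamma>" using A by blast

lemma C\<epsilon>: "C * \<epsilon> \<le> 1/64" "\<epsilon> \<le> 1/64" "\<eta> \<le> 1/64" "C * \<eta> \<le> 1/64"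
  using \<eta>\<epsilon> C mult_right_mono[of 1 C \<epsilon>] mult_right_mono[of 1 C \<eta>] by linarith+

lemma l_functional: "p \<in> \<Gamma> - A \<Longrightarrow> complex_functional I (l p)"
proof -
  assume p: "p \<in> \<Gamma> - A"
  have "complex_functional I (\<lambda>y. \<Sum>i\<in>{0, 1, 2 :: nat}. ([1/2, 3/4, 1] ! i) * ([f e, f p, g p] ! i) y)"
    by (rule complex_functional_sum) (use p eG f g in auto)
  then show ?thesis by (simp add: l_def[abs_def] add.assoc)
qed

lemma V_functional:
  assumes "v \<in> V"
  shows "complex_functional I v"
proof -
  obtain \<alpha> where "v = (\<lambda>y. \<Sum>a\<in>A. \<alpha> a * f a y)" using V_comb[OF assms] by blast
  then show ?thesis using complex_functional_sum[of A I f \<alpha>] A f by blast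
qed

lemma V_le_k: "v \<in> V \<Longrightarrow> cmod (v y) \<le> 8 * k y"
proof -
  assume "v \<in> V"
  then obtain \<alpha> where \<alpha>: "\<forall>a\<in>A. cmod (\<alpha> a) \<le> 1" "v = (\<lambda>y. \<Sum>a\<in>A. \<alpha> a * f a y)" using V_comb by blast
  have "cmod (v y) \<le> (\<Sum>a\<in>A. cmod (\<alpha> a * f a y))" unfolding \<alpha>(2) by (rule norm_sum)
  also have "\<dots> \<le> (\<Sum>a\<in>A. 1 * cmod (f a y))" unfolding norm_mult
    using \<alpha>(1) by (intro sum_mono mult_right_mono) auto
  finally show ?thesis by (simp add: k_def)
qed

lemma k_le_norm: "8 * k y \<le> 2 * C * norm y"
proof -
  have "8 * k y \<le> of_nat (card A) * (C * norm y)"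
    unfolding k_def using f_bound A(2) by (simp add: sum_bounded_above subset_iff)
  also have "\<dots> \<le> 2 * (C * norm y)" using A(4) C by (intro mult_right_mono) auto
  finally show ?thesis by simp
qed

lemma \<Phi>_functional: "\<phi> \<in> \<Phi> \<Longrightarrow> complex_functional I \<phi>"
  using Q f l_functional unfolding \<Phi>_def by blast

lemma l_bound:
  assumes "p \<in> \<Gamma> - A"
  shows "cmod (l p y) \<le> cmod (f e y) / 2 + 3/4 * cmod (f p y) + \<epsilon> * norm y"
proof -
  have "cmod (l p y) \<le> cmod (f e y / 2) + cmod (3/4 * f p y) + cmod (g p y)"
    unfolding l_def by (intro order_trans[OF norm_triangle_ineq] add_mono norm_triangle_ineq order_refl)
  then show ?thesis using g_bound[OF assms, of y] by (simp add: norm_mult norm_divide)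
qed

lemma \<Phi>_bound:
  assumes "\<phi> \<in> \<Phi>"
  shows "cmod (\<phi> y) \<le> 2 * C * norm y"
proof -
  have Cn: "1 * norm y \<le> C * norm y" by (rule mult_right_mono[OF C norm_ge_zero])
  have "\<eta> * norm y \<le> (1/64) * norm y" "\<epsilon> * norm y \<le> (1/64) * norm y"
    using C\<epsilon> by (auto intro!: mult_right_mono simp del: times_divide_eq_left)
  then have 1: "\<eta> * norm y \<le> norm y" "\<epsilon> * norm y \<le> norm y / 64"
    using norm_ge_zero[of y] by linarith+
  consider "\<phi> \<in> Q" | p where "p \<in> \<Gamma> - A" "\<phi> = f p" | p where "p \<in> \<Gamma> - A" "\<phi> = l p"
    using assms unfolding \<Phi>_def by blast
  then show ?thesis
  proof cases
    case 1
    then show ?thesis using Q_bound[of \<phi> y] \<open>\<eta> * norm y \<le> norm y\<close> Cn norm_ge_zero[of y] by linarith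
  next
    case 2
    then have "cmod (\<phi> y) \<le> C * norm y" using f_bound[of p y] by simp
    then show ?thesis using Cn norm_ge_zero[of y] by linarith
  next
    case 3
    have "cmod (l p y) \<le> cmod (f e y) / 2 + 3/4 * cmod (f p y) + \<epsilon> * norm y"
      "cmod (f p y) \<le> C * norm y" "cmod (f e y) \<le> C * norm y"
      using l_bound[of p y] f_bound[of p y] f_bound[OF eG, of y] 3 by auto
    then show ?thesis unfolding 3(2) using Cn 1(2) norm_ge_zero[of y] by linarith
  qed
qed

sublocale Phi: bounded_functionals \<Phi> "2 * C"
proof (rule bounded_functionals.intro)
  show "\<Phi> \<noteq> {}" using Q_norming[of 0] by (auto simp: \<Phi>_def)
  show "linear \<phi>" if "\<phi> \<in> \<Phi>" for \<phi> using \<Phi>_functional[OF that] by (rule complex_functionalD(2))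
qed (rule \<Phi>_bound)

sublocale V: bounded_functionals V "2 * C"
proof (rule bounded_functionals.intro)
  show "V \<noteq> {}" using f_V[OF A(3)] by blast
  show "cmod (v y) \<le> 2 * C * norm y" if "v \<in> V" for v y
    using V_le_k[OF that, of y] k_le_norm[of y] by linarith
  show "linear v" if "v \<in> V" for v using V_functional[OF that] by (rule complex_functionalD(2))
qed

lemma continuous_k: "isCont k y"
  unfolding k_def using f A(2)
  by (intro continuous_intros linear_continuous_at[unfolded comp_def] complex_functionalD(1)) auto

lemma continuous_R: "isCont R y"
  unfolding R_def[abs_def] by (intro isCont_add Phi.continuous continuous_k)

lemma k_nonneg: "0 \<le> k y"
  unfolding k_def by (simp add: sum_nonneg)

lemma k_triangle: "k (y + z) \<le> k y + k z"
proof -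
  have "(\<Sum>a\<in>A. cmod (f a (y + z))) \<le> (\<Sum>a\<in>A. cmod (f a y) + cmod (f a z))"
    using A(2) complex_functionalD(4)[OF f] by (intro sum_mono) (auto intro!: norm_triangle_ineq simp: subset_iff)
  then show ?thesis by (simp add: k_def sum.distrib add_divide_distrib[symmetric])
qed

lemma k_scale: "k (c *\<^sub>R y) = \<bar>c\<bar> * k y"
proof -
  have "(\<Sum>a\<in>A. cmod (f a (c *\<^sub>R y))) = (\<Sum>a\<in>A. \<bar>c\<bar> * cmod (f a y))"
    using A(2) complex_functionalD(7)[OF f] by (intro sum.cong) (auto simp: subset_iff)
  then show ?thesis by (simp add: k_def sum_distrib_left)
qed

lemma N_lower: "\<eta> / C * norm y \<le> N y"
proof -
  obtain \<phi> where \<phi>: "\<phi> \<in> Q" "\<eta> * norm y \<le> C * cmod (\<phi> y)" using Q_norming by blast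
  have "\<eta> / C * norm y \<le> cmod (\<phi> y)" using \<phi>(2) C by (simp add: field_simps)
  also have "\<dots> \<le> sup_abs \<Phi> y" by (rule Phi.upper) (use \<phi> in \<open>simp add: \<Phi>_def\<close>)
  finally show ?thesis using k_nonneg[of y] by (simp add: N_def R_def)
qed

lemma N_upper: "N y \<le> 3 * C * norm y"
proof -
  have "0 \<le> C * norm y" using C by simp
  then show ?thesis using V.le_norm[of y] Phi.le_norm[of y] k_le_norm[of y] by (simp add: N_def R_def)
qed

lemma equivalent_norm_N: "equivalent_norm N"
  unfolding equivalent_norm_def
proof (intro conjI allI)
  have pos: "0 < \<eta> / C" using \<eta>\<epsilon> C by simp
  show "N y = 0 \<longleftrightarrow> y = 0" for y
  proof
    assume "N y = 0"
    then have "\<eta> / C * norm y \<le> 0" using N_lower[of y] by simp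
    then show "y = 0" using mult_pos_pos[OF pos, of "norm y"] by (cases "y = 0") auto
  next
    assume "y = 0"
    then show "N y = 0" using N_lower[of y] N_upper[of y] by simp
  qed
  show "N (c *\<^sub>R y) = \<bar>c\<bar> * N y" for c y
    by (simp add: N_def R_def V.scale Phi.scale k_scale distrib_left[symmetric] max_mult_distrib_left)
  show "N (y + z) \<le> N y + N z" for y z
    using V.triangle[of y z] Phi.triangle[of y z] k_triangle[of y z] by (simp add: N_def R_def max_def)
  show "\<exists>a>0. \<exists>b>0. \<forall>x. a * norm x \<le> N x \<and> N x \<le> b * norm x"
    using pos N_lower N_upper C by (intro exI[of _ "\<eta> / C"] exI[of _ "3 * C"] conjI allI) auto
qed

text \<open>The gap \<open>1/8\<close> is what all exposing points below provide.\<close>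

lemma N_eq_if_R_exposed:
  assumes \<phi>: "\<phi> \<in> \<Phi>" and gap: "\<And>\<psi>. \<psi> \<in> \<Phi> \<Longrightarrow> \<psi> \<noteq> \<phi> \<Longrightarrow> cmod (\<psi> z) \<le> cmod (\<phi> z) - 1/8"
    and V: "sup_abs V z < cmod (\<phi> z)"
  shows "\<forall>\<^sub>F y in nhds z. N y = cmod (\<phi> y) + k y"
proof -
  have "sup_abs V z < R z" using V Phi.upper[OF \<phi>, of z] k_nonneg[of z] by (simp add: R_def)
  then have "\<forall>\<^sub>F y in nhds z. sup_abs V y < R y"
    by (rule eventually_less_nhds[OF V.continuous continuous_R])
  moreover have "\<forall>\<^sub>F y in nhds z. sup_abs \<Phi> y = cmod (\<phi> y)"
    by (rule Phi.locally_attained[OF \<phi>, of "1/8"]) (simp, rule gap)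
  ultimately show ?thesis by eventually_elim (simp add: N_def R_def)
qed

lemma f_off: "p \<in> \<Gamma> - A \<Longrightarrow> a \<in> A \<Longrightarrow> f a (x p) = 0"
  using biorth[of a p] A(2) by auto

lemma \<Phi>_cases:
  assumes "\<phi> \<in> \<Phi>"
  obtains "\<phi> \<in> Q" | p where "p \<in> \<Gamma> - A" "\<phi> = f p" | p where "p \<in> \<Gamma> - A" "\<phi> = l p"
  using assms unfolding \<Phi>_def by blast

lemma N_near_x:
  assumes p: "p \<in> \<Gamma> - A"
  shows "\<forall>\<^sub>F y in nhds (x p). N y = cmod (f p y) + k y"
proof (rule N_eq_if_R_exposed)
  have fp: "f p (x p) = 1" using biorth[of p p] p by simp
  have fe: "f e (x p) = 0" using f_off[OF p A(3)] .
  have fq: "f q (x p) = 0" if "q \<in> \<Gamma>" "f q \<noteq> f p" for q using biorth[of q p] that p by auto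
  have small: "\<epsilon> * norm (x p) \<le> 1/64" "\<eta> * norm (x p) \<le> 1/64"
    using mult_mono[OF C\<epsilon>(2) norm_x] mult_mono[OF C\<epsilon>(3) norm_x] p by auto
  show "f p \<in> \<Phi>" using p by (simp add: \<Phi>_def)
  show "cmod (\<psi> (x p)) \<le> cmod (f p (x p)) - 1/8" if "\<psi> \<in> \<Phi>" "\<psi> \<noteq> f p" for \<psi>
    using that(1)
  proof (cases rule: \<Phi>_cases)
    case 1
    then show ?thesis using Q_bound[of \<psi> "x p"] small by (simp add: fp)
  next
    case (2 q)
    then show ?thesis using fq[of q] that by (simp add: fp)
  next
    case (3 q)
    have "cmod (f q (x p)) \<le> 1" using biorth[of q p] 3 p by (simp add: of_bool_def)
    then show ?thesis using 3 l_bound[of q "x p"] small by (simp add: fp fe)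
  qed
  have "k (x p) = 0" by (simp add: k_def f_off[OF p])
  then have "sup_abs V (x p) \<le> 0" using V_le_k[of _ "x p"] by (intro V.least) simp
  then show "sup_abs V (x p) < cmod (f p (x p))" by (simp add: fp)
qed

lemma N_near_x_plus:
  assumes p: "p \<in> \<Gamma> - A"
  shows "\<forall>\<^sub>F y in nhds (x e + x p). N y = cmod (l p y) + k y" "l p (x e + x p) \<noteq> 0"
proof -
  let ?z = "x e + x p"
  have ne: "p \<noteq> e" using p A by auto
  have add: "f q ?z = f q (x e) + f q (x p)" if "q \<in> \<Gamma>" for q
    using complex_functionalD(4)[OF f[OF that]] .
  have fp: "f p ?z = 1" "f e ?z = 1" using add[of p] add[of e] biorth p eG ne by auto
  have fq: "f q ?z = 0" if "q \<in> \<Gamma> - A" "q \<noteq> p" for q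
    using add[of q] biorth[of q e] biorth[of q p] that p eG A by auto
  have "norm ?z \<le> 2" using norm_triangle_ineq[of "x e" "x p"] norm_x[OF eG] norm_x[of p] p by simp
  then have small: "\<epsilon> * norm ?z \<le> 1/32" "\<eta> * norm ?z \<le> 1/32"
    using mult_mono[OF C\<epsilon>(2), of "norm ?z" 2] mult_mono[OF C\<epsilon>(3), of "norm ?z" 2] by auto
  have "l p ?z = 5/4 + g p ?z" by (simp add: l_def fp)
  then have "cmod (5/4) \<le> cmod (l p ?z) + cmod (g p ?z)"
    by (metis add_diff_cancel_right' norm_triangle_ineq4)
  then have big: "39/32 \<le> cmod (l p ?z)" using g_bound[OF p, of ?z] small(1) by simp
  then show "l p ?z \<noteq> 0" by auto
  show "\<forall>\<^sub>F y in nhds ?z. N y = cmod (l p y) + k y"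
  proof (rule N_eq_if_R_exposed)
    show "l p \<in> \<Phi>" using p by (simp add: \<Phi>_def)
    show "cmod (\<psi> ?z) \<le> cmod (l p ?z) - 1/8" if "\<psi> \<in> \<Phi>" "\<psi> \<noteq> l p" for \<psi>
      using that(1)
    proof (cases rule: \<Phi>_cases)
      case 1
      then show ?thesis using Q_bound[of \<psi> ?z] small big by simp
    next
      case (2 q)
      then have "cmod (f q ?z) \<le> 1" using fp fq[of q] by (cases "q = p") auto
      then show ?thesis using 2 big by simp
    next
      case (3 q)
      then have "f q ?z = 0" using fq[of q] that by auto
      then show ?thesis using 3 l_bound[of q ?z] small big by (simp add: fp)
    qed
    have "cmod (v ?z) \<le> 1" if v: "v \<in> V" for v
    proof -
      obtain \<alpha> where \<alpha>: "\<forall>a\<in>A. cmod (\<alpha> a) \<le> 1" "v = (\<lambda>y. \<Sum>a\<in>A. \<alpha> a * f a y)" using V_comb[OF v] by blast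
      have "f a ?z = of_bool (a = e)" if "a \<in> A" for a
        using add[of a] biorth[of a e] f_off[OF p that] A(2) that eG by auto
      then have "v ?z = (\<Sum>a\<in>A. if a = e then \<alpha> a else 0)" unfolding \<alpha>(2) by (intro sum.cong) auto
      then show ?thesis using \<alpha>(1) A by simp
    qed
    then have "sup_abs V ?z \<le> 1" by (rule V.least)
    then show "sup_abs V ?z < cmod (l p ?z)" using big by simp
  qed
qed

text \<open>At the point provided by the exposure condition the second term of the maximum is at most
\<open>17/32 + 1/4 < 1\<close>, so the norm is given by the first one.\<close>

lemma V_exposing_point:
  assumes "v \<in> V"
  obtains z where "v z \<noteq> 0" "\<forall>\<^sub>F y in nhds z. N y = cmod (v y)"
proof -
  obtain z where z: "norm z \<le> 2 * C" "\<And>p. p \<in> \<Gamma> - A \<Longrightarrow> f p z = 0" "\<And>a. a \<in> A \<Longrightarrow> cmod (f a z) \<le> 1"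
    "1 \<le> cmod (v z)" "\<And>w. w \<in> V - {v} \<Longrightarrow> cmod (w z) < cmod (v z)"
    using V_exposed[OF assms] by blast
  have small: "\<epsilon> * norm z \<le> 1/32" "\<eta> * norm z \<le> 1/32"
  proof -
    have "\<epsilon> * norm z \<le> \<epsilon> * (2 * C)" "\<eta> * norm z \<le> \<eta> * (2 * C)"
      using z(1) \<eta>\<epsilon> by (auto intro!: mult_left_mono)
    moreover have "\<epsilon> * (2 * C) \<le> 1/32" "\<eta> * (2 * C) \<le> 1/32" using \<eta>\<epsilon>(2,4) by (simp_all add: mult_ac)
    ultimately show "\<epsilon> * norm z \<le> 1/32" "\<eta> * norm z \<le> 1/32" by linarith+
  qed
  have "sup_abs \<Phi> z \<le> 17/32"
  proof (rule Phi.least)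
    fix \<phi> assume "\<phi> \<in> \<Phi>"
    then show "cmod (\<phi> z) \<le> 17/32"
    proof (cases rule: \<Phi>_cases)
      case 1
      then show ?thesis using Q_bound[of \<phi> z] small by simp
    next
      case (2 p)
      then show ?thesis using z(2)[of p] by simp
    next
      case (3 p)
      then show ?thesis using z(2)[of p] z(3)[OF A(3)] l_bound[of p z] small by simp
    qed
  qed
  moreover have "k z \<le> 1/4"
  proof -
    have "(\<Sum>a\<in>A. cmod (f a z)) \<le> of_nat (card A) * 1" by (rule sum_bounded_above) (rule z(3))
    then show ?thesis using A(4) by (simp add: k_def)
  qed
  ultimately have "R z < cmod (v z)" using z(4) by (simp add: R_def)
  then have "\<forall>\<^sub>F y in nhds z. R y < cmod (v y)"
    using complex_functionalD(1)[OF V_functional[OF assms]]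
    by (intro eventually_less_nhds continuous_R continuous_intros linear_continuous_at) auto
  moreover have "\<forall>\<^sub>F y in nhds z. \<forall>w\<in>V - {v}. cmod (w y) < cmod (v y)"
  proof (subst eventually_ball_finite_distrib)
    show "finite (V - {v})" using V_finite by simp
    show "\<forall>w\<in>V - {v}. \<forall>\<^sub>F y in nhds z. cmod (w y) < cmod (v y)"
    proof
      fix w assume w: "w \<in> V - {v}"
      show "\<forall>\<^sub>F y in nhds z. cmod (w y) < cmod (v y)"
        using complex_functionalD(1)[OF V_functional[OF assms]] complex_functionalD(1)[OF V_functional[of w]] w z(5)
        by (intro eventually_less_nhds continuous_intros linear_continuous_at) auto
    qed
  qed
  ultimately have "\<forall>\<^sub>F y in nhds z. N y = cmod (v y)"
  proof eventually_elim
    case (elim y)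
    have "cmod (w y) \<le> cmod (v y)" if "w \<in> V" for w using elim(2) that by (cases "w = v") (auto simp: less_imp_le)
    then have "sup_abs V y \<le> cmod (v y)" by (rule V.least)
    then have "sup_abs V y = cmod (v y)" using V.upper[OF assms, of y] by (rule antisym)
    then show ?case using elim(1) by (simp add: N_def)
  qed
  moreover have "v z \<noteq> 0" using z(4) by auto
  ultimately show ?thesis using that by blast
qed

lemma N_rotate: "N (cos \<theta> *\<^sub>R y + sin \<theta> *\<^sub>R I y) = N y"
proof -
  have "k (cos \<theta> *\<^sub>R y + sin \<theta> *\<^sub>R I y) = k y" unfolding k_def
    using A(2) by (intro arg_cong[of _ _ "\<lambda>s. s / 8"] sum.cong refl complex_functional_rotate f) auto
  moreover have "sup_abs V (cos \<theta> *\<^sub>R y + sin \<theta> *\<^sub>R I y) = sup_abs V y"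
    by (intro sup_abs_cong complex_functional_rotate V_functional)
  moreover have "sup_abs \<Phi> (cos \<theta> *\<^sub>R y + sin \<theta> *\<^sub>R I y) = sup_abs \<Phi> y"
    by (intro sup_abs_cong complex_functional_rotate \<Phi>_functional)
  ultimately show ?thesis by (simp add: N_def R_def)
qed

lemma linear_I: "linear I"
  using bounded_I by (rule bounded_linear.linear)

lemma linear_rotate:
  assumes "linear J"
  shows "linear (\<lambda>y. c *\<^sub>R y + s *\<^sub>R J y)"
  by (intro linear_compose_add linear_compose_scale_right linear_ident assms)

lemma I_structure: "I \<in> isometric_complex_structures N" "(\<lambda>y. - I y) \<in> isometric_complex_structures N"
proof -
  show "I \<in> isometric_complex_structures N"
    unfolding isometric_complex_structures_def linear_isometry_def
    using linear_I I_I N_rotate linear_rotate[OF linear_I] by blast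
  have lin: "linear (\<lambda>y. - I y)" using linear_I by (rule linear_compose_neg)
  have "N (cos \<theta> *\<^sub>R y + sin \<theta> *\<^sub>R - I y) = N y" for \<theta> y using N_rotate[of "- \<theta>" y] by simp
  moreover have "- I (- I y) = - y" for y using linear_I by (simp add: linear_neg I_I)
  ultimately show "(\<lambda>y. - I y) \<in> isometric_complex_structures N"
    unfolding isometric_complex_structures_def linear_isometry_def
    using lin linear_rotate[OF lin] by blast
qed

text \<open>The signs are first determined on \<open>V\<close>, which makes \<open>k\<close> invariant, and then on the functionals \<open>f p\<close>
and \<open>l p\<close>, which are exposed only up to \<open>k\<close>. In \<open>l p\<close> the unknown values of \<open>g p\<close> are too small to
compensate a difference between the signs of \<open>f e\<close>, \<open>f p\<close> and \<open>l p\<close>; once these agree, the sign of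
\<open>g p\<close> is determined by linearity.\<close>

theorem structures_eq: "isometric_complex_structures N = {I, \<lambda>y. - I y}"
proof
  show "{I, \<lambda>y. - I y} \<subseteq> isometric_complex_structures N" using I_structure by blast
  show "isometric_complex_structures N \<subseteq> {I, \<lambda>y. - I y}"
  proof
    fix J assume "J \<in> isometric_complex_structures N"
    then have J: "linear J" "\<And>y. J (J y) = - y"
      and NJ: "\<And>\<theta> y. N (cos \<theta> *\<^sub>R y + sin \<theta> *\<^sub>R J y) = N y"
      unfolding isometric_complex_structures_def linear_isometry_def by blast+
    have J_bound: "norm (J y) \<le> 3 * C\<^sup>2 / \<eta> * norm y" for y
    proof -
      have "\<eta> / C * norm (J y) \<le> N (J y)" by (rule N_lower)
      also have "\<dots> = N y" using NJ[of "pi / 2" y] by simp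
      also have "\<dots> \<le> 3 * C * norm y" by (rule N_upper)
      finally show ?thesis using \<eta>\<epsilon>(1) C by (simp add: field_simps power2_eq_square)
    qed
    note sign = exposed_sign_preserved[OF _ I_I J J_bound NJ]
    have sign_V: "sign_preserved I J v" if v: "v \<in> V" for v
    proof -
      obtain z where z: "v z \<noteq> 0" "\<forall>\<^sub>F y in nhds z. N y = cmod (v y)" by (rule V_exposing_point[OF v])
      show ?thesis
        by (rule sign[OF V_functional[OF v], of "\<lambda>_. 0" z]) (use z in simp_all)
    qed
    have k_inv: "k (cos \<theta> *\<^sub>R y + sin \<theta> *\<^sub>R J y) = k y" for \<theta> y unfolding k_def
      using A(2) by (intro arg_cong[of _ _ "\<lambda>s. s / 8"] sum.cong refl sign_preserved_rotate[OF f] sign_V f_V) auto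
    have sign_f: "sign_preserved I J (f p)" if p: "p \<in> \<Gamma>" for p
    proof (cases "p \<in> A")
      case False
      then have p': "p \<in> \<Gamma> - A" using p by simp
      show ?thesis
        by (rule sign[OF f[OF p] k_inv N_near_x[OF p']]) (use biorth[OF p p] in simp)
    qed (simp add: sign_V f_V)
    have sign_l: "sign_preserved I J (l p)" if p: "p \<in> \<Gamma> - A" for p
      by (rule sign[OF l_functional[OF p] k_inv N_near_x_plus[OF p]])
    define agree where "agree \<phi> t \<longleftrightarrow> (\<forall>y. \<phi> (J y) = of_real t * \<phi> (I y))" for \<phi> :: "'a \<Rightarrow> complex" and t :: real
    have agree: "\<exists>t. (t = s \<or> t = - s) \<and> agree \<phi> t" if "sign_preserved I J \<phi>" "s = 1 \<or> s = -1" for s \<phi>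
      using that unfolding sign_preserved_def agree_def by (elim disjE) force+
    obtain s where s: "s = 1 \<or> s = -1" and fe: "agree (f e) s" using agree[OF sign_f[OF eG], of 1] by auto
    have I_neg_I: "I (- I w) = w" for w using linear_I by (simp add: linear_neg I_I)
    have fA: "agree (f a) s" if a: "a \<in> A" for a
    proof (cases "a = e")
      case ne: False
      obtain t where t: "t = s \<or> t = - s" "agree (f a) t" using agree[OF sign_f s] a A(2) by blast
      obtain \<alpha> \<beta> where ab: "\<alpha> \<noteq> 0" "\<beta> \<noteq> 0" "(\<lambda>y. \<alpha> * f e y + \<beta> * f a y) \<in> V" using V_link[OF a ne] by blast
      obtain u where u: "agree (\<lambda>y. \<alpha> * f e y + \<beta> * f a y) u" using agree[OF sign_V[OF ab(3)] s] by blast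
      \<comment> \<open>Evaluation at \<open>x e\<close> and at \<open>x a\<close> compares the sign of the combination with both signs.\<close>
      have eq: "\<alpha> * (s * f e w) + \<beta> * (t * f a w) = u * (\<alpha> * f e w + \<beta> * f a w)" for w
        using u fe t(2) unfolding agree_def by (metis I_neg_I)
      have aG: "a \<in> \<Gamma>" using a A by blast
      have "complex_of_real s = u" using eq[of "x e"] ab(1) biorth[OF eG eG] biorth[OF aG eG] ne by simp
      moreover have "complex_of_real t = u" using eq[of "x a"] ab(2) biorth[OF aG aG] biorth[OF eG aG] ne by simp
      ultimately have "s = t" by simp
      then show ?thesis using t(2) by simp
    qed (simp add: fe)
    have fg: "agree (f p) s \<and> agree (g p) s" if p: "p \<in> \<Gamma> - A" for p
    proof -
      obtain t where t: "t = s \<or> t = - s" "agree (f p) t" using agree[OF sign_f s] p by blast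
      obtain u where u: "u = s \<or> u = - s" "agree (l p) u" using agree[OF sign_l[OF p] s] by blast
      have eq: "g p (J (- I w)) - u * g p w = (u - s) * f e w / 2 + 3/4 * ((u - t) * f p w)" for w
      proof -
        have "l p (J (- I w)) = u * l p w" "f e (J (- I w)) = s * f e w" "f p (J (- I w)) = t * f p w"
          using u t fe unfolding agree_def by (metis I_neg_I)+
        moreover have "g p (J (- I w)) = l p (J (- I w)) - f e (J (- I w)) / 2 - 3/4 * f p (J (- I w))"
          by (simp add: l_def)
        ultimately have "g p (J (- I w)) = u * l p w - s * f e w / 2 - 3/4 * (t * f p w)" by simp
        then show ?thesis by (simp add: l_def algebra_simps diff_divide_distrib add_divide_distrib)
      qed
      \<comment> \<open>The isometry \<open>J\<close> is bounded by the ratio of the constants of norm equivalence, which involves \<open>\<eta>\<close> but not \<open>\<epsilon>\<close>.\<close>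
      have small: "cmod (g p (J (- I w)) - u * g p w) < 1/2" if "norm w \<le> 1" for w
      proof -
        have "norm (J (- I w)) \<le> 3 * C\<^sup>2 / \<eta> * norm (- I w)" by (rule J_bound)
        also have "\<dots> \<le> 3 * C\<^sup>2 / \<eta> * C"
        proof (rule mult_left_mono)
          have "C * norm w \<le> C * 1" using that C by (intro mult_left_mono) auto
          then show "norm (- I w) \<le> C" using norm_I[of w] by simp
        qed (use \<eta>\<epsilon>(1) in simp)
        finally have "\<epsilon> * norm (J (- I w)) \<le> \<epsilon> * (3 * C\<^sup>2 / \<eta> * C)"
          using \<eta>\<epsilon>(3) by (intro mult_left_mono) auto
        then have 1: "cmod (g p (J (- I w))) \<le> \<epsilon> * (3 * C\<^sup>2 / \<eta> * C)" using g_bound[OF p] order_trans by blast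
        have "\<epsilon> * norm w \<le> \<epsilon> * (C * C)"
          using that C \<eta>\<epsilon>(3) mult_mono[OF C C] by (intro mult_left_mono) auto
        then have 2: "cmod (u * g p w) \<le> \<epsilon> * (C * C)"
          using g_bound[OF p, of w] s u by (auto simp: norm_mult)
        have "cmod (g p (J (- I w)) - u * g p w) \<le> \<epsilon> * (3 * C\<^sup>2 / \<eta> * C) + \<epsilon> * (C * C)"
          by (rule order_trans[OF norm_triangle_ineq4 add_mono[OF 1 2]])
        also have "\<dots> = \<epsilon> * (C * (3 * C\<^sup>2 / \<eta> + C))" by (simp add: algebra_simps)
        finally show ?thesis using link_small by simp
      qed
      have ne: "p \<noteq> e" and pG: "p \<in> \<Gamma>" using p A by auto
      have "cmod ((u - s) / 2) < 1/2"
        using small[OF norm_x[OF eG]] unfolding eq using biorth[OF eG eG] biorth[OF pG eG] ne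
        by (simp add: norm_mult flip: of_real_diff)
      then have "\<bar>u - s\<bar> < 1" by (simp add: norm_divide flip: of_real_diff)
      then have us: "u = s" using u s by auto
      have "cmod (3/4 * (u - t)) < 1/2"
        using small[OF norm_x[OF pG]] unfolding eq using biorth[OF pG pG] biorth[OF eG pG] ne by simp
      then have "\<bar>3 * u - 3 * t\<bar> < 2" by (simp add: norm_mult flip: of_real_diff)
      then have ts: "t = s" using us t s by auto
      have "g p (J y) = s * g p (I y)" for y
        using u(2) t(2) fe unfolding us ts agree_def l_def by (simp add: algebra_simps)
      then show ?thesis using t(2) ts by (simp add: agree_def)
    qed
    have "J y - s *\<^sub>R I y = 0" for y
    proof (rule total)
      fix p assume p: "p \<in> \<Gamma>"
      then have "agree (f p) s" using fA fg by blast
      then show "f p (J y - s *\<^sub>R I y) = 0"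
        by (simp add: agree_def complex_functionalD[OF f[OF p]] scaleR_conv_of_real)
    next
      fix p assume p: "p \<in> \<Gamma> - A"
      then have "agree (g p) s" using fg by blast
      then show "g p (J y - s *\<^sub>R I y) = 0"
        by (simp add: agree_def complex_functionalD[OF g[OF p]] scaleR_conv_of_real)
    qed
    then have "J = (\<lambda>y. s *\<^sub>R I y)" by (auto simp: fun_eq_iff)
    then show "J \<in> {I, \<lambda>y. - I y}" using s by auto
  qed
qed

end

section \<open>Excluding conjugate-linear isometries\<close>

context rigid_frame
begin

lemma V_sup_attained: "\<exists>v\<in>V. sup_abs V y = cmod (v y)"
proof -
  have "finite ((\<lambda>v. cmod (v y)) ` V)" "(\<lambda>v. cmod (v y)) ` V \<noteq> {}"
    using V_finite V.nonempty by auto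
  then have "sup_abs V y \<in> (\<lambda>v. cmod (v y)) ` V"
    unfolding sup_abs_def by (metis cSup_eq_Max Max_in)
  then show ?thesis by blast
qed

text \<open>A sum of convex functions is affine along a segment only if each summand is.\<close>

lemma R_affine_imp_f_affine:
  assumes "R (z + d) + R (z - d) = 2 * R z" and a: "a \<in> A"
  shows "cmod (f a z + f a d) + cmod (f a z - f a d) = 2 * cmod (f a z)"
proof -
  have fb: "complex_functional I (f b)" if "b \<in> A" for b using f A(2) that by blast
  have z2: "(z + d) + (z - d) = 2 *\<^sub>R z" by (simp add: scaleR_2)
  have "2 * sup_abs \<Phi> z \<le> sup_abs \<Phi> (z + d) + sup_abs \<Phi> (z - d)"
    using Phi.triangle[of "z + d" "z - d"] unfolding z2 Phi.scale by simp
  then have "k (z + d) + k (z - d) - 2 * k z \<le> 0" using assms(1) by (simp add: R_def)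
  moreover define s where "s b = cmod (f b (z + d)) + cmod (f b (z - d)) - 2 * cmod (f b z)" for b
  have "8 * (k (z + d) + k (z - d) - 2 * k z) = (\<Sum>b\<in>A. s b)"
    by (simp add: k_def s_def sum.distrib sum_subtractf flip: sum_distrib_left)
  moreover have s: "0 \<le> s b" if "b \<in> A" for b
  proof -
    have "f b (z + d) + f b (z - d) = 2 * f b z" by (simp add: complex_functionalD[OF fb[OF that]])
    then have "2 * cmod (f b z) = cmod (f b (z + d) + f b (z - d))" by (simp add: norm_mult)
    then show ?thesis using norm_triangle_ineq[of "f b (z + d)" "f b (z - d)"] by (simp add: s_def)
  qed
  then have "0 \<le> (\<Sum>b\<in>A. s b)" by (intro sum_nonneg)
  ultimately have "(\<Sum>b\<in>A. s b) = 0" by (intro antisym) argo+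
  then have "s a = 0" using sum_nonneg_eq_0_iff[OF A(1), of s] s a by simp
  then show ?thesis by (simp add: s_def complex_functionalD[OF fb[OF a]])
qed

text \<open>Only members of \<open>V\<close> give the norm locally without an additional term. If the second term
\<open>R\<close> of the maximum were larger at \<open>z\<close>, it would be constant near \<open>z\<close> in the directions of the kernel
of \<open>\<psi>\<close>; but some \<open>f a\<close> is not zero on this kernel, as there are two of them, and \<open>|f a|\<close> is not
affine in both directions \<open>u\<close> and \<open>I u\<close>. So a member of \<open>V\<close> attains the norm at \<open>z\<close>, and it is
proportional to \<open>\<psi>\<close>, since its modulus does not exceed that of \<open>\<psi>\<close> nearby.\<close>

lemma local_modulus:
  assumes e': "e' \<in> A" "e' \<noteq> e" and \<psi>: "complex_functional I \<psi>"
    and loc: "\<forall>\<^sub>F y in nhds z. N y = cmod (\<psi> y)" and z: "\<psi> z \<noteq> 0"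
  obtains v c where "v \<in> V" "cmod c = 1" "\<And>y. \<psi> y = c * v y"
proof -
  note \<psi>D = complex_functionalD[OF \<psi>]
  have Nz: "N z = cmod (\<psi> z)" using loc by (rule eventually_nhds_x_imp_x)
  have small_multiple: "\<exists>t>0. norm (t *\<^sub>R u) < r \<and> norm (t *\<^sub>R I u) < r" if "r > 0" for r u
  proof (intro exI conjI)
    define t where "t = r / (2 * (1 + norm u + norm (I u)))"
    show t: "t > 0" using that by (simp add: t_def add_pos_nonneg)
    have p: "1 + norm u + norm (I u) > 0" by (simp add: add_pos_nonneg)
    have "t * (1 + norm u + norm (I u)) = r / 2" using p by (simp add: t_def field_simps)
    then have "t + t * norm u + t * norm (I u) = r / 2" by (simp add: algebra_simps)
    moreover have "0 \<le> t * norm u" "0 \<le> t * norm (I u)" using t by auto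
    moreover have "norm (t *\<^sub>R u) = t * norm u" "norm (t *\<^sub>R I u) = t * norm (I u)" using t by simp_all
    ultimately show "norm (t *\<^sub>R u) < r" "norm (t *\<^sub>R I u) < r" using t that by linarith+
  qed
  have "sup_abs V z = N z"
  proof (rule ccontr)
    assume "sup_abs V z \<noteq> N z"
    then have "sup_abs V z < R z" by (simp add: N_def max_def split: if_splits)
    then have "\<forall>\<^sub>F y in nhds z. sup_abs V y < R y"
      by (rule eventually_less_nhds[OF V.continuous continuous_R])
    with loc have "\<forall>\<^sub>F y in nhds z. R y = cmod (\<psi> y)" by eventually_elim (simp add: N_def)
    then obtain r where r: "r > 0" "\<And>y. dist y z < r \<Longrightarrow> R y = cmod (\<psi> y)"
      unfolding eventually_nhds_metric by blast
    have "\<exists>u. \<exists>a\<in>A. \<psi> u = 0 \<and> f a u \<noteq> 0"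
    proof (rule ccontr)
      assume "\<not> ?thesis"
      then have ker: "f a u = 0" if "a \<in> A" "\<psi> u = 0" for a u using that by blast
      define u where "u = cscale I (\<psi> (x e)) (x e') - cscale I (\<psi> (x e')) (x e)"
      have "\<psi> u = 0" by (simp add: u_def \<psi>D)
      have e'G: "e' \<in> \<Gamma>" using e' A by blast
      have "f e u = - \<psi> (x e')"
        by (simp add: u_def complex_functionalD[OF f[OF eG]] biorth[OF eG eG] biorth[OF eG e'G] e'(2)[symmetric])
      then have "\<psi> (x e') = 0" using ker[OF A(3) \<open>\<psi> u = 0\<close>] by simp
      then show False using ker[OF e'(1), of "x e'"] biorth[OF e'G e'G] by simp
    qed
    then obtain u a where ua: "a \<in> A" "\<psi> u = 0" "f a u \<noteq> 0" by blast
    have aff: "cmod (f a z + f a d) + cmod (f a z - f a d) = 2 * cmod (f a z)" if "\<psi> d = 0" "norm d < r" for d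
    proof (rule R_affine_imp_f_affine[OF _ ua(1)])
      have "R (z + d) = cmod (\<psi> z)" "R (z - d) = cmod (\<psi> z)" "R z = cmod (\<psi> z)"
        using r that by (simp_all add: dist_norm \<psi>D)
      then show "R (z + d) + R (z - d) = 2 * R z" by simp
    qed
    obtain t where t: "t > 0" "norm (t *\<^sub>R u) < r" "norm (t *\<^sub>R I u) < r"
      using small_multiple[OF r(1)] by blast
    have fa: "complex_functional I (f a)" using f A(2) ua(1) by blast
    have "f a (t *\<^sub>R u) = 0"
    proof (rule zero_if_cmod_affine)
      show "cmod (f a z + f a (t *\<^sub>R u)) + cmod (f a z - f a (t *\<^sub>R u)) = 2 * cmod (f a z)"
        using t ua(2) by (intro aff) (simp_all add: \<psi>D)
      have "cmod (f a z + f a (t *\<^sub>R I u)) + cmod (f a z - f a (t *\<^sub>R I u)) = 2 * cmod (f a z)"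
        using t ua(2) by (intro aff) (simp_all add: \<psi>D)
      then show "cmod (f a z + \<i> * f a (t *\<^sub>R u)) + cmod (f a z - \<i> * f a (t *\<^sub>R u)) = 2 * cmod (f a z)"
        by (simp add: complex_functionalD[OF fa])
    qed
    then show False using t(1) ua(3) by (simp add: complex_functionalD[OF fa])
  qed
  then obtain v where v: "v \<in> V" "cmod (v z) = cmod (\<psi> z)" using V_sup_attained[of z] Nz by metis
  note vD = complex_functionalD[OF V_functional[OF v(1)]]
  obtain r where r: "r > 0" "\<And>y. dist y z < r \<Longrightarrow> N y = cmod (\<psi> y)"
    using loc unfolding eventually_nhds_metric by blast
  have le: "cmod (v y) \<le> cmod (\<psi> y)" if "dist y z < r" for y
    using V.upper[OF v(1), of y] r(2)[OF that] by (simp add: N_def)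
  have ker: "v u = 0" if "\<psi> u = 0" for u
  proof -
    obtain t where t: "t > 0" "norm (t *\<^sub>R u) < r" using small_multiple[OF r(1)] by blast
    have "v (t *\<^sub>R u) = 0"
    proof (rule zero_if_cmod_le_both[OF _ _ v(2)])
      show "cmod (v z + v (t *\<^sub>R u)) \<le> cmod (\<psi> z)" "cmod (v z - v (t *\<^sub>R u)) \<le> cmod (\<psi> z)"
        using le[of "z + t *\<^sub>R u"] le[of "z - t *\<^sub>R u"] t that by (simp_all add: dist_norm \<psi>D vD)
    qed
    then show ?thesis using t(1) by (simp add: vD)
  qed
  have vz: "v z \<noteq> 0" using v(2) z by auto
  have "\<psi> y = \<psi> z / v z * v y" for y
  proof -
    have "v (y - cscale I (\<psi> y / \<psi> z) z) = 0" by (rule ker) (use z in \<open>simp add: \<psi>D\<close>)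
    then have "v y = \<psi> y / \<psi> z * v z" by (simp add: vD)
    then show ?thesis using z vz by simp
  qed
  moreover have "cmod (\<psi> z / v z) = 1" using v(2) z by (simp add: norm_divide)
  ultimately show ?thesis using that v(1) by blast
qed

text \<open>If \<open>v\<close> gives the norm near \<open>z\<close>, then \<open>cnj \<circ> v \<circ> P\<close> is complex linear and gives the norm near the
preimage of \<open>z\<close>.\<close>

lemma antilinear_isometry_permutes_V:
  assumes e': "e' \<in> A" "e' \<noteq> e"
    and P: "linear P" "surj P" "\<And>y. N (P y) = N y" "\<And>y. P (I y) = - I (P y)" and v: "v \<in> V"
  obtains w c where "w \<in> V" "cmod c = 1" "\<And>y. cnj (v (P y)) = c * w y"
proof -
  have P_bound: "norm (P y) \<le> 3 * C\<^sup>2 / \<eta> * norm y" for y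
  proof -
    have "\<eta> / C * norm (P y) \<le> 3 * C * norm y"
      using N_lower[of "P y"] N_upper[of y] P(3)[of y] by linarith
    then show ?thesis using \<eta>\<epsilon>(1) C by (simp add: field_simps power2_eq_square)
  qed
  have blP: "bounded_linear P"
    using P(1) P_bound by (intro bounded_linear_intro[of _ "3 * C\<^sup>2 / \<eta>"]) (auto simp: linear_add linear_scale mult.commute)
  note vD = complex_functionalD[OF V_functional[OF v]]
  have "bounded_linear (\<lambda>y. cnj (v (P y)))"
    by (rule bounded_linear_compose[OF bounded_linear_cnj bounded_linear_compose[OF vD(1) blP]])
  then have \<psi>: "complex_functional I (\<lambda>y. cnj (v (P y)))"
    by (simp add: complex_functional_def P(4) vD)
  obtain z where z: "v z \<noteq> 0" "\<forall>\<^sub>F y in nhds z. N y = cmod (v y)" by (rule V_exposing_point[OF v])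
  obtain w where w: "P w = z" using P(2) by (metis surj_def)
  have "isCont P w" using blP by (rule linear_continuous_at)
  then have "(P \<longlongrightarrow> P w) (nhds w)" by (simp add: isCont_def tendsto_at_iff_tendsto_nhds)
  then have "\<forall>\<^sub>F y in nhds w. N (P y) = cmod (v (P y))"
    using z(2) unfolding w filterlim_iff by blast
  then have "\<forall>\<^sub>F y in nhds w. N y = cmod (cnj (v (P y)))" by (simp add: P(3))
  from local_modulus[OF e' \<psi> this] w z(1) that show ?thesis by auto
qed

end

text \<open>Coefficients of four linear forms on a two-dimensional complex space. Three forms can always be made
real by a choice of basis vectors and phases, and then conjugation preserves their moduli; hence a
fourth form with a coefficient that is not real. The six pairs have determinants of different absolute
values, and every form is the largest in modulus at some vector with coordinates in the unit disc.\<close>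

definition chiral_quadruple :: "(complex \<times> complex) set" where
  "chiral_quadruple = {(1, 0), (0, 1), (3/5, 7/10), (4/5, 9/10 * \<i>)}"

definition pair_det :: "complex \<times> complex \<Rightarrow> complex \<times> complex \<Rightarrow> complex" where
  "pair_det p q = fst p * snd q - snd p * fst q"

definition det2 :: "complex \<times> complex \<Rightarrow> complex \<times> complex \<Rightarrow> real" where
  "det2 p q = (cmod (pair_det p q))\<^sup>2"

text \<open>The map \<open>\<pi>\<close> multiplies the squared determinants by \<open>K\<close>; they lie between \<open>36/100\<close> and \<open>1\<close>, and both
bounds occur, so \<open>K = 1\<close>. As the six values are different, each pair is preserved, hence each element.\<close>

lemma chiral_quadruple_rigid:
  fixes K :: real and \<pi> :: "complex \<times> complex \<Rightarrow> complex \<times> complex"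
  assumes \<pi>: "\<And>p. p \<in> chiral_quadruple \<Longrightarrow> \<pi> p \<in> chiral_quadruple"
    and K: "\<And>p q. p \<in> chiral_quadruple \<Longrightarrow> q \<in> chiral_quadruple \<Longrightarrow> det2 (\<pi> p) (\<pi> q) = K * det2 p q"
    and ne: "\<pi> (1, 0) \<noteq> \<pi> (0, 1)" and p: "p \<in> chiral_quadruple"
  shows "\<pi> p = p"
proof -
  define P0 P1 P2 P3 :: "complex \<times> complex" where
    "P0 = (1, 0)" and "P1 = (0, 1)" and "P2 = (3/5, 7/10)" and "P3 = (4/5, 9/10 * \<i>)"
  have Q: "chiral_quadruple = {P0, P1, P2, P3}"
    by (simp add: chiral_quadruple_def P0_def P1_def P2_def P3_def)
  have sym: "det2 q p = det2 p q" for p q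
  proof -
    have "pair_det q p = - pair_det p q" by (simp add: pair_det_def)
    then show ?thesis by (simp add: det2_def)
  qed
  have self: "det2 p p = 0" for p by (simp add: det2_def pair_det_def)
  have d: "det2 P0 P1 = 1" "det2 P0 P2 = 49/100" "det2 P0 P3 = 81/100" "det2 P1 P2 = 36/100"
    "det2 P1 P3 = 64/100" "det2 P2 P3 = 6052/10000"
    by (simp_all add: det2_def pair_det_def P0_def P1_def P2_def P3_def norm_mult cmod_power2)
      (simp_all add: power2_eq_square)
  note d' = d d[THEN trans[OF sym]] self
  have in4: "q = P0 \<or> q = P1 \<or> q = P2 \<or> q = P3" if "q \<in> chiral_quadruple" for q
    using that by (auto simp: Q)
  have range: "36/100 \<le> det2 p q \<and> det2 p q \<le> 1" if "p \<in> chiral_quadruple" "q \<in> chiral_quadruple" "p \<noteq> q" for p q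
    using in4[OF that(1)] in4[OF that(2)] that(3) by (elim disjE) (simp_all add: d')
  have mem: "P0 \<in> chiral_quadruple" "P1 \<in> chiral_quadruple" "P2 \<in> chiral_quadruple" "P3 \<in> chiral_quadruple"
    by (simp_all add: Q)
  have ne': "\<pi> P0 \<noteq> \<pi> P1" using ne by (simp add: P0_def P1_def)
  have K1: "36/100 \<le> K" "K \<le> 1"
    using range[OF \<pi> \<pi> ne', OF mem(1,2)] K[OF mem(1,2)] d by simp_all
  have "\<pi> P1 \<noteq> \<pi> P2"
  proof
    assume eq: "\<pi> P1 = \<pi> P2"
    show False using K[OF mem(2,3)] K1(1) unfolding eq self d by simp
  qed
  then have "K = 1" using range[OF \<pi> \<pi>, OF mem(2,3)] K[OF mem(2,3)] K1 d by simp
  then have e: "det2 (\<pi> P0) (\<pi> P1) = 1" "det2 (\<pi> P0) (\<pi> P2) = 49/100" "det2 (\<pi> P0) (\<pi> P3) = 81/100"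
    using K[OF mem(1,2)] K[OF mem(1,3)] K[OF mem(1,4)] d by simp_all
  have 0: "\<pi> P0 = P0"
    using in4[OF \<pi>[OF mem(1)]] in4[OF \<pi>[OF mem(2)]] in4[OF \<pi>[OF mem(3)]] e(1,2)
    by (elim disjE) (simp_all add: d')
  have "\<pi> P1 = P1" "\<pi> P2 = P2" "\<pi> P3 = P3"
    using in4[OF \<pi>[OF mem(2)]] in4[OF \<pi>[OF mem(3)]] in4[OF \<pi>[OF mem(4)]] e unfolding 0
    by (auto simp: d')
  with 0 show ?thesis using in4[OF p] by auto
qed

text \<open>Polarization: the moduli of the two forms with both coefficients nonzero contain the real and the
imaginary part of the product.\<close>

lemma moduli_determine_product:
  assumes "cmod F = cmod a" "cmod G = cmod b"
    "cmod (3/5 * F + 7/10 * G) = cmod (3/5 * a + 7/10 * b)"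
    "cmod (4/5 * F + 9/10 * \<i> * G) = cmod (4/5 * a + 9/10 * \<i> * b)"
  shows "F * cnj G = a * cnj b"
proof -
  have 1: "(cmod F)\<^sup>2 = (cmod a)\<^sup>2" "(cmod G)\<^sup>2 = (cmod b)\<^sup>2" by (simp_all only: assms)
  have re: "(cmod (3/5 * F + 7/10 * G))\<^sup>2 = 9/25 * (cmod F)\<^sup>2 + 49/100 * (cmod G)\<^sup>2 + 42/50 * Re (F * cnj G)" for F G
    unfolding cmod_power2 by (simp add: power2_eq_square field_simps)
  have im: "(cmod (4/5 * F + 9/10 * \<i> * G))\<^sup>2 = 16/25 * (cmod F)\<^sup>2 + 81/100 * (cmod G)\<^sup>2 + 72/50 * Im (F * cnj G)" for F G
    unfolding cmod_power2 by (simp add: power2_eq_square field_simps)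
  have "Re (F * cnj G) = Re (a * cnj b)" "Im (F * cnj G) = Im (a * cnj b)"
    using re[of F G] re[of a b] im[of F G] im[of a b] unfolding assms(3,4) 1 by linarith+
  then show ?thesis by (rule complex_eqI)
qed

context rigid_frame
begin

text \<open>The permutation of \<open>V\<close> induced by \<open>P\<close> multiplies all determinants by the same factor, so it is the
identity, and \<open>P\<close> preserves \<open>f e y * cnj (f e' y)\<close>. This product is \<open>1\<close> at \<open>x e + x e'\<close> and \<open>- i\<close> at
\<open>x e + I (x e')\<close>, but conjugate linearity of \<open>P\<close> turns the first value into \<open>i\<close> at the second
point.\<close>

lemma no_antilinear_isometry:
  assumes e': "A = {e, e'}" "e' \<noteq> e"
    and V: "V = (\<lambda>p y. fst p * f e y + snd p * f e' y) ` chiral_quadruple"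
    and P: "linear P" "surj P" "\<And>y. N (P y) = N y" "\<And>y. P (I y) = - I (P y)"
  shows False
proof -
  define comb where "comb p y = fst p * f e y + snd p * f e' y" for p y
  have e'A: "e' \<in> A" using e' by simp
  have e'G: "e' \<in> \<Gamma>" using e'A A by blast
  note bo = biorth[OF eG eG] biorth[OF eG e'G] biorth[OF e'G eG] biorth[OF e'G e'G]
  note D = complex_functionalD[OF f[OF eG]] complex_functionalD[OF f[OF e'G]]
  have comb_x: "comb p (x e) = fst p" "comb p (x e') = snd p" for p
    using bo e'(2) by (auto simp: comb_def)
  have "\<exists>q\<in>chiral_quadruple. \<exists>c. cmod c = 1 \<and> (\<forall>y. cnj (comb p (P y)) = c * comb q y)"
    if "p \<in> chiral_quadruple" for p
  proof -
    have "comb p \<in> V" using that by (auto simp: V comb_def[abs_def])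
    then obtain w c where w: "w \<in> V" "cmod c = 1" "\<And>y. cnj (comb p (P y)) = c * w y"
      by (rule antilinear_isometry_permutes_V[OF e'A e'(2) P]) blast
    from w(1) obtain q where "q \<in> chiral_quadruple" "w = comb q" by (auto simp: V comb_def[abs_def])
    with w show ?thesis by blast
  qed
  then obtain \<pi> c where \<pi>: "\<And>p. p \<in> chiral_quadruple \<Longrightarrow> \<pi> p \<in> chiral_quadruple"
    and c: "\<And>p. p \<in> chiral_quadruple \<Longrightarrow> cmod (c p) = 1"
    and \<pi>c: "\<And>p y. p \<in> chiral_quadruple \<Longrightarrow> cnj (comb p (P y)) = c p * comb (\<pi> p) y"
    by metis
  have modulus: "cmod (comb p (P y)) = cmod (comb (\<pi> p) y)" if "p \<in> chiral_quadruple" for p y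
    using arg_cong[OF \<pi>c[OF that, of y], of cmod] c[OF that] by (simp add: norm_mult)
  have mem: "(1, 0) \<in> chiral_quadruple" "(0, 1) \<in> chiral_quadruple" "(3/5, 7/10) \<in> chiral_quadruple"
    "(4/5, 9/10 * \<i>) \<in> chiral_quadruple"
    by (simp_all add: chiral_quadruple_def)
  \<comment> \<open>The determinant of the map induced by \<open>P\<close> on the two coordinates \<open>f e\<close>, \<open>f e'\<close>.\<close>
  define \<kappa> where "\<kappa> = f e (P (x e)) * f e' (P (x e')) - f e (P (x e')) * f e' (P (x e))"
  have "det2 (\<pi> p) (\<pi> q) = (cmod \<kappa>)\<^sup>2 * det2 p q"
    if pq: "p \<in> chiral_quadruple" "q \<in> chiral_quadruple" for p q
  proof -
    have "comb p (P (x e)) * comb q (P (x e')) - comb p (P (x e')) * comb q (P (x e)) = pair_det p q * \<kappa>"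
      by (simp add: comb_def pair_det_def \<kappa>_def algebra_simps)
    then have "cnj (pair_det p q * \<kappa>) = cnj (comb p (P (x e))) * cnj (comb q (P (x e'))) - cnj (comb p (P (x e'))) * cnj (comb q (P (x e)))"
      by (metis complex_cnj_diff complex_cnj_mult)
    also have "\<dots> = c p * c q * pair_det (\<pi> p) (\<pi> q)"
      unfolding \<pi>c[OF pq(1)] \<pi>c[OF pq(2)] comb_x pair_det_def by (simp add: algebra_simps)
    finally have "cmod (cnj (pair_det p q * \<kappa>)) = cmod (c p * c q * pair_det (\<pi> p) (\<pi> q))" by simp
    then have "cmod (pair_det p q) * cmod \<kappa> = cmod (pair_det (\<pi> p) (\<pi> q))"
      using c pq by (simp add: norm_mult del: complex_cnj_mult)
    then show ?thesis unfolding det2_def by (simp add: power_mult_distrib flip: \<open>_ = cmod (pair_det (\<pi> p) (\<pi> q))\<close>)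
  qed
  moreover have "\<pi> (1, 0) \<noteq> \<pi> (0, 1)"
  proof
    assume eq: "\<pi> (1, 0) = \<pi> (0, 1)"
    obtain y where y: "P y = x e" using P(2) by (metis surj_def)
    have "cmod (comb (\<pi> (1, 0)) y) = 1" "cmod (comb (\<pi> (0, 1)) y) = 0"
      using modulus[OF mem(1), of y] modulus[OF mem(2), of y] by (simp_all add: y comb_x)
    then show False by (simp add: eq)
  qed
  ultimately have fix4: "\<pi> p = p" if "p \<in> chiral_quadruple" for p
    using chiral_quadruple_rigid[of \<pi> "(cmod \<kappa>)\<^sup>2" p] \<pi> that by blast
  have h: "f e (P y) * cnj (f e' (P y)) = f e y * cnj (f e' y)" for y
  proof (rule moduli_determine_product)
    show "cmod (f e (P y)) = cmod (f e y)" "cmod (f e' (P y)) = cmod (f e' y)"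
      using modulus[OF mem(1), of y] modulus[OF mem(2), of y] by (simp_all add: fix4 mem comb_def)
    show "cmod (3/5 * f e (P y) + 7/10 * f e' (P y)) = cmod (3/5 * f e y + 7/10 * f e' y)"
      using modulus[OF mem(3), of y] unfolding fix4[OF mem(3)] by (simp add: comb_def)
    show "cmod (4/5 * f e (P y) + 9/10 * \<i> * f e' (P y)) = cmod (4/5 * f e y + 9/10 * \<i> * f e' y)"
      using modulus[OF mem(4), of y] unfolding fix4[OF mem(4)] by (simp add: comb_def)
  qed
  have z: "f e (P (x e')) = 0" "f e' (P (x e)) = 0"
    using modulus[OF mem(1), of "x e'"] modulus[OF mem(2), of "x e"]
    by (simp_all add: fix4 mem comb_def bo e'(2) e'(2)[symmetric])
  have "f e (P (x e)) * cnj (f e' (P (x e'))) = 1"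
    using h[of "x e + x e'"] by (simp add: linear_add[OF P(1)] D z bo e'(2) e'(2)[symmetric])
  moreover have "\<i> * (f e (P (x e)) * cnj (f e' (P (x e')))) = - \<i>"
    using h[of "x e + I (x e')"]
    by (simp add: linear_add[OF P(1)] P(4) D z bo e'(2) e'(2)[symmetric] algebra_simps)
  ultimately show False by (simp add: complex_eq_iff)
qed

end

lemma card_structures_two:
  fixes I :: "'a::real_normed_vector \<Rightarrow> 'a"
  assumes N: "equivalent_norm N" and S: "isometric_complex_structures N = {I, J}" "I \<noteq> J"
    and no: "(I, J) \<notin> isometric_structs_rel N"
  shows "card (complex_structures_upto_isometry N) = 2"
proof -
  let ?r = "isometric_structs_rel N"
  have eq: "equiv {I, J} ?r" using equiv_isometric_structs_rel[OF N] by (simp add: S)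
  have sub: "?r \<subseteq> {I, J} \<times> {I, J}" by (rule equiv_type[OF eq])
  have "(J, I) \<notin> ?r" using no eq by (meson equivE symD)
  moreover have "(I, I) \<in> ?r" "(J, J) \<in> ?r" using eq by (auto simp: equiv_def refl_on_def)
  ultimately have "?r `` {I} = {I}" "?r `` {J} = {J}" using sub no by auto
  then have "{I, J} // ?r = {{I}, {J}}" by (auto simp: quotient_def)
  then show ?thesis using S(2) by (simp add: complex_structures_upto_isometry_def S)
qed

lemma card_structures_one:
  fixes I :: "'a::real_normed_vector \<Rightarrow> 'a"
  assumes N: "equivalent_norm N" and S: "isometric_complex_structures N = {I, J}"
    and rel: "(I, J) \<in> isometric_structs_rel N"
  shows "card (complex_structures_upto_isometry N) = 1"
proof -
  let ?r = "isometric_structs_rel N"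
  have eq: "equiv {I, J} ?r" using equiv_isometric_structs_rel[OF N] by (simp add: S)
  have "?r `` {I} = ?r `` {J}" using equiv_class_eq[OF eq rel] .
  then have "{I, J} // ?r = {?r `` {J}}" by (auto simp: quotient_def)
  then show ?thesis by (simp add: complex_structures_upto_isometry_def S)
qed

section \<open>Construction of the two norms\<close>

text \<open>This covers both situations of the theorem. Either \<open>Z\<close> is \<open>X\<close> itself with \<open>J = I\<close>, \<open>a = id\<close> and
\<open>b = - I\<close>, or \<open>X\<close> is isomorphic to \<open>Z\<close> + \<open>Z\<close>, \<open>J = 0\<close>, and \<open>a\<close>, \<open>b\<close> are multiples of the two coordinates. In
both cases a real functional \<open>h\<close> on \<open>Z\<close> yields the complex functional \<open>h (a y) + i h (b y)\<close>.\<close>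

locale complexification =
  J: complex_or_trivial J for J :: "'z::real_normed_vector \<Rightarrow> 'z" +
  fixes I :: "'a::real_normed_vector \<Rightarrow> 'a" and a b :: "'a \<Rightarrow> 'z" and j :: "'z \<Rightarrow> 'a" and C :: real
  assumes bounded: "bounded_linear I" "bounded_linear a" "bounded_linear b"
    and I_I: "\<And>y. I (I y) = - y" and a_I: "\<And>y. a (I y) = - b y" and b_I: "\<And>y. b (I y) = a y"
    and J_ab: "(\<forall>y. J (a y) = - b y \<and> J (b y) = a y) \<or> (\<forall>z. J z = 0)"
    and a_j: "\<And>z. a (j z) = z" and b_j: "\<And>z. b (j z) = - J z" and norm_j: "\<And>z. norm (j z) \<le> norm z"
    and bounds: "\<And>y. norm (a y) \<le> C * norm y" "\<And>y. norm (b y) \<le> C * norm y"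
      "\<And>y. norm (I y) \<le> C * norm y" "\<And>y. norm y \<le> C * max (norm (a y)) (norm (b y))"
begin

definition lift :: "('z \<Rightarrow> real) \<Rightarrow> 'a \<Rightarrow> complex" where
  "lift h y = Complex (h (a y)) (h (b y))"

lemma lift_functional:
  assumes "bounded_linear h"
  shows "complex_functional I (lift h)"
  unfolding complex_functional_def
proof
  have "bounded_linear (\<lambda>y. of_real (h (a y)) + \<i> * of_real (h (b y)))"
    by (intro bounded_linear_add bounded_linear_const_mult bounded_linear_compose[OF bounded_linear_of_real]
        bounded_linear_compose[OF assms] bounded)
  then show "bounded_linear (lift h)" by (simp add: lift_def[abs_def] Complex_eq)
  show "\<forall>y. lift h (I y) = \<i> * lift h y"
    by (simp add: lift_def a_I b_I complex_eq_iff linear_neg bounded_linear.linear[OF assms])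
qed

lemma lift_bound:
  assumes "\<And>z. \<bar>h z\<bar> \<le> B * norm z" "0 \<le> B"
  shows "cmod (lift h y) \<le> 2 * B * C * norm y"
proof -
  have "cmod (lift h y) \<le> \<bar>h (a y)\<bar> + \<bar>h (b y)\<bar>" unfolding lift_def by (rule order_trans[OF cmod_le]) simp
  also have "\<dots> \<le> B * norm (a y) + B * norm (b y)" by (intro add_mono assms)
  also have "\<dots> \<le> B * (C * norm y) + B * (C * norm y)"
    by (intro add_mono mult_left_mono bounds assms)
  finally show ?thesis by simp
qed

lemma lift_scale: "lift (\<lambda>z. r * h z) y = of_real r * lift h y"
  by (simp add: lift_def complex_eq_iff)

lemma lift_zero:
  assumes "lift h y = 0" "linear h"
  shows "h (a y) = 0" "h (b y) = 0" "h (J (a y)) = 0" "h (J (b y)) = 0"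
proof -
  show 1: "h (a y) = 0" "h (b y) = 0" using assms(1) by (simp_all add: lift_def complex_eq_iff)
  show "h (J (a y)) = 0" "h (J (b y)) = 0"
    using J_ab 1 assms(2) by (auto simp: linear_neg linear_0)
qed

lemma lift_norming:
  obtains h where "bounded_linear h" "\<And>z. \<bar>h z\<bar> \<le> norm z" "norm y \<le> C * cmod (lift h y)"
proof -
  define w where "w = (if norm (a y) \<le> norm (b y) then b y else a y)"
  obtain h where h: "bounded_linear h" "h w = norm w" "\<And>z. \<bar>h z\<bar> \<le> norm z" using norming_functional[of w] by blast
  have w: "norm w = max (norm (a y)) (norm (b y))" by (simp add: w_def max_def)
  have "\<bar>h w\<bar> \<le> cmod (lift h y)" unfolding lift_def w_def
    using abs_Re_le_cmod[of "Complex (h (a y)) (h (b y))"] abs_Im_le_cmod[of "Complex (h (a y)) (h (b y))"] by simp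
  then have 1: "max (norm (a y)) (norm (b y)) \<le> cmod (lift h y)" unfolding h(2) w by linarith
  have "norm y \<le> C * cmod (lift h y)"
  proof (cases "C \<ge> 0")
    case True
    then show ?thesis using bounds(4)[of y] mult_left_mono[OF 1, of C] by linarith
  next
    case False
    have "0 \<le> max (norm (a y)) (norm (b y))" by (simp add: le_max_iff_disj)
    with False have "C * max (norm (a y)) (norm (b y)) \<le> 0" by (simp add: mult_nonpos_nonneg)
    with bounds(4)[of y] have "norm y \<le> 0" by linarith
    then have "y = 0" by simp
    then show ?thesis using h bounded by (simp add: lift_def linear_0 bounded_linear.linear flip: zero_complex.code)
  qed
  then show ?thesis using that h by blast
qed

text \<open>It remains to choose the constants: \<open>\<eta>\<close> in terms of the bounds of the system, and then \<open>\<epsilon>\<close> in terms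
of \<open>\<eta>\<close>. That the functionals \<open>g p\<close> and those in \<open>Q\<close> are lifted from \<open>Z\<close> is recorded for the
invariance of the norm under conjugation.\<close>

lemma rigid_frame_exists:
  assumes S: "biorthogonal J S" and D: "1 \<le> D" "\<And>p y. p \<in> S \<Longrightarrow> \<bar>snd p y\<bar> \<le> D * norm y"
    and G: "\<And>p. p \<in> S - A \<Longrightarrow> bounded_linear (G p)" "\<And>p y. p \<in> S - A \<Longrightarrow> \<bar>G p y\<bar> \<le> norm y"
    and total: "\<And>y. (\<forall>p\<in>S. snd p y = 0 \<and> snd p (J y) = 0) \<Longrightarrow>
      (\<forall>p\<in>S - A. G p y = 0 \<and> G p (J y) = 0) \<Longrightarrow> y = 0"
    and A: "finite A" "A \<subseteq> S" "e \<in> A" "card A \<le> 2"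
    and V: "finite V" "\<And>q. q \<in> A \<Longrightarrow> lift (snd q) \<in> V"
      "\<And>v. v \<in> V \<Longrightarrow> \<exists>\<alpha>. (\<forall>q\<in>A. cmod (\<alpha> q) \<le> 1) \<and> v = (\<lambda>y. \<Sum>q\<in>A. \<alpha> q * lift (snd q) y)"
      "\<And>q. q \<in> A \<Longrightarrow> q \<noteq> e \<Longrightarrow>
        \<exists>\<alpha> \<beta>. \<alpha> \<noteq> 0 \<and> \<beta> \<noteq> 0 \<and> (\<lambda>y. \<alpha> * lift (snd e) y + \<beta> * lift (snd q) y) \<in> V"
      "\<And>v. v \<in> V \<Longrightarrow> \<exists>z. norm z \<le> 2 * (1 + C) \<and> (\<forall>p\<in>S - A. lift (snd p) z = 0) \<and>
        (\<forall>q\<in>A. cmod (lift (snd q) z) \<le> 1) \<and> 1 \<le> cmod (v z) \<and> (\<forall>w\<in>V - {v}. cmod (w z) < cmod (v z))"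
  obtains g Q C' \<epsilon> \<eta> where
    "rigid_frame I S A e (\<lambda>p. j (fst p)) (\<lambda>p. lift (snd p)) g V Q C' \<epsilon> \<eta>"
    "\<And>p. p \<in> S - A \<Longrightarrow> \<exists>h. linear h \<and> g p = lift h" "\<And>\<phi>. \<phi> \<in> Q \<Longrightarrow> \<exists>h. linear h \<and> \<phi> = lift h"
proof -
  define C' where "C' = (1 + D) * (2 + 2 * \<bar>C\<bar>)\<^sup>2"
  define B where "B = 2 + 2 * \<bar>C\<bar>"
  have B: "2 \<le> B" "2 * C \<le> B" "C \<le> B" "1 + C \<le> B" by (auto simp: B_def)
  have BB: "2 * B \<le> B\<^sup>2" using B by (simp add: power2_eq_square mult_right_mono)
  have "1 * B\<^sup>2 \<le> (1 + D) * B\<^sup>2" using D by (intro mult_right_mono) auto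
  then have C'B: "B\<^sup>2 \<le> C'" by (simp add: C'_def B_def)
  have "D * B \<le> (1 + D) * B\<^sup>2" using D B BB by (intro mult_mono) auto
  then have DB: "D * B \<le> C'" by (simp add: C'_def B_def)
  have C'1: "1 \<le> C'" "C \<le> C'" "1 + C \<le> C'" using C'B BB B by linarith+
  define \<eta> where "\<eta> = 1 / (64 * C')"
  define M where "M = C' * (3 * C'\<^sup>2 / \<eta> + C')"
  define \<epsilon> where "\<epsilon> = 1 / (64 * M)"
  have \<eta>: "0 < \<eta>" "64 * (C' * \<eta>) \<le> 1" using C'1 by (simp_all add: \<eta>_def)
  have "0 \<le> 3 * C'\<^sup>2 / \<eta>" using \<eta>(1) by simp
  then have "C' * 1 \<le> C' * (3 * C'\<^sup>2 / \<eta> + C')" using C'1 by (intro mult_left_mono) linarith+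
  then have M: "C' \<le> M" by (simp add: M_def)
  then have Mpos: "0 < M" using C'1 by linarith
  have \<epsilon>: "0 < \<epsilon>" "64 * (C' * \<epsilon>) \<le> 1" "2 * (\<epsilon> * M) < 1" using Mpos M by (simp_all add: \<epsilon>_def)
  define g where "g p = lift (\<lambda>z. \<epsilon> / B * G p z)" for p
  define Q where "Q = {lift (\<lambda>z. \<eta> / B * h z) |h. bounded_linear h \<and> (\<forall>z. \<bar>h z\<bar> \<le> norm z)}"
  have lin: "linear (snd p)" "bounded_linear (snd p)" if "p \<in> S" for p using biorthogonalD[OF S that] by auto
  have bl: "bounded_linear (\<lambda>z. r * h z)" if "bounded_linear h" for r and h :: "'z \<Rightarrow> real"
    using that by (rule bounded_linear_const_mult)
  have scaled: "cmod (lift (\<lambda>z. r / B * h z) y) \<le> r * norm y" if "\<And>z. \<bar>h z\<bar> \<le> norm z" "0 < r" for r h y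
  proof -
    have "cmod (lift h y) \<le> 2 * 1 * C * norm y" by (rule lift_bound) (use that in auto)
    also have "\<dots> \<le> B * norm y" using B by (intro mult_right_mono) auto
    finally have "r / B * cmod (lift h y) \<le> r / B * (B * norm y)" using that(2) B by (intro mult_left_mono) auto
    also have "\<dots> = r * norm y" using B by simp
    finally show ?thesis unfolding lift_scale norm_mult norm_of_real using B that(2) by simp
  qed
  have "rigid_frame I S A e (\<lambda>p. j (fst p)) (\<lambda>p. lift (snd p)) g V Q C' \<epsilon> \<eta>"
  proof (rule rigid_frame.intro)
    show "norm (I y) \<le> C' * norm y" for y
      using bounds(3)[of y] mult_right_mono[OF C'1(2), of "norm y"] by simp
    show "complex_functional I (lift (snd p))" if "p \<in> S" for p using lin(2)[OF that] by (rule lift_functional)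
    show "cmod (lift (snd p) y) \<le> C' * norm y" if "p \<in> S" for p y
    proof -
      have "cmod (lift (snd p) y) \<le> 2 * D * C * norm y" by (rule lift_bound) (use D that in auto)
      also have "\<dots> = D * (2 * C) * norm y" by simp
      also have "\<dots> \<le> D * B * norm y" using D B by (intro mult_right_mono mult_left_mono) auto
      also have "\<dots> \<le> C' * norm y" using DB by (intro mult_right_mono) auto
      finally show ?thesis .
    qed
    show "lift (snd p) (j (fst q)) = of_bool (p = q)" if "p \<in> S" "q \<in> S" for p q
      using biorthogonalD(4,5)[OF S that(1) that(2)] lin(1)[OF that(1)]
      by (simp add: lift_def a_j b_j linear_neg complex_eq_iff)
    show "norm (j (fst p)) \<le> 1" if "p \<in> S" for p using norm_j[of "fst p"] biorthogonalD(3)[OF S that] by simp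
    show "complex_functional I (g p)" if "p \<in> S - A" for p
      unfolding g_def using G(1)[OF that] by (intro lift_functional bl)
    show "cmod (g p y) \<le> \<epsilon> * norm y" if "p \<in> S - A" for p y
      unfolding g_def by (rule scaled[OF G(2)[OF that] \<epsilon>(1)])
    show "y = 0" if f0: "\<And>p. p \<in> S \<Longrightarrow> lift (snd p) y = 0" and g0: "\<And>p. p \<in> S - A \<Longrightarrow> g p y = 0" for y
    proof -
      have G0: "lift (G p) y = 0" if "p \<in> S - A" for p
        using g0[OF that] \<epsilon>(1) B unfolding g_def lift_scale by simp
      have "a y = 0" "b y = 0"
        using lift_zero[OF f0 lin(1)] lift_zero[OF G0 bounded_linear.linear[OF G(1)]] by (auto intro!: total)
      then show "y = 0" using bounds(4)[of y] by simp
    qed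
    show "complex_functional I \<phi>" if \<phi>: "\<phi> \<in> Q" for \<phi>
    proof -
      obtain h where "\<phi> = lift (\<lambda>z. \<eta> / B * h z)" "bounded_linear h" using \<phi> unfolding Q_def by blast
      then show ?thesis by (simp only: lift_functional[OF bl])
    qed
    show "cmod (\<phi> y) \<le> \<eta> * norm y" if "\<phi> \<in> Q" for \<phi> y
      using that scaled \<eta>(1) unfolding Q_def by blast
    show "\<exists>\<phi>\<in>Q. \<eta> * norm y \<le> C' * cmod (\<phi> y)" for y
    proof -
      obtain h where h: "bounded_linear h" "\<And>z. \<bar>h z\<bar> \<le> norm z" "norm y \<le> C * cmod (lift h y)"
        using lift_norming[of y] by blast
      have "\<eta> * norm y \<le> \<eta> * (C * cmod (lift h y))" using h(3) \<eta>(1) by (intro mult_left_mono) auto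
      also have "\<dots> \<le> \<eta> * (B * cmod (lift h y))" using B \<eta>(1) by (intro mult_left_mono mult_right_mono) auto
      also have "\<dots> = B\<^sup>2 * cmod (lift (\<lambda>z. \<eta> / B * h z) y)"
        unfolding lift_scale norm_mult norm_of_real using B \<eta>(1) by (simp add: power2_eq_square)
      also have "\<dots> \<le> C' * cmod (lift (\<lambda>z. \<eta> / B * h z) y)" using C'B by (intro mult_right_mono) auto
      finally show ?thesis using h(1,2) unfolding Q_def by blast
    qed
    show "2 * (\<epsilon> * (C' * (3 * C'\<^sup>2 / \<eta> + C'))) < 1" using \<epsilon>(3) by (simp add: M_def)
    show "\<exists>z. norm z \<le> 2 * C' \<and> (\<forall>p\<in>S - A. lift (snd p) z = 0) \<and>
        (\<forall>q\<in>A. cmod (lift (snd q) z) \<le> 1) \<and> 1 \<le> cmod (v z) \<and> (\<forall>w\<in>V - {v}. cmod (w z) < cmod (v z))"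
      if v: "v \<in> V" for v
    proof -
      have "2 * (1 + C) \<le> 2 * C'" using C'1 by simp
      then show ?thesis using V(5)[OF v] by (meson order_trans)
    qed
  qed (fact bounded I_I C'1 A \<eta> \<epsilon> V)+
  moreover have "\<exists>h. linear h \<and> g p = lift h" if "p \<in> S - A" for p
    using bounded_linear.linear[OF bl[OF G(1)[OF that]]] unfolding g_def by blast
  moreover have "\<exists>h. linear h \<and> \<phi> = lift h" if "\<phi> \<in> Q" for \<phi>
    using that bounded_linear.linear[OF bl] unfolding Q_def by blast
  ultimately show ?thesis using that by blast
qed

end

text \<open>A total system with at most one element embeds the space in the complex plane.\<close>

lemma two_elements_if_dim_ge_4:
  fixes S :: "('a::real_normed_vector \<times> ('a \<Rightarrow> real)) set"
  assumes dim: "dim_ge 4 (UNIV :: 'a set)" and I: "linear I"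
    and lin: "\<And>p. p \<in> S \<Longrightarrow> linear (snd p)"
    and total: "\<And>y. finite S \<Longrightarrow> (\<And>p. p \<in> S \<Longrightarrow> snd p y = 0 \<and> snd p (I y) = 0) \<Longrightarrow> y = 0"
  obtains e e' where "e \<in> S" "e' \<in> S" "e' \<noteq> e"
proof (rule ccontr)
  assume "\<not> thesis"
  then have "\<exists>q. S \<subseteq> {q}" using that by blast
  then obtain q where q: "S \<subseteq> {q}" by blast
  define h where "h = (if q \<in> S then snd q else (\<lambda>_. 0))"
  define L where "L y = Complex (h y) (h (I y))" for y
  have lh: "linear h" using lin by (simp add: h_def linear_zero)
  have "linear L"
    using lh I by (intro linearI) (simp_all add: L_def linear_add linear_scale complex_eq_iff)
  have "y = 0" if "L y = 0" for y
  proof (rule total)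
    show "finite S" using q finite_subset by blast
    show "snd p y = 0 \<and> snd p (I y) = 0" if "p \<in> S" for p
      using \<open>L y = 0\<close> q that by (auto simp: L_def h_def complex_eq_iff)
  qed
  then have inj: "inj L" using \<open>linear L\<close> by (simp add: linear_injective_0)
  obtain B :: "'a set" where B: "independent B" "finite B \<Longrightarrow> 4 \<le> card B"
    using dim unfolding dim_ge_def by blast
  have "independent (L ` B)"
    using linear_independent_injective_image[OF \<open>linear L\<close> B(1)] inj inj_on_subset by blast
  then have "finite (L ` B)" "card (L ` B) \<le> DIM(complex)" using independent_bound by blast+
  moreover have "inj_on L B" using inj inj_on_subset by blast
  ultimately have "finite B" "card B \<le> 2" by (simp_all add: finite_image_iff card_image)
  then show False using B(2) by simp
qed

lemma chiral_quadruple_exposed: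
  assumes "p \<in> chiral_quadruple"
  shows "\<exists>s t. cmod s \<le> 1 \<and> cmod t \<le> 1 \<and> 1 \<le> cmod (fst p * s + snd p * t) \<and>
    (\<forall>q\<in>chiral_quadruple - {p}. cmod (fst q * s + snd q * t) < cmod (fst p * s + snd p * t))"
proof -
  have less: "cmod z < cmod w" if "(cmod z)\<^sup>2 < (cmod w)\<^sup>2" for z w :: complex
    using that by (simp add: power2_less_imp_less)
  have le: "1 \<le> cmod w" if "1 \<le> (cmod w)\<^sup>2" for w :: complex
    using that power2_le_imp_le[of 1 "cmod w"] by simp
  consider "p = (1, 0)" | "p = (0, 1)" | "p = (3/5, 7/10)" | "p = (4/5, 9/10 * \<i>)"
    using assms by (auto simp: chiral_quadruple_def)
  then show ?thesis
  proof cases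
    case 1
    then show ?thesis
      by (intro exI[of _ 1] exI[of _ 0]) (auto simp: chiral_quadruple_def)
  next
    case 2
    then show ?thesis
      by (intro exI[of _ 0] exI[of _ 1]) (auto simp: chiral_quadruple_def norm_mult)
  next
    case 3
    then show ?thesis
      by (intro exI[of _ 1] exI[of _ 1] conjI le ballI less)
        (unfold 3 cmod_power2, auto simp: chiral_quadruple_def power2_eq_square)
  next
    case 4
    then show ?thesis
      by (intro exI[of _ 1] exI[of _ "- \<i>"] conjI le ballI less)
        (unfold 4 cmod_power2, auto simp: chiral_quadruple_def power2_eq_square)
  qed
qed

text \<open>The structures \<open>I\<close> and \<open>- I\<close> are the only ones, and an isometry that identifies them would be
conjugate-linear.\<close>

theorem exactly_two_structures:
  assumes dim: "dim_ge 4 (UNIV :: 'a::banach set)" and adm: "admits_complex_structure TYPE('a)"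
  shows "\<exists>N :: 'a \<Rightarrow> real. equivalent_norm N \<and> card (complex_structures_upto_isometry N) = 2"
proof -
  obtain I :: "'a \<Rightarrow> 'a" where bI: "bounded_linear I" and II: "\<And>y. I (I y) = - y"
    using adm unfolding admits_complex_structure_def by blast
  have lI: "linear I" using bI by (rule bounded_linear.linear)
  interpret J: complex_or_trivial I by (intro complex_or_trivial.intro bI) (simp add: II)
  define C where "C = J.K"
  have C: "1 \<le> C" "norm (I y) \<le> C * norm y" "norm y \<le> C * norm y" for y
    using J.K_ge_1 J.norm_I_le mult_right_mono[OF J.K_ge_1, of "norm y"] by (auto simp: C_def)
  interpret complexification I I "\<lambda>y. y" "\<lambda>y. - I y" "\<lambda>y. y" C
  proof (rule complexification.intro[OF J.complex_or_trivial_axioms complexification_axioms.intro])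
    show "norm y \<le> C * max (norm y) (norm (- I y))" for y
    proof -
      have "C * norm y \<le> C * max (norm y) (norm (- I y))" using C(1) by (intro mult_left_mono) auto
      then show ?thesis using C(3)[of y] by linarith
    qed
  qed (use bI II C in \<open>auto intro: bounded_linear_ident bounded_linear_minus simp: linear_neg[OF lI]\<close>)
  obtain S D where S: "biorthogonal I S" and D: "1 \<le> D" "\<And>p y. p \<in> S \<Longrightarrow> \<bar>snd p y\<bar> \<le> D * norm y"
    and G: "\<And>A. finite A \<Longrightarrow> \<exists>g. (\<forall>p\<in>S - A. bounded_linear (g p) \<and> (\<forall>y. \<bar>g p y\<bar> \<le> norm y)) \<and>
       (\<forall>y. (\<forall>p\<in>S. snd p y = 0 \<and> snd p (I y) = 0) \<longrightarrow> (\<forall>p\<in>S - A. g p y = 0 \<and> g p (I y) = 0) \<longrightarrow> y = 0)"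
    by (rule J.total_biorthogonal_system) blast
  obtain e e' where e: "e \<in> S" "e' \<in> S" "e' \<noteq> e"
  proof (rule two_elements_if_dim_ge_4[OF dim lI])
    show "linear (snd p)" if "p \<in> S" for p using biorthogonalD(2)[OF S that] .
    show "y = 0" if "finite S" "\<And>p. p \<in> S \<Longrightarrow> snd p y = 0 \<and> snd p (I y) = 0" for y
      using G[OF that(1)] that(2) by auto
  qed blast
  define A where "A = {e, e'}"
  have finA: "finite A" by (simp add: A_def)
  obtain g0 where g0': "(\<forall>p\<in>S - A. bounded_linear (g0 p) \<and> (\<forall>y. \<bar>g0 p y\<bar> \<le> norm y)) \<and>
      (\<forall>y. (\<forall>p\<in>S. snd p y = 0 \<and> snd p (I y) = 0) \<longrightarrow> (\<forall>p\<in>S - A. g0 p y = 0 \<and> g0 p (I y) = 0) \<longrightarrow> y = 0)"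
    using G[OF finA] by (rule exE)
  have g0: "\<And>p. p \<in> S - A \<Longrightarrow> bounded_linear (g0 p)" "\<And>p y. p \<in> S - A \<Longrightarrow> \<bar>g0 p y\<bar> \<le> norm y"
    "\<And>y. (\<forall>p\<in>S. snd p y = 0 \<and> snd p (I y) = 0) \<Longrightarrow>
      (\<forall>p\<in>S - A. g0 p y = 0 \<and> g0 p (I y) = 0) \<Longrightarrow> y = 0"
    using g0' by blast+
  \<comment> \<open>The four forms of the chiral quadruple in the coordinates \<open>f e\<close> and \<open>f e'\<close>.\<close>
  define comb where "comb p y = fst p * lift (snd e) y + snd p * lift (snd e') y" for p :: "complex \<times> complex" and y
  define V where "V = comb ` chiral_quadruple"
  have bo: "lift (snd p) (fst q) = of_bool (p = q)" if "p \<in> S" "q \<in> S" for p q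
    using biorthogonalD(4,5)[OF S that] biorthogonalD(2)[OF S that(1)]
    by (simp add: lift_def linear_neg complex_eq_iff)
  have sumA: "(\<Sum>q\<in>A. \<alpha> q * lift (snd q) y) = \<alpha> e * lift (snd e) y + \<alpha> e' * lift (snd e') y" for \<alpha> y
    using e(3) by (simp add: A_def)
  obtain g Q C' \<epsilon> \<eta> where frame: "rigid_frame I S A e fst (\<lambda>p. lift (snd p)) g V Q C' \<epsilon> \<eta>"
  proof (rule rigid_frame_exists[OF S D g0])
    show "finite A" "A \<subseteq> S" "e \<in> A" "card A \<le> 2" using e by (auto simp: A_def)
    show "finite V" by (simp add: V_def chiral_quadruple_def)
    show "lift (snd q) \<in> V" if "q \<in> A" for q
    proof -
      have "comb (1, 0) = lift (snd e)" "comb (0, 1) = lift (snd e')" by (simp_all add: comb_def fun_eq_iff)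
      moreover have "comb (1, 0) \<in> V" "comb (0, 1) \<in> V" by (simp_all add: V_def chiral_quadruple_def)
      ultimately show ?thesis using that by (auto simp: A_def)
    qed
    show "\<exists>\<alpha>. (\<forall>q\<in>A. cmod (\<alpha> q) \<le> 1) \<and> v = (\<lambda>y. \<Sum>q\<in>A. \<alpha> q * lift (snd q) y)" if v: "v \<in> V" for v
    proof -
      obtain p where p: "p \<in> chiral_quadruple" "v = comb p" using v unfolding V_def by blast
      have "cmod (fst p) \<le> 1 \<and> cmod (snd p) \<le> 1" using p(1) by (auto simp: chiral_quadruple_def norm_mult norm_divide)
      then show ?thesis unfolding sumA using p(2) e(3)
        by (intro exI[of _ "\<lambda>q. if q = e then fst p else snd p"]) (auto simp: comb_def[abs_def] A_def)
    qed
    show "\<exists>\<alpha> \<beta>. \<alpha> \<noteq> 0 \<and> \<beta> \<noteq> 0 \<and> (\<lambda>y. \<alpha> * lift (snd e) y + \<beta> * lift (snd q) y) \<in> V"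
      if "q \<in> A" "q \<noteq> e" for q
    proof (intro exI conjI)
      have "comb (3/5, 7/10) \<in> V" by (simp add: V_def chiral_quadruple_def)
      moreover have "q = e'" using that by (simp add: A_def)
      ultimately show "(\<lambda>y. 3/5 * lift (snd e) y + 7/10 * lift (snd q) y) \<in> V" by (simp add: comb_def[abs_def])
    qed simp_all
    show "\<exists>z. norm z \<le> 2 * (1 + C) \<and> (\<forall>p\<in>S - A. lift (snd p) z = 0) \<and>
        (\<forall>q\<in>A. cmod (lift (snd q) z) \<le> 1) \<and> 1 \<le> cmod (v z) \<and> (\<forall>w\<in>V - {v}. cmod (w z) < cmod (v z))"
      if v: "v \<in> V" for v
    proof -
      obtain p where p: "p \<in> chiral_quadruple" "v = comb p" using v unfolding V_def by blast
      obtain s t where st: "cmod s \<le> 1" "cmod t \<le> 1" "1 \<le> cmod (fst p * s + snd p * t)"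
        "\<forall>q\<in>chiral_quadruple - {p}. cmod (fst q * s + snd q * t) < cmod (fst p * s + snd p * t)"
        using chiral_quadruple_exposed[OF p(1)] by blast
      define z where "z = cscale I s (fst e) + cscale I t (fst e')"
      have cs: "norm (cscale I c y) \<le> 1 + C" if "cmod c \<le> 1" "norm y = 1" for c y
      proof -
        have "norm (cscale I c y) \<le> \<bar>Re c\<bar> * norm y + \<bar>Im c\<bar> * norm (I y)"
          unfolding cscale_def by (rule order_trans[OF norm_triangle_ineq]) simp
        also have "\<dots> \<le> 1 * 1 + 1 * C"
          using that C(2)[of y] abs_Re_le_cmod[of c] abs_Im_le_cmod[of c] by (intro add_mono mult_mono) auto
        finally show ?thesis by simp
      qed
      have "norm z \<le> 2 * (1 + C)"
        unfolding z_def using cs[OF st(1) biorthogonalD(3)[OF S e(1)]] cs[OF st(2) biorthogonalD(3)[OF S e(2)]]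
        by (intro order_trans[OF norm_triangle_ineq]) simp
      moreover have lz: "lift (snd q) z = s * of_bool (q = e) + t * of_bool (q = e')" if "q \<in> S" for q
      proof -
        note cf = complex_functionalD[OF lift_functional[OF biorthogonalD(1)[OF S that]]]
        show ?thesis by (simp add: z_def cf(4,9) bo that e)
      qed
      moreover have cz: "comb q z = fst q * s + snd q * t" for q
        using e by (simp add: comb_def lz)
      have "cmod (w z) < cmod (v z)" if w: "w \<in> V - {v}" for w
      proof -
        obtain q where q: "q \<in> chiral_quadruple" "w = comb q" using w unfolding V_def by blast
        then have "q \<noteq> p" using w p(2) by auto
        then show ?thesis using st(4) q p(2) by (simp add: cz)
      qed
      moreover have "1 \<le> cmod (v z)" using st(3) by (simp add: p(2) cz)
      moreover have "cmod (lift (snd q) z) \<le> 1" if "q \<in> A" for q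
        using that st(1,2) e by (auto simp: A_def lz)
      moreover have "lift (snd q) z = 0" if "q \<in> S - A" for q
        using that by (simp add: A_def lz)
      ultimately show ?thesis by (intro exI[of _ z]) blast
    qed
  qed blast
  interpret F: rigid_frame I S A e fst "\<lambda>p. lift (snd p)" g V Q C' \<epsilon> \<eta> by (rule frame)
  have V: "V = (\<lambda>p y. fst p * lift (snd e) y + snd p * lift (snd e') y) ` chiral_quadruple"
    by (simp add: V_def comb_def[abs_def])
  have "(I, \<lambda>y. - I y) \<notin> isometric_structs_rel F.N"
    using F.no_antilinear_isometry[OF A_def e(3) V]
    unfolding isometric_structs_rel_def linear_isometry_def by blast
  moreover have "I \<noteq> (\<lambda>y. - I y)"
  proof
    assume "I = (\<lambda>y. - I y)"
    then have "I (fst e) = - I (fst e)" by metis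
    then have "I (fst e) = 0" by (simp add: eq_neg_iff_add_eq_0 flip: scaleR_2)
    then have "I (I (fst e)) = 0" using linear_0[OF lI] by simp
    then show False using II[of "fst e"] biorthogonalD(3)[OF S e(1)] by auto
  qed
  ultimately show ?thesis
    using card_structures_two[OF F.equivalent_norm_N F.structures_eq] F.equivalent_norm_N by blast
qed

text \<open>All functionals come from real functionals on \<open>Z\<close>, so conjugation replaces their values by complex
conjugates and preserves the norm. It identifies \<open>I\<close> with \<open>- I\<close>.\<close>

theorem unique_structure:
  fixes T :: "'a::banach \<Rightarrow> 'z::banach \<times> 'z"
  assumes T: "toplinear_iso T"
  shows "\<exists>N :: 'a \<Rightarrow> real. equivalent_norm N \<and> card (complex_structures_upto_isometry N) = 1"
proof -
  define U where "U = inv T"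
  have bT: "bounded_linear T" and bU: "bounded_linear U" and bij: "bij T"
    using T by (auto simp: toplinear_iso_def U_def)
  have TU: "T (U w) = w" and UT: "U (T y) = y" for w y
    using bij by (simp_all add: U_def bij_is_surj surj_f_inv_f bij_is_inj)
  have lT: "linear T" and lU: "linear U" using bT bU by (auto intro: bounded_linear.linear)
  \<comment> \<open>Scaling the coordinates by \<open>t\<close> makes the embedding \<open>j\<close> of \<open>Z\<close> a contraction.\<close>
  define t where "t = 1 + onorm U"
  have t: "1 \<le> t" "t > 0" using onorm_pos_le[OF bU] by (auto simp: t_def)
  have U_le: "norm (U w) \<le> t * norm w" for w
    using onorm[OF bU, of w] by (simp add: t_def distrib_right add_increasing)
  define I where "I y = U (- snd (T y), fst (T y))" for y
  define conj where "conj y = U (fst (T y), - snd (T y))" for y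
  define a where "a y = t *\<^sub>R fst (T y)" for y
  define b where "b y = t *\<^sub>R snd (T y)" for y
  define j where "j z = U ((1 / t) *\<^sub>R z, 0)" for z
  have bfs: "bounded_linear (\<lambda>y. fst (T y))" "bounded_linear (\<lambda>y. snd (T y))"
    using bounded_linear_compose[OF bounded_linear_fst bT] bounded_linear_compose[OF bounded_linear_snd bT] by auto
  have bI: "bounded_linear I" unfolding I_def
    by (intro bounded_linear_compose[OF bU] bounded_linear_Pair bounded_linear_minus bfs)
  have bconj: "bounded_linear conj" unfolding conj_def
    by (intro bounded_linear_compose[OF bU] bounded_linear_Pair bounded_linear_minus bfs)
  have ba: "bounded_linear a" "bounded_linear b" unfolding a_def b_def
    by (intro bounded_linear_compose[OF bounded_linear_scaleR_right] bfs)+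
  have II: "I (I y) = - y" for y
  proof -
    have "I (I y) = U (- T y)" by (simp add: I_def TU prod_eq_iff uminus_prod_def)
    then show ?thesis using linear_neg[OF lU] by (simp add: UT)
  qed
  define C where "C = 2 + t * onorm T + onorm I + t"
  have oT: "0 \<le> onorm T" and oI: "0 \<le> onorm I" using onorm_pos_le bT bI by auto
  have tT: "0 \<le> t * onorm T" using oT t by simp
  have ab_T: "norm (a y) \<le> C * norm y" "norm (b y) \<le> C * norm y" for y
  proof -
    have "t * norm (T y) \<le> t * (onorm T * norm y)" using onorm[OF bT, of y] t by (intro mult_left_mono) auto
    moreover have "(t * onorm T) * norm y \<le> C * norm y"
      using oI t by (intro mult_right_mono) (auto simp: C_def)
    ultimately have 1: "t * norm (T y) \<le> C * norm y" by simp
    have "norm (fst (T y)) \<le> norm (T y)" "norm (snd (T y)) \<le> norm (T y)"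
      by (metis norm_fst_le prod.collapse, metis norm_snd_le prod.collapse)
    then show "norm (a y) \<le> C * norm y" "norm (b y) \<le> C * norm y"
      using 1 t mult_left_mono[of _ "norm (T y)" t] unfolding a_def b_def norm_scaleR by (smt (verit))+
  qed
  have J: "complex_or_trivial (\<lambda>_ :: 'z. 0 :: 'z)" by (intro complex_or_trivial.intro bounded_linear_zero) simp
  interpret J: complex_or_trivial "\<lambda>_ :: 'z. 0 :: 'z" by (rule J)
  interpret complexification "\<lambda>_ :: 'z. 0 :: 'z" I a b j C
  proof (rule complexification.intro[OF J complexification_axioms.intro])
    show "norm (j z) \<le> norm z" for z
      using U_le[of "((1 / t) *\<^sub>R z, 0)"] t by (simp add: j_def norm_Pair)
    show "norm (I y) \<le> C * norm y" for y
    proof -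
      have "norm (I y) \<le> onorm I * norm y" by (rule onorm[OF bI])
      also have "\<dots> \<le> C * norm y" using tT t by (intro mult_right_mono) (auto simp: C_def)
      finally show ?thesis .
    qed
    show "norm y \<le> C * max (norm (a y)) (norm (b y))" for y
    proof -
      have "norm y \<le> t * norm (T y)" using U_le[of "T y"] by (simp add: UT)
      also have "\<dots> \<le> t * (norm (fst (T y)) + norm (snd (T y)))"
        using norm_Pair_le[of "fst (T y)" "snd (T y)"] t by (intro mult_left_mono) auto
      also have "\<dots> = norm (a y) + norm (b y)" using t by (simp add: a_def b_def distrib_left)
      also have "\<dots> \<le> 2 * max (norm (a y)) (norm (b y))" by simp
      also have "\<dots> \<le> C * max (norm (a y)) (norm (b y))"
        using tT oI t by (intro mult_right_mono) (auto simp: C_def le_max_iff_disj)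
      finally show ?thesis .
    qed
  qed (use bI ba II ab_T t in \<open>auto simp: a_def b_def j_def I_def TU\<close>)
  obtain S D where S: "biorthogonal (\<lambda>_ :: 'z. 0) S" and D: "1 \<le> D" "\<And>p y. p \<in> S \<Longrightarrow> \<bar>snd p y\<bar> \<le> D * norm y"
    and G: "\<And>A. finite A \<Longrightarrow> \<exists>g. (\<forall>p\<in>S - A. bounded_linear (g p) \<and> (\<forall>y. \<bar>g p y\<bar> \<le> norm y)) \<and>
       (\<forall>y. (\<forall>p\<in>S. snd p y = 0 \<and> snd p 0 = 0) \<longrightarrow> (\<forall>p\<in>S - A. g p y = 0 \<and> g p 0 = 0) \<longrightarrow> y = (0 :: 'z))"
    by (rule J.total_biorthogonal_system) blast
  have conj_invariant_norm: "\<exists>N :: 'a \<Rightarrow> real. equivalent_norm N \<and> isometric_complex_structures N = {I, \<lambda>y. - I y} \<and> (\<forall>y. N (conj y) = N y)"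
  proof (cases "S = {}")
    case True
    \<comment> \<open>An empty total system means that the space is zero, and then any norm will do.\<close>
    have "z = 0" for z :: 'z using G[of "{}"] True by auto
    then have "T y = 0" for y by (simp add: prod_eq_iff)
    then have "y = U 0" for y using UT[of y] by simp
    then have triv: "y = z" for y z :: 'a by metis
    then have all_eq: "J = I" for J by (auto simp: fun_eq_iff)
    have "equivalent_norm (norm :: 'a \<Rightarrow> real)"
      unfolding equivalent_norm_def by (auto intro!: norm_triangle_ineq exI[of _ 1])
    moreover have "linear J" for J :: "'a \<Rightarrow> 'a" by (intro linearI) (rule triv)+
    moreover have same_norm: "norm y = norm z" for y z :: 'a by (rule arg_cong[OF triv])
    ultimately have "I \<in> isometric_complex_structures norm"
      unfolding isometric_complex_structures_def linear_isometry_def using II by blast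
    have "isometric_complex_structures norm = {I, \<lambda>y. - I y}"
    proof (rule set_eqI)
      fix J :: "'a \<Rightarrow> 'a"
      have "J = I" by (rule all_eq)
      then show "J \<in> isometric_complex_structures norm \<longleftrightarrow> J \<in> {I, \<lambda>y. - I y}"
        using \<open>I \<in> isometric_complex_structures norm\<close> by simp
    qed
    then show ?thesis by (intro exI[of _ norm] conjI allI \<open>equivalent_norm norm\<close> same_norm)
  next
    case False
    then obtain e where e: "e \<in> S" by blast
    have fin_e: "finite {e}" by simp
    obtain g0 where g0': "(\<forall>p\<in>S - {e}. bounded_linear (g0 p) \<and> (\<forall>y. \<bar>g0 p y\<bar> \<le> norm y)) \<and>
        (\<forall>y. (\<forall>p\<in>S. snd p y = 0 \<and> snd p 0 = 0) \<longrightarrow> (\<forall>p\<in>S - {e}. g0 p y = 0 \<and> g0 p 0 = 0) \<longrightarrow> y = (0 :: 'z))"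
      using G[OF fin_e] by (rule exE)
    have g0: "\<And>p. p \<in> S - {e} \<Longrightarrow> bounded_linear (g0 p)" "\<And>p y. p \<in> S - {e} \<Longrightarrow> \<bar>g0 p y\<bar> \<le> norm y"
      "\<And>y. (\<forall>p\<in>S. snd p y = 0 \<and> snd p 0 = 0) \<Longrightarrow>
        (\<forall>p\<in>S - {e}. g0 p y = 0 \<and> g0 p 0 = 0) \<Longrightarrow> y = (0 :: 'z)"
      using g0' by blast+
    have bo: "lift (snd p) (j (fst e)) = of_bool (p = e)" if "p \<in> S" for p
      using biorthogonalD(4,5)[OF S that e] by (simp add: lift_def a_j b_j complex_eq_iff)
    obtain g Q C' \<epsilon> \<eta> where frame: "rigid_frame I S {e} e (\<lambda>p. j (fst p)) (\<lambda>p. lift (snd p)) g {lift (snd e)} Q C' \<epsilon> \<eta>"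
      and lifts: "\<And>p. p \<in> S - {e} \<Longrightarrow> \<exists>h. linear h \<and> g p = lift h" "\<And>\<phi>. \<phi> \<in> Q \<Longrightarrow> \<exists>h. linear h \<and> \<phi> = lift h"
    proof (rule rigid_frame_exists[OF S D g0, where e = e and V = "{lift (snd e)}"])
      show "\<exists>z. norm z \<le> 2 * (1 + C) \<and> (\<forall>p\<in>S - {e}. lift (snd p) z = 0) \<and>
          (\<forall>q\<in>{e}. cmod (lift (snd q) z) \<le> 1) \<and> 1 \<le> cmod (v z) \<and> (\<forall>w\<in>{lift (snd e)} - {v}. cmod (w z) < cmod (v z))"
        if "v \<in> {lift (snd e)}" for v
      proof (intro exI conjI)
        have "norm (j (fst e)) \<le> 1" using norm_j[of "fst e"] biorthogonalD(3)[OF S e] by simp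
        then show "norm (j (fst e)) \<le> 2 * (1 + C)" using tT oI t by (simp add: C_def)
      qed (use that bo e in auto)
      show "\<exists>\<alpha>. (\<forall>q\<in>{e}. cmod (\<alpha> q) \<le> 1) \<and> v = (\<lambda>y. \<Sum>q\<in>{e}. \<alpha> q * lift (snd q) y)"
        if "v \<in> {lift (snd e)}" for v
        using that by (intro exI[of _ "\<lambda>_. 1"]) auto
    qed (use e in auto)
    interpret F: rigid_frame I S "{e}" e "\<lambda>p. j (fst p)" "\<lambda>p. lift (snd p)" g "{lift (snd e)}" Q C' \<epsilon> \<eta>
      by (rule frame)
    have cnj: "lift h (conj y) = cnj (lift h y)" if "linear h" for h y
      using linear_neg[OF that] by (simp add: lift_def conj_def a_def b_def TU complex_eq_iff)
    have lc: "lift (snd p) (conj y) = cnj (lift (snd p) y)" if "p \<in> S" for p y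
      by (rule cnj[OF biorthogonalD(2)[OF S that]])
    have \<Phi>: "cmod (\<phi> (conj y)) = cmod (\<phi> y)" if "\<phi> \<in> F.\<Phi>" for \<phi> y
      using that
    proof (cases rule: F.\<Phi>_cases)
      case 1
      then show ?thesis using lifts(2) cnj by fastforce
    next
      case (2 p)
      then show ?thesis using lc[of p] by simp
    next
      case (3 p)
      then obtain h where "linear h" "g p = lift h" using lifts(1) by blast
      then have "F.l p (conj y) = cnj (F.l p y)"
        using 3 lc[of p] lc[OF e] cnj[of h] by (simp add: F.l_def)
      then show ?thesis using 3 by simp
    qed
    have "F.N (conj y) = F.N y" for y
    proof -
      have "sup_abs F.\<Phi> (conj y) = sup_abs F.\<Phi> y" by (rule sup_abs_cong) (rule \<Phi>)
      moreover have "sup_abs {lift (snd e)} (conj y) = sup_abs {lift (snd e)} y"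
        by (rule sup_abs_cong) (use lc[OF e] in auto)
      moreover have "F.k (conj y) = F.k y" using lc[OF e] by (simp add: F.k_def)
      ultimately show ?thesis by (simp add: F.N_def F.R_def)
    qed
    then show ?thesis using F.equivalent_norm_N F.structures_eq by blast
  qed
  then obtain N :: "'a \<Rightarrow> real" where N: "equivalent_norm N"
    "isometric_complex_structures N = {I, \<lambda>y. - I y}" "\<And>y. N (conj y) = N y" by blast
  have "conj (conj y) = y" for y by (simp add: conj_def TU UT)
  then have "surj conj" by (rule surjI)
  moreover have "linear conj" using bconj by (rule bounded_linear.linear)
  moreover have "conj (I y) = - I (conj y)" for y
  proof -
    have "conj (I y) = U (- snd (T y), - fst (T y))" by (simp add: conj_def I_def TU)
    also have "\<dots> = U (- (snd (T y), fst (T y)))" by simp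
    also have "\<dots> = - U (snd (T y), fst (T y))" by (rule linear_neg[OF lU])
    finally show ?thesis by (simp add: conj_def I_def TU)
  qed
  ultimately have "(I, \<lambda>y. - I y) \<in> isometric_structs_rel N"
    unfolding isometric_structs_rel_def linear_isometry_def using N(2,3) by blast
  then show ?thesis using card_structures_one[OF N(1,2)] N(1) by blast
qed

theorem theorem24:
  shows "(dim_ge 4 (UNIV :: 'a::banach set) \<and> admits_complex_structure TYPE('a) \<longrightarrow>
            (\<exists>N :: 'a \<Rightarrow> real. equivalent_norm N \<and> card (complex_structures_upto_isometry N) = 2))
       \<and> ((\<exists>T :: 'a \<Rightarrow> 'z::banach \<times> 'z. toplinear_iso T) \<longrightarrow>
            (\<exists>N :: 'a \<Rightarrow> real. equivalent_norm N \<and> card (complex_structures_upto_isometry N) = 1))"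
  using exactly_two_structures unique_structure by blast

end
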